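(* Let $n\geq 1$ be an integer. (i) With probability $1$, for any integer $M$ there are (infinitely many) levels $i\geq M$ and $j\leq -M$ such that the aggregate $A_n^*[\infty]$ does not intersect the axes $\mathbb{Z}\times\{i\}$ and $\mathbb{Z}\times\{j\}$. In particular, almost surely $A_n^*[\infty]$ has only finite connected components, included in disjoint strips. (ii) The same holds for $A_n^\dag[\infty]$.
   Context: Let $(S_{i,j})_{i\in\mathbb{Z},j\geq1}$ be independent simple symmetric random walks on $\mathbb{Z}^2$, $S_{i,j}$ starting at $(0,i)$. When the current aggregate is $A\subset\mathbb{Z}^2$, sending particle $(i,j)$ (from level $i$) means: follow $S_{i,j}$ until the first time (possibly time $0$) it is at a site $z\notin A$; the particle stops there and the aggregate becomes $A\cup\{z\}$. Let $(N_i)_{i\in\mathbb{Z}}$ be i.i.d. Poisson random variables with parameter $n$, independent of the walks. $A_n^*[M]$ ($M\geq0$) is the aggregate obtained from $\emptyset$ by sending $N_i$ particles from each level $i$ with $|i|\leq M$, levels being treated in the usual order $0,1,-1,2,-2,\dots,M,-M$; $A_n^*[\infty]=\bigcup_{M\geq0}A_n^*[M]$ (increasing union). Let $(\mathcal{N}_i)_{i\in\mathbb{Z}}$ be i.i.d. Poisson point processes on $\mathbb{R}^+$ with intensity $1$, independent of the walks, and let $T_{i,1}<T_{i,2}<\dots$ be the points of $\mathcal{N}_i$. $A_n^\dag[M]$ is the aggregate obtained from $\emptyset$ by sending, in increasing order of the times $T_{i,j}$ (a.s. distinct), all particles $(i,j)$ with $|i|\leq M$ and $T_{i,j}\leq n$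 (trajectories are realized instantaneously); $A_n^\dag[\infty]=\bigcup_{M\geq0}A_n^\dag[M]$ (increasing union). A set $C\subset\mathbb{Z}^2$ is connected if any two of its points can be joined by a path in $C$ whose successive sites are at $\ell^1$-distance $1$. *)

theory Defs
  imports "HOL-Probability.Probability"
begin

section \<open>Simple random walks on the square lattice\<close>

type_synonym site = "int \<times> int"

type_synonym path = "nat \<Rightarrow> site"

definition path_space :: "path measure" where
  "path_space = PiM UNIV (\<lambda>_. count_space UNIV)"

definition simple_random_walk :: "'a measure \<Rightarrow> site \<Rightarrow> ('a \<Rightarrow> path) \<Rightarrow> bool" where
  "simple_random_walk P x X \<longleftrightarrow>
     X \<in> P \<rightarrow>\<^sub>M path_space \<and>
     (AE \<omega> in P. X \<omega> 0 = x) \<and>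
     prob_space.indep_vars P (\<lambda>_. count_space UNIV) (\<lambda>t \<omega>. X \<omega> (Suc t) - X \<omega> t) UNIV \<and>
     (\<forall>t. distr P (count_space UNIV) (\<lambda>\<omega>. X \<omega> (Suc t) - X \<omega> t)
           = measure_pmf (pmf_of_set {(1, 0), (-1, 0), (0, 1), (0, -1)}))"

text \<open>A particle \<open>(i, j)\<close> is the \<open>j\<close>-th one (\<open>j \<ge> 1\<close>) of level \<open>i\<close>.\<close>

definition particles :: "(int \<times> nat) set" where
  "particles = UNIV \<times> {1..}"

definition independent_walks :: "'a measure \<Rightarrow> (int \<Rightarrow> nat \<Rightarrow> 'a \<Rightarrow> path) \<Rightarrow> bool" where
  "independent_walks P S \<longleftrightarrow>
     (\<forall>(i, j) \<in> particles. simple_random_walk P (0, i) (S i j)) \<and>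
     prob_space.indep_vars P (\<lambda>_. path_space) (\<lambda>(i, j). S i j) particles"


section \<open>Sources of particles\<close>

text \<open>The library's \<open>indep_var\<close> requires both variables to have values in the same type.\<close>

definition indep_rvs ::
  "'a measure \<Rightarrow> 'b measure \<Rightarrow> ('a \<Rightarrow> 'b) \<Rightarrow> 'c measure \<Rightarrow> ('a \<Rightarrow> 'c) \<Rightarrow> bool" where
  "indep_rvs P M X N Y \<longleftrightarrow>
     X \<in> P \<rightarrow>\<^sub>M M \<and> Y \<in> P \<rightarrow>\<^sub>M N \<and>
     prob_space.indep_set P (sets (vimage_algebra (space P) X M))
                            (sets (vimage_algebra (space P) Y N))"

definition indep_of_walks ::
  "'a measure \<Rightarrow> (int \<Rightarrow> nat \<Rightarrow> 'a \<Rightarrow> path) \<Rightarrow> 'b measure \<Rightarrow> (int \<Rightarrow> 'a \<Rightarrow> 'b) \<Rightarrow> bool" where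
  "indep_of_walks P S M X \<longleftrightarrow>
     indep_rvs P (PiM particles (\<lambda>_. path_space)) (\<lambda>\<omega>. \<lambda>(i, j)\<in>particles. S i j \<omega>)
                 (PiM UNIV (\<lambda>_. M)) (\<lambda>\<omega> i. X i \<omega>)"

text \<open>
  The mass function is written out because \<open>poisson_pmf\<close> is only specified for positive
  rates, whereas the number of points of a Poisson process in a null set has rate \<open>0\<close>.
\<close>

definition poisson_distributed :: "'a measure \<Rightarrow> ('a \<Rightarrow> nat) \<Rightarrow> real \<Rightarrow> bool" where
  "poisson_distributed P X r \<longleftrightarrow>
     X \<in> P \<rightarrow>\<^sub>M count_space UNIV \<and>
     (\<forall>k. measure P {\<omega> \<in> space P. X \<omega> = k} = r ^ k / fact k * exp (- r))"

definition poisson_levels ::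
  "'a measure \<Rightarrow> (int \<Rightarrow> nat \<Rightarrow> 'a \<Rightarrow> path) \<Rightarrow> real \<Rightarrow> (int \<Rightarrow> 'a \<Rightarrow> nat) \<Rightarrow> bool" where
  "poisson_levels P S r N \<longleftrightarrow>
     (\<forall>i. poisson_distributed P (N i) r) \<and>
     prob_space.indep_vars P (\<lambda>_. count_space UNIV) N UNIV \<and>
     indep_of_walks P S (count_space UNIV) N"

text \<open>
  A point process on \<open>{0..}\<close> is a random locally finite set of nonnegative reals; the
  sigma-algebra is generated by the numbers of points in bounded Borel sets.
\<close>

definition bounded_borel :: "real set set" where
  "bounded_borel = {B \<in> sets borel. bounded B \<and> B \<subseteq> {0..}}"

definition configurations :: "real set measure" where
  "configurations =
     sigma {\<xi>. \<xi> \<subseteq> {0..} \<and> (\<forall>t. finite (\<xi> \<inter> {..t}))}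
           {{\<xi>. \<xi> \<subseteq> {0..} \<and> (\<forall>t. finite (\<xi> \<inter> {..t})) \<and> card (\<xi> \<inter> B) = k} | B k.
              B \<in> bounded_borel}"

definition poisson_process :: "'a measure \<Rightarrow> ('a \<Rightarrow> real set) \<Rightarrow> bool" where
  "poisson_process P \<Xi> \<longleftrightarrow>
     \<Xi> \<in> P \<rightarrow>\<^sub>M configurations \<and>
     (\<forall>B \<in> bounded_borel. poisson_distributed P (\<lambda>\<omega>. card (\<Xi> \<omega> \<inter> B)) (measure lborel B)) \<and>
     (\<forall>B :: nat \<Rightarrow> real set. range B \<subseteq> bounded_borel \<and> disjoint_family B \<longrightarrow>
        prob_space.indep_vars P (\<lambda>_. count_space UNIV) (\<lambda>k \<omega>. card (\<Xi> \<omega> \<inter> B k)) UNIV)"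

definition poisson_clocks ::
  "'a measure \<Rightarrow> (int \<Rightarrow> nat \<Rightarrow> 'a \<Rightarrow> path) \<Rightarrow> (int \<Rightarrow> 'a \<Rightarrow> real set) \<Rightarrow> bool" where
  "poisson_clocks P S \<Xi> \<longleftrightarrow>
     (\<forall>i. poisson_process P (\<Xi> i)) \<and>
     prob_space.indep_vars P (\<lambda>_. configurations) \<Xi> UNIV \<and>
     indep_of_walks P S configurations \<Xi>"

text \<open>The \<open>j\<close>-th smallest point, \<open>j \<ge> 1\<close>; meaningful if there are at least \<open>j\<close> points.\<close>

definition nth_point :: "real set \<Rightarrow> nat \<Rightarrow> real" where
  "nth_point \<xi> j = (THE x. x \<in> \<xi> \<and> card (\<xi> \<inter> {..x}) = j)"


section \<open>Aggregates\<close>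

text \<open>
  The aggregate is unchanged by a particle which never leaves it; for the finite
  aggregates below this has probability \<open>0\<close>.
\<close>

definition send :: "site set \<Rightarrow> path \<Rightarrow> site set" where
  "send A w = (if \<exists>t. w t \<notin> A then insert (w (LEAST t. w t \<notin> A)) A else A)"

text \<open>Below, \<open>w i j\<close> is a realisation of the trajectory of the particle \<open>(i, j)\<close>.\<close>

definition send_all :: "(int \<Rightarrow> nat \<Rightarrow> path) \<Rightarrow> (int \<times> nat) list \<Rightarrow> site set" where
  "send_all w ps = foldl (\<lambda>A (i, j). send A (w i j)) {} ps"

text \<open>The usual order \<open>0, 1, -1, 2, -2, \<dots>, M, -M\<close>.\<close>

definition usual_levels :: "nat \<Rightarrow> int list" where
  "usual_levels M = 0 # concat (map (\<lambda>k. [int k, - int k]) [1..<Suc M])"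

definition star_aggregate_upto ::
  "(int \<Rightarrow> nat \<Rightarrow> path) \<Rightarrow> (int \<Rightarrow> nat) \<Rightarrow> nat \<Rightarrow> site set" where
  "star_aggregate_upto w N M =
     send_all w (concat (map (\<lambda>i. map (\<lambda>j. (i, j)) [1..<Suc (N i)]) (usual_levels M)))"

definition star_aggregate :: "(int \<Rightarrow> nat \<Rightarrow> path) \<Rightarrow> (int \<Rightarrow> nat) \<Rightarrow> site set" where
  "star_aggregate w N = (\<Union>M. star_aggregate_upto w N M)"

text \<open>
  Here \<open>T i j\<close> is the time at which \<open>(i, j)\<close> is sent. The list of particles is the intended
  one when the particles involved are finitely many and have distinct times, which holds
  almost surely for Poisson processes.
\<close>

definition dagger_aggregate_upto ::
  "(int \<Rightarrow> nat \<Rightarrow> path) \<Rightarrow> (int \<Rightarrow> nat \<Rightarrow> real) \<Rightarrow> real \<Rightarrow> nat \<Rightarrow> site set" where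
  "dagger_aggregate_upto w T n M =
     send_all w (sorted_key_list_of_set (\<lambda>(i, j). T i j)
       {(i, j) \<in> particles. \<bar>i\<bar> \<le> int M \<and> T i j \<le> n})"

definition dagger_aggregate ::
  "(int \<Rightarrow> nat \<Rightarrow> path) \<Rightarrow> (int \<Rightarrow> nat \<Rightarrow> real) \<Rightarrow> real \<Rightarrow> site set" where
  "dagger_aggregate w T n = (\<Union>M. dagger_aggregate_upto w T n M)"


section \<open>Geometry of aggregates\<close>

definition l1_dist :: "site \<Rightarrow> site \<Rightarrow> int" where
  "l1_dist x y = \<bar>fst x - fst y\<bar> + \<bar>snd x - snd y\<bar>"

definition lattice_connected :: "site set \<Rightarrow> bool" where
  "lattice_connected C \<longleftrightarrow>
     (\<forall>x\<in>C. \<forall>y\<in>C. \<exists>p. p \<noteq> [] \<and> hd p = x \<and> last p = y \<and> set p \<subseteq> C \<and>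
        successively (\<lambda>u v. l1_dist u v = 1) p)"

definition lattice_components :: "site set \<Rightarrow> site set set" where
  "lattice_components A =
     {C. C \<noteq> {} \<and> C \<subseteq> A \<and> lattice_connected C \<and>
         (\<forall>D. C \<subseteq> D \<and> D \<subseteq> A \<and> lattice_connected D \<longrightarrow> D = C)}"

definition misses_level :: "site set \<Rightarrow> int \<Rightarrow> bool" where
  "misses_level A i \<longleftrightarrow> A \<inter> (UNIV \<times> {i}) = {}"

text \<open>Horizontal strips of finite width.\<close>

definition strips :: "site set set" where
  "strips = {UNIV \<times> {a..b} | a b. a \<le> b}"

text \<open>Several components may lie in the same strip.\<close>

definition components_in_disjoint_strips :: "site set \<Rightarrow> bool" where
  "components_in_disjoint_strips A \<longleftrightarrow>
     (\<exists>\<S> \<subseteq> strips. disjoint \<S> \<and> (\<forall>C \<in> lattice_components A. \<exists>R\<in>\<S>. C \<subseteq> R))"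

end

theory Submission
  imports Defs "HOL-Library.Sublist"
begin

text \<open>
  Fix a level \<open>a\<close>, condition on the order in which the particles are sent, and call a particle
  from level \<open>i\<close> straying if it moves vertically by more than \<open>\<bar>i - a\<bar> / 2\<close> before it settles.
  Until the first straying particle, sites at distance of order \<open>D\<close> from \<open>a\<close> are only filled by
  particles from distances of order \<open>D\<close>, so if the numbers of particles around \<open>a\<close> grow linearly,
  a particle from distance \<open>D\<close> sees an aggregate with boundedly many sites on a positive
  fraction of the levels it has to cross. On each of those it has a probability bounded away from
  \<open>0\<close> to leave the aggregate horizontally, so it strays with probability exponentially small
  in \<open>D\<close>, whatever the order. If the block of radius \<open>R\<close> around \<open>a\<close> emits no particle, then \<open>a\<close> is
  visited with conditional probability tending to \<open>0\<close> as \<open>R\<close> grows, and there are infinitely many such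
  blocks for every \<open>R\<close>. Neither translation invariance nor the abelian property is needed, and
  the two aggregates are treated alike. Finally, no particle can cross a missed level,
  hence only finitely many sites lie between two of them.
\<close>

section \<open>Random walks in thin sets\<close>

text \<open>The obstacle is dependence: each particle moves in an aggregate built by the others, and
  one aggregate serves all candidate levels. Once the list of particles is fixed, the aggregate met
  by a particle is a function of the earlier walks, hence independent of its own walk, and union
  bounds over the list suffice. They cannot be applied to straying alone, since one straying
  particle may crowd the surroundings of the next; each event of the union therefore also records
  that the aggregate is still thin.

  A vacant block of radius \<open>R\<close> has probability
  \<open>exp (- real n) ^ (2 * R + 1)\<close>, so every error has to be small relative to that
  number; hence the density estimate is made jointly with vacancy and not by itself. Visits to the
  centres of different blocks are dependent, so blocks cannot be treated as independent trials. Only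
  their vacancy is: the number of blocks is taken inversely proportional to the probability of
  vacancy, and visited centres are handled through their expected number.\<close>

definition steps :: "site set" where
  "steps = {(1, 0), (-1, 0), (0, 1), (0, -1)}"

lemma finite_steps [simp]: "finite steps"
  and card_steps: "card steps = 4"
  and steps_nonempty: "steps \<noteq> {}"
  by (simp_all add: steps_def)

lemma sum_steps:
  "(\<Sum>e\<in>steps. f e) = f (1, 0) + f (-1, 0) + f (0, 1) + (f (0, -1) :: 'b :: comm_monoid_add)"
  by (simp add: steps_def add.assoc)

text \<open>One predicate serves two purposes: with \<open>B\<close> a single site it locates where
  a particle settles, with \<open>B\<close> a half-plane or the outside of a strip it expresses a
  long vertical displacement.\<close>

definition hits_within :: "site set \<Rightarrow> site set \<Rightarrow> path \<Rightarrow> bool" where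
  "hits_within A B w \<longleftrightarrow> (\<exists>t. w t \<in> B \<and> (\<forall>s<t. w s \<in> A))"

lemma simple_random_walk_steps:
  assumes "prob_space P" "simple_random_walk P x X"
  shows "AE \<omega> in P. \<forall>t. X \<omega> (Suc t) - X \<omega> t \<in> steps"
proof -
  interpret prob_space P by fact
  have "AE \<omega> in P. X \<omega> (Suc t) - X \<omega> t \<in> steps" for t
  proof -
    have d: "distr P (count_space UNIV) (\<lambda>\<omega>. X \<omega> (Suc t) - X \<omega> t) = measure_pmf (pmf_of_set steps)"
      using assms(2) by (simp add: simple_random_walk_def steps_def)
    have m: "(\<lambda>\<omega>. X \<omega> (Suc t) - X \<omega> t) \<in> P \<rightarrow>\<^sub>M count_space UNIV"
      using assms(2) by (simp add: simple_random_walk_def indep_vars_def2)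
    have "AE y in distr P (count_space UNIV) (\<lambda>\<omega>. X \<omega> (Suc t) - X \<omega> t). y \<in> steps"
      unfolding d by (auto simp: AE_measure_pmf_iff set_pmf_of_set steps_nonempty)
    then show ?thesis
      using AE_distrD[OF m] by fast
  qed
  then show ?thesis
    by (simp add: AE_all_countable)
qed

lemma path_component_measurable [measurable]:
  "(\<lambda>w. w t) \<in> path_space \<rightarrow>\<^sub>M count_space UNIV"
  unfolding path_space_def by (rule measurable_component_singleton) simp

lemma pred_hits_within [measurable]: "Measurable.pred path_space (hits_within A B)"
  unfolding hits_within_def[abs_def] by measurable

text \<open>The Markov property in cylinder form: fixing the past to a deterministic trajectory
  \<open>y\<close> reduces it to a product formula for increments, with no conditional expectation.
  A \<open>y\<close> with a forbidden step gives 0 on both sides.\<close>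

lemma simple_random_walk_extend:
  assumes "prob_space P" "simple_random_walk P x X" "e \<in> steps" "y 0 = x"
  shows "measure P {\<omega> \<in> space P. (\<forall>s\<le>k. X \<omega> s = y s) \<and> X \<omega> (Suc k) = y k + e}
       = measure P {\<omega> \<in> space P. \<forall>s\<le>k. X \<omega> s = y s} / 4"
proof -
  interpret prob_space P by fact
  have X[measurable]: "X \<in> P \<rightarrow>\<^sub>M path_space"
    and X0: "AE \<omega> in P. X \<omega> 0 = x"
    and ind: "indep_vars (\<lambda>_. count_space UNIV) (\<lambda>t \<omega>. X \<omega> (Suc t) - X \<omega> t) UNIV"
    and d: "\<And>t. distr P (count_space UNIV) (\<lambda>\<omega>. X \<omega> (Suc t) - X \<omega> t) = measure_pmf (pmf_of_set steps)"
    using assms(2) by (auto simp: simple_random_walk_def steps_def)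
  have Xt[measurable]: "(\<lambda>\<omega>. X \<omega> t) \<in> P \<rightarrow>\<^sub>M count_space UNIV" for t
    using measurable_compose[OF X path_component_measurable] .
  have m: "(\<lambda>\<omega>. X \<omega> (Suc t) - X \<omega> t) \<in> P \<rightarrow>\<^sub>M count_space UNIV" for t
    using ind by (simp add: indep_vars_def2)
  have pe: "prob {\<omega> \<in> space P. X \<omega> (Suc t) - X \<omega> t = e} = 1/4" for t
  proof -
    have "prob {\<omega> \<in> space P. X \<omega> (Suc t) - X \<omega> t = e}
        = measure (distr P (count_space UNIV) (\<lambda>\<omega>. X \<omega> (Suc t) - X \<omega> t)) {e}"
      using m[of t] by (subst measure_distr) (auto intro!: arg_cong[where f=prob])
    also have "\<dots> = 1/4"
      unfolding d using assms(3) by (simp add: measure_pmf_single steps_nonempty card_steps)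
    finally show ?thesis .
  qed
  \<comment> \<open>The increments of \<open>y\<close> up to time \<open>k\<close>, followed by
    \<open>e\<close>: the first \<open>k\<close> of them describe the past, all \<open>Suc k\<close>
    its extension.\<close>
  define g where "g s = (if s < k then y (Suc s) - y s else e)" for s
  have form: "prob {\<omega> \<in> space P. \<forall>s<j. X \<omega> (Suc s) - X \<omega> s = g s}
       = (\<Prod>s<j. prob {\<omega> \<in> space P. X \<omega> (Suc s) - X \<omega> s = g s})" for j
  proof (cases "j = 0")
    case True then show ?thesis by (simp add: prob_space)
  next
    case False
    have "prob (\<Inter>s\<in>{..<j}. (\<lambda>\<omega>. X \<omega> (Suc s) - X \<omega> s) -` {g s} \<inter> space P)
       = (\<Prod>s<j. prob ((\<lambda>\<omega>. X \<omega> (Suc s) - X \<omega> s) -` {g s} \<inter> space P))"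
      using False by (intro indep_varsD[OF ind]) auto
    also have "(\<Inter>s\<in>{..<j}. (\<lambda>\<omega>. X \<omega> (Suc s) - X \<omega> s) -` {g s} \<inter> space P)
       = {\<omega> \<in> space P. \<forall>s<j. X \<omega> (Suc s) - X \<omega> s = g s}"
      using False by auto
    also have "(\<lambda>s. (\<lambda>\<omega>. X \<omega> (Suc s) - X \<omega> s) -` {g s} \<inter> space P)
       = (\<lambda>s. {\<omega> \<in> space P. X \<omega> (Suc s) - X \<omega> s = g s})" by auto
    finally show ?thesis .
  qed
  have walk: "(\<forall>s\<le>j. u s = y s) \<longleftrightarrow> (\<forall>s<j. u (Suc s) - u s = g s)"
    if "u 0 = x" "j \<le> k" for u :: path and j
    using that(2)
  proof (induction j)
    case 0 then show ?case using that assms(4) by simp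
  next
    case (Suc j)
    then have "(\<forall>s\<le>Suc j. u s = y s) \<longleftrightarrow> (\<forall>s<j. u (Suc s) - u s = g s) \<and> u (Suc j) = y (Suc j)"
      by (auto simp: le_Suc_eq)
    also have "\<dots> \<longleftrightarrow> (\<forall>s<Suc j. u (Suc s) - u s = g s)"
      using Suc by (auto simp: less_Suc_eq g_def)
    finally show ?case .
  qed
  have "prob {\<omega> \<in> space P. (\<forall>s\<le>k. X \<omega> s = y s) \<and> X \<omega> (Suc k) = y k + e}
      = prob {\<omega> \<in> space P. \<forall>s<Suc k. X \<omega> (Suc s) - X \<omega> s = g s}"
  proof (rule finite_measure_eq_AE)
    show "AE \<omega> in P. \<omega> \<in> {\<omega> \<in> space P. (\<forall>s\<le>k. X \<omega> s = y s) \<and> X \<omega> (Suc k) = y k + e}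
      \<longleftrightarrow> \<omega> \<in> {\<omega> \<in> space P. \<forall>s<Suc k. X \<omega> (Suc s) - X \<omega> s = g s}"
      using X0
    proof eventually_elim
      case (elim \<omega>)
      have "(\<forall>s\<le>k. X \<omega> s = y s) \<and> X \<omega> (Suc k) = y k + e \<longleftrightarrow>
            (\<forall>s\<le>k. X \<omega> s = y s) \<and> X \<omega> (Suc k) - X \<omega> k = g k"
        by (auto simp: g_def)
      then show ?case
        using walk[of "X \<omega>" k, OF elim] by (auto simp: less_Suc_eq)
    qed
    show "{\<omega> \<in> space P. \<forall>s<Suc k. X \<omega> (Suc s) - X \<omega> s = g s} \<in> events"
      using m by measurable
  qed measurable
  also have "\<dots> = prob {\<omega> \<in> space P. \<forall>s<k. X \<omega> (Suc s) - X \<omega> s = g s} * (1/4)"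
    unfolding form using pe[of k] by (simp add: g_def)
  also have "prob {\<omega> \<in> space P. \<forall>s<k. X \<omega> (Suc s) - X \<omega> s = g s}
      = prob {\<omega> \<in> space P. \<forall>s\<le>k. X \<omega> s = y s}"
  proof (rule finite_measure_eq_AE)
    show "AE \<omega> in P. \<omega> \<in> {\<omega> \<in> space P. \<forall>s<k. X \<omega> (Suc s) - X \<omega> s = g s}
      \<longleftrightarrow> \<omega> \<in> {\<omega> \<in> space P. \<forall>s\<le>k. X \<omega> s = y s}"
      using X0 by eventually_elim (simp add: walk)
    show "{\<omega> \<in> space P. \<forall>s<k. X \<omega> (Suc s) - X \<omega> s = g s} \<in> events"
      using m by measurable
  qed measurable
  finally show ?thesis by simp
qed

text \<open>Optional stopping for the nonnegative supermartingale given by \<open>\<phi>\<close>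
  along the walk, stopped on reaching \<open>B\<close> or on leaving \<open>A\<close>; proved by
  induction on the time horizon.\<close>

lemma hits_within_prob_le:
  fixes \<phi> :: "site \<Rightarrow> real"
  assumes P: "prob_space P" and srw: "simple_random_walk P x X"
    and nonneg: "\<And>z. 0 \<le> \<phi> z"
    and target: "\<And>z. z \<in> B \<Longrightarrow> 1 \<le> \<phi> z"
    and super: "\<And>z. z \<in> A \<Longrightarrow> z \<notin> B \<Longrightarrow> (\<Sum>e\<in>steps. \<phi> (z + e)) \<le> 4 * \<phi> z"
  shows "measure P {\<omega> \<in> space P. hits_within A B (X \<omega>)} \<le> \<phi> x"
proof -
  interpret prob_space P by fact
  have X[measurable]: "X \<in> P \<rightarrow>\<^sub>M path_space"
    and X0: "AE \<omega> in P. X \<omega> 0 = x"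
    using srw by (auto simp: simple_random_walk_def)
  have Xt[measurable]: "(\<lambda>\<omega>. X \<omega> t) \<in> P \<rightarrow>\<^sub>M count_space UNIV" for t
    using measurable_compose[OF X path_component_measurable] .
  let ?pre = "\<lambda>y k \<omega>. \<forall>s\<le>k. X \<omega> s = y s"
  let ?H = "\<lambda>k T \<omega>. \<exists>t\<le>T. X \<omega> (k + t) \<in> B \<and> (\<forall>s<t. X \<omega> (k + s) \<in> A)"
  \<comment> \<open>The past is an arbitrary cylinder, so that in the induction the first step of
    the remaining walk can be moved into it, with \<open>k\<close> increased and \<open>T\<close>
    decreased by one.\<close>
  have main: "prob {\<omega> \<in> space P. ?pre y k \<omega> \<and> ?H k T \<omega>} \<le> prob {\<omega> \<in> space P. ?pre y k \<omega>} * \<phi> (y k)"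
    if "y 0 = x" for y k T
    using that
  proof (induction T arbitrary: y k)
    case 0
    show ?case
    proof (cases "y k \<in> B")
      case True
      have "prob {\<omega> \<in> space P. ?pre y k \<omega> \<and> ?H k 0 \<omega>} \<le> prob {\<omega> \<in> space P. ?pre y k \<omega>} * 1"
        by (auto intro!: finite_measure_mono)
      also have "\<dots> \<le> prob {\<omega> \<in> space P. ?pre y k \<omega>} * \<phi> (y k)"
        using target[OF True] by (intro mult_left_mono) auto
      finally show ?thesis .
    next
      case False
      then have *: "{\<omega> \<in> space P. ?pre y k \<omega> \<and> ?H k 0 \<omega>} = {}" by auto
      show ?thesis unfolding * using nonneg by simp
    qed
  next
    case (Suc T)
    consider "y k \<in> B" | "y k \<notin> B" "y k \<notin> A" | "y k \<notin> B" "y k \<in> A" by blast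
    then show ?case
    proof cases
      case 1
      have "prob {\<omega> \<in> space P. ?pre y k \<omega> \<and> ?H k (Suc T) \<omega>} \<le> prob {\<omega> \<in> space P. ?pre y k \<omega>} * 1"
        by (auto intro!: finite_measure_mono)
      also have "\<dots> \<le> prob {\<omega> \<in> space P. ?pre y k \<omega>} * \<phi> (y k)"
        using target[OF 1] by (intro mult_left_mono) auto
      finally show ?thesis .
    next
      case 2
      have "\<not> ?H k (Suc T) \<omega>" if "?pre y k \<omega>" for \<omega>
      proof
        assume "?H k (Suc T) \<omega>"
        then obtain t where t: "X \<omega> (k + t) \<in> B" "\<forall>s<t. X \<omega> (k + s) \<in> A" by blast
        show False
        proof (cases t)
          case 0 then show ?thesis using t that 2 by simp
        next
          case (Suc t') then show ?thesis using t(2)[rule_format, of 0] that 2 by simp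
        qed
      qed
      then have *: "{\<omega> \<in> space P. ?pre y k \<omega> \<and> ?H k (Suc T) \<omega>} = {}" by blast
      show ?thesis unfolding * using nonneg by simp
    next
      case 3
      let ?y = "\<lambda>e. y(Suc k := y k + e)"
      have y0: "?y e 0 = x" for e using Suc.prems by simp
      have sub: "AE \<omega> in P. \<omega> \<in> {\<omega> \<in> space P. ?pre y k \<omega> \<and> ?H k (Suc T) \<omega>} \<longrightarrow>
         \<omega> \<in> (\<Union>e\<in>steps. {\<omega> \<in> space P. ?pre (?y e) (Suc k) \<omega> \<and> ?H (Suc k) T \<omega>})"
        using simple_random_walk_steps[OF P srw]
      proof eventually_elim
        case (elim \<omega>)
        show ?case
        proof
          assume "\<omega> \<in> {\<omega> \<in> space P. ?pre y k \<omega> \<and> ?H k (Suc T) \<omega>}"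
          then obtain t where t: "\<omega> \<in> space P" "?pre y k \<omega>" "t \<le> Suc T" "X \<omega> (k + t) \<in> B"
            "\<forall>s<t. X \<omega> (k + s) \<in> A" by blast
          from t(2,4) 3 obtain t' where t': "t = Suc t'" by (cases t) auto
          let ?e = "X \<omega> (Suc k) - X \<omega> k"
          have "?pre (?y ?e) (Suc k) \<omega>" using t(2) by (auto simp: le_Suc_eq)
          moreover have "?H (Suc k) T \<omega>"
          proof (intro exI[of _ t'] conjI allI impI)
            show "t' \<le> T" "X \<omega> (Suc k + t') \<in> B" using t t' by simp_all
            fix s assume "s < t'"
            then show "X \<omega> (Suc k + s) \<in> A" using t(5)[rule_format, of "Suc s"] t' by simp
          qed
          moreover have "?e \<in> steps" using elim by blast
          ultimately show "\<omega> \<in> (\<Union>e\<in>steps. {\<omega> \<in> space P. ?pre (?y e) (Suc k) \<omega> \<and> ?H (Suc k) T \<omega>})"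
            using t(1) by blast
        qed
      qed
      have "prob {\<omega> \<in> space P. ?pre y k \<omega> \<and> ?H k (Suc T) \<omega>}
          \<le> prob (\<Union>e\<in>steps. {\<omega> \<in> space P. ?pre (?y e) (Suc k) \<omega> \<and> ?H (Suc k) T \<omega>})"
        by (rule finite_measure_mono_AE[OF sub]) (auto intro!: sets.finite_UN)
      also have "\<dots> \<le> (\<Sum>e\<in>steps. prob {\<omega> \<in> space P. ?pre (?y e) (Suc k) \<omega> \<and> ?H (Suc k) T \<omega>})"
        by (rule finite_measure_subadditive_finite) auto
      also have "\<dots> \<le> (\<Sum>e\<in>steps. prob {\<omega> \<in> space P. ?pre (?y e) (Suc k) \<omega>} * \<phi> (y k + e))"
      proof (rule sum_mono)
        fix e
        show "prob {\<omega> \<in> space P. ?pre (?y e) (Suc k) \<omega> \<and> ?H (Suc k) T \<omega>}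
            \<le> prob {\<omega> \<in> space P. ?pre (?y e) (Suc k) \<omega>} * \<phi> (y k + e)"
          using Suc.IH[of "?y e" "Suc k", OF y0] by (simp only: fun_upd_same)
      qed
      also have "\<dots> = (\<Sum>e\<in>steps. prob {\<omega> \<in> space P. ?pre y k \<omega>} / 4 * \<phi> (y k + e))"
      proof (intro sum.cong refl arg_cong2[where f="(*)"])
        fix e assume e: "e \<in> steps"
        have "{\<omega> \<in> space P. ?pre (?y e) (Suc k) \<omega>}
            = {\<omega> \<in> space P. (\<forall>s\<le>k. X \<omega> s = y s) \<and> X \<omega> (Suc k) = y k + e}"
          by (auto simp: le_Suc_eq)
        then show "prob {\<omega> \<in> space P. ?pre (?y e) (Suc k) \<omega>} = prob {\<omega> \<in> space P. ?pre y k \<omega>} / 4"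
          using simple_random_walk_extend[where y=y and k=k, OF P srw e Suc.prems] by simp
      qed
      also have "\<dots> = prob {\<omega> \<in> space P. ?pre y k \<omega>} / 4 * (\<Sum>e\<in>steps. \<phi> (y k + e))"
        by (simp add: sum_distrib_left)
      also have "\<dots> \<le> prob {\<omega> \<in> space P. ?pre y k \<omega>} / 4 * (4 * \<phi> (y k))"
        using super[OF 3(2,1)] by (intro mult_left_mono) auto
      finally show ?thesis by simp
    qed
  qed
  have fin: "prob {\<omega> \<in> space P. ?H 0 T \<omega>} \<le> \<phi> x" for T
  proof -
    have "prob {\<omega> \<in> space P. ?H 0 T \<omega>} = prob {\<omega> \<in> space P. ?pre (\<lambda>_. x) 0 \<omega> \<and> ?H 0 T \<omega>}"
      using X0 by (intro finite_measure_eq_AE) auto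
    also have "\<dots> \<le> prob {\<omega> \<in> space P. ?pre (\<lambda>_. x) 0 \<omega>} * \<phi> x"
      by (rule main) simp
    also have "\<dots> \<le> 1 * \<phi> x" by (intro mult_right_mono) (auto simp: nonneg)
    finally show ?thesis by simp
  qed
  have "(\<lambda>T. prob {\<omega> \<in> space P. ?H 0 T \<omega>}) \<longlonglongrightarrow> prob (\<Union>T. {\<omega> \<in> space P. ?H 0 T \<omega>})"
    by (intro finite_Lim_measure_incseq) (auto simp: incseq_def intro: order_trans)
  also have "(\<Union>T. {\<omega> \<in> space P. ?H 0 T \<omega>}) = {\<omega> \<in> space P. hits_within A B (X \<omega>)}"
    by (auto simp: hits_within_def)
  finally show ?thesis
    by (rule LIMSEQ_le_const2) (use fin in blast)
qed

text \<open>
  On a level with at most \<open>R\<close> sites of \<open>A\<close>, a walker leaves \<open>A\<close> by walking straight to the right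
  with probability at least \<open>(1/4) ^ R\<close>. The function \<open>\<phi>\<close> below turns this into a
  superharmonic majorant of the crossing probability.
\<close>

lemma crossing_prob_le:
  fixes \<sigma> i :: int and R h :: nat and A :: "site set"
  defines "L \<equiv> \<lambda>z :: site. \<sigma> * (snd z - i)"
  assumes P: "prob_space P" and srw: "simple_random_walk P (x, i) X"
    and \<sigma>: "\<sigma> = 1 \<or> \<sigma> = -1" and A: "finite A"
  shows "measure P {\<omega> \<in> space P. hits_within A {z. int h \<le> L z} (X \<omega>)}
           \<le> (1 - (1/4) ^ R) ^ card {y \<in> {0..<int h}. card {z \<in> A. L z = y} \<le> R}"
proof -
  define sl where "sl y = {z \<in> A. L z = y}" for y
  define G where "G = {y \<in> {0..<int h}. card (sl y) \<le> R}"
  define \<rho> :: real where "\<rho> = 1 - (1/4) ^ R"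
  \<comment> \<open>The bound for a walk at height \<open>y\<close>: one factor
    \<open>\<rho>\<close> for each thin level still to be crossed, \<open>y\<close>
    included.\<close>
  define c where "c y = \<rho> ^ card (G \<inter> {y..})" for y
  \<comment> \<open>The number of steps to the right needed to leave \<open>A\<close>; it is 0
    exactly for \<open>z\<close> outside \<open>A\<close>.\<close>
  define r where "r z = (LEAST r. z + (int r, 0) \<notin> A)" for z
  \<comment> \<open>On a thin level, \<open>(1/4) ^ r z\<close> is the chance of leaving
    \<open>A\<close> by going straight to the right; failing that, the walk is credited with already
    standing one level higher.\<close>
  define \<phi> where "\<phi> z = (if int h \<le> L z then 1 else if z \<notin> A then 0
      else if L z \<in> G then (1 - (1/4) ^ r z) * c (L z + 1) else c (L z))" for z
  have G: "finite G" unfolding G_def by (rule finite_Collect_conjI) simp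
  have \<rho>: "0 \<le> \<rho>" "\<rho> \<le> 1" by (auto simp: \<rho>_def power_le_one)
  have c0: "0 \<le> c y" and c1: "c y \<le> 1" for y
    using \<rho> by (auto simp: c_def power_le_one)
  have c_mono: "c y \<le> c y'" if "y \<le> y'" for y y'
    unfolding c_def using \<rho> that G by (intro power_decreasing card_mono) auto
  have c_step: "c y = (if y \<in> G then \<rho> else 1) * c (y + 1)" for y
  proof (cases "y \<in> G")
    case True
    then have "G \<inter> {y..} = insert y (G \<inter> {y + 1..})" by auto
    then show ?thesis using True G by (simp add: c_def)
  next
    case False
    then have "G \<inter> {y..} = G \<inter> {y + 1..}" by (auto simp: order_le_less)
    then show ?thesis using False by (simp add: c_def)
  qed
  have ex: "\<exists>r. z + (int r, 0) \<notin> A" for z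
  proof (rule ccontr)
    assume "\<nexists>r. z + (int r, 0) \<notin> A"
    then have "range (\<lambda>r::nat. z + (int r, 0)) \<subseteq> A" by auto
    moreover have "infinite (range (\<lambda>r::nat. z + (int r, 0)))"
      by (rule range_inj_infinite) (auto simp: inj_on_def)
    ultimately show False using A finite_subset by blast
  qed
  have r_le: "r z \<le> R" if "L z \<in> G" for z
  proof (rule ccontr)
    assume "\<not> r z \<le> R"
    then have *: "z + (int j, 0) \<in> A" if "j \<le> R" for j
      using that not_less_Least[of j "\<lambda>r. z + (int r, 0) \<notin> A"] by (auto simp: r_def)
    have "(\<lambda>j::nat. z + (int j, 0)) ` {..R} \<subseteq> sl (L z)"
      using * by (auto simp: sl_def L_def)
    then have "card ((\<lambda>j::nat. z + (int j, 0)) ` {..R}) \<le> card (sl (L z))"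
      using A by (intro card_mono) (auto simp: sl_def)
    moreover have "card ((\<lambda>j::nat. z + (int j, 0)) ` {..R}) = Suc R"
      by (subst card_image) (auto simp: inj_on_def)
    ultimately show False using that by (simp add: G_def)
  qed
  have \<phi>_nonneg: "0 \<le> \<phi> z" for z
    using c0 by (auto simp: \<phi>_def power_le_one intro!: mult_nonneg_nonneg)
  have \<phi>_le: "\<phi> z \<le> c (L z)" for z
  proof -
    have "c (L z) = 1" if "int h \<le> L z"
    proof -
      have "G \<inter> {L z..} = {}" using that by (auto simp: G_def)
      then show ?thesis by (simp add: c_def)
    qed
    moreover have "(1 - (1/4) ^ r z) * c (L z + 1) \<le> c (L z)" if "L z \<in> G"
    proof -
      have "(1 - (1/4) ^ r z) * c (L z + 1) \<le> \<rho> * c (L z + 1)"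
        unfolding \<rho>_def using c0 r_le[OF that]
        by (intro mult_right_mono) (auto intro!: power_decreasing)
      then show ?thesis using c_step[of "L z"] that by simp
    qed
    ultimately show ?thesis using c0[of "L z"] by (auto simp: \<phi>_def)
  qed
  \<comment> \<open>On a thin level the left, upper and lower neighbours are worth at most
    \<open>c (L z + 1)\<close>, and the right one has \<open>r\<close> smaller by one. The sum is
    thus at most \<open>c (L z + 1)\<close> times \<open>4 - (1/4) ^ (r z - 1)\<close>, which is
    \<open>4 * (1 - (1/4) ^ r z)\<close>. On other levels \<open>c (L z)\<close> and
    \<open>c (L z + 1)\<close> coincide.\<close>
  have super: "(\<Sum>e\<in>steps. \<phi> (z + e)) \<le> 4 * \<phi> z" if z: "z \<in> A" "\<not> int h \<le> L z" for z
  proof -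
    let ?y = "L z"
    have Lr: "L (z + (1, 0)) = ?y" "L (z + (-1, 0)) = ?y"
      and Lu: "L (z + (0, 1)) \<le> ?y + 1" "L (z + (0, -1)) \<le> ?y + 1"
      using \<sigma> by (auto simp: L_def algebra_simps)
    have up: "\<phi> w \<le> c (?y + 1)" if "L w \<le> ?y + 1" for w
      using \<phi>_le[of w] c_mono[OF that] by linarith
    have three: "\<phi> (z + (-1, 0)) \<le> c (?y + 1)" "\<phi> (z + (0, 1)) \<le> c (?y + 1)"
      "\<phi> (z + (0, -1)) \<le> c (?y + 1)"
      using Lr Lu by (auto intro!: up)
    show ?thesis
    proof (cases "?y \<in> G")
      case True
      obtain r' where "z + (int r', 0) \<notin> A" using ex by blast
      then have "r z = Suc (LEAST m. z + (int (Suc m), 0) \<notin> A)"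
        unfolding r_def using z
        by (intro Least_Suc[of "\<lambda>r. z + (int r, 0) \<notin> A" r']) (simp_all flip: zero_prod_def)
      also have "(LEAST m. z + (int (Suc m), 0) \<notin> A) = r (z + (1, 0))"
        by (simp add: r_def add.assoc)
      finally have r: "r z = Suc (r (z + (1, 0)))" .
      have "\<phi> (z + (1, 0)) = (1 - (1/4) ^ r (z + (1, 0))) * c (?y + 1)"
      proof (cases "z + (1, 0) \<in> A")
        case True
        then show ?thesis using Lr(1) \<open>?y \<in> G\<close> z by (simp add: \<phi>_def)
      next
        case False
        then have "z + (1, 0) + (int 0, 0) \<notin> A" using False by (simp flip: zero_prod_def)
        then have "r (z + (1, 0)) = 0"
          unfolding r_def by (intro Least_eq_0)
        then show ?thesis using False Lr(1) z by (simp add: \<phi>_def)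
      qed
      moreover have "\<phi> z = (1 - (1/4) ^ r z) * c (?y + 1)"
        using z True by (simp add: \<phi>_def)
      ultimately show ?thesis
        using three unfolding sum_steps r by (simp add: algebra_simps)
    next
      case False
      then have "\<phi> z = c (?y + 1)" using z c_step[of ?y] by (simp add: \<phi>_def)
      moreover have "\<phi> (z + (1, 0)) \<le> c (?y + 1)" using Lr by (auto intro!: up)
      ultimately show ?thesis using three unfolding sum_steps by simp
    qed
  qed
  have "measure P {\<omega> \<in> space P. hits_within A {z. int h \<le> L z} (X \<omega>)} \<le> \<phi> (x, i)"
    by (rule hits_within_prob_le[OF P srw \<phi>_nonneg]) (use super in \<open>auto simp: \<phi>_def\<close>)
  also have "\<dots> \<le> c 0" using \<phi>_le[of "(x, i)"] by (simp add: L_def)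
  also have "\<dots> = \<rho> ^ card G"
  proof -
    have "G \<inter> {0..} = G" by (auto simp: G_def)
    then show ?thesis by (simp add: c_def)
  qed
  finally show ?thesis by (simp add: \<rho>_def G_def sl_def)
qed

text \<open>Markov's inequality for the number of sites on a uniformly chosen level: an average of
  at most \<open>m\<close> leaves at least half of the levels with at most \<open>2 * m\<close>
  sites.\<close>

lemma card_thin_levels_ge:
  fixes h m :: nat and L :: "site \<Rightarrow> int"
  assumes A: "finite A" and card: "card {z \<in> A. 0 \<le> L z \<and> L z < int h} \<le> m * h"
  shows "h \<le> 2 * card {y \<in> {0..<int h}. card {z \<in> A. L z = y} \<le> 2 * m}"
proof -
  let ?sl = "\<lambda>y. {z \<in> A. L z = y}"
  let ?B = "{y \<in> {0..<int h}. \<not> card (?sl y) \<le> 2 * m}"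
  let ?G = "{y \<in> {0..<int h}. card (?sl y) \<le> 2 * m}"
  have "(2 * m + 1) * card ?B = (\<Sum>y\<in>?B. 2 * m + 1)" by simp
  also have "\<dots> \<le> (\<Sum>y\<in>?B. card (?sl y))" by (intro sum_mono) auto
  also have "\<dots> \<le> (\<Sum>y\<in>{0..<int h}. card (?sl y))" by (intro sum_mono2) auto
  also have "\<dots> = card (\<Union>y\<in>{0..<int h}. ?sl y)"
    using A by (intro card_UN_disjoint[symmetric]) auto
  also have "(\<Union>y\<in>{0..<int h}. ?sl y) = {z \<in> A. 0 \<le> L z \<and> L z < int h}" by auto
  finally have *: "(2 * m + 1) * card ?B \<le> m * h" using card by linarith
  have "2 * card ?B \<le> h"
  proof (rule ccontr)
    assume "\<not> ?thesis"
    then have "(2 * m + 1) * h < (2 * m + 1) * (2 * card ?B)" by (intro mult_strict_left_mono) auto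
    also have "\<dots> \<le> 2 * (m * h)" using * by simp
    finally show False by (simp add: algebra_simps)
  qed
  moreover have "card ?B + card ?G = h"
  proof -
    have "finite ?B" "finite ?G" by (rule finite_Collect_conjI, simp)+
    then have "card ?B + card ?G = card (?B \<union> ?G)" by (intro card_Un_disjoint[symmetric]) auto
    also have "?B \<union> ?G = {0..<int h}" by auto
    finally show ?thesis by simp
  qed
  ultimately show ?thesis by linarith
qed

text \<open>To get away by \<open>h\<close> levels the walk has to cross \<open>h\<close> levels
  upwards or \<open>h\<close> levels downwards, whence the factor 2. On either side at least half of
  the levels are thin, with threshold \<open>2 * m\<close>, and each of these costs a factor
  \<open>1 - (1/4) ^ (2 * m)\<close>.\<close>

lemma escape_prob_le:
  fixes i :: int and m h :: nat and A :: "site set"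
  assumes P: "prob_space P" and srw: "simple_random_walk P (x, i) X"
    and A: "finite A" and m: "1 \<le> m" and card: "card {z \<in> A. \<bar>snd z - i\<bar> < int h} \<le> m * h"
  shows "measure P {\<omega> \<in> space P. hits_within A {z. int h \<le> \<bar>snd z - i\<bar>} (X \<omega>)}
           \<le> 2 * (1 - (1/4) ^ (2 * m)) powr (real h / 2)"
proof -
  interpret prob_space P by fact
  have X[measurable]: "X \<in> P \<rightarrow>\<^sub>M path_space" using srw by (simp add: simple_random_walk_def)
  define \<rho> :: real where "\<rho> = 1 - (1/4) ^ (2 * m)"
  have "(1/4::real) ^ (2 * m) \<le> (1/4) ^ 1" using m by (intro power_decreasing) auto
  then have \<rho>: "0 < \<rho>" "\<rho> \<le> 1" by (auto simp: \<rho>_def)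
  have one: "prob {\<omega> \<in> space P. hits_within A {z. int h \<le> \<sigma> * (snd z - i)} (X \<omega>)} \<le> \<rho> powr (real h / 2)"
    if \<sigma>: "\<sigma> = 1 \<or> \<sigma> = -1" for \<sigma>
  proof -
    let ?L = "\<lambda>z :: site. \<sigma> * (snd z - i)"
    let ?G = "{y \<in> {0..<int h}. card {z \<in> A. ?L z = y} \<le> 2 * m}"
    have "card {z \<in> A. 0 \<le> ?L z \<and> ?L z < int h} \<le> card {z \<in> A. \<bar>snd z - i\<bar> < int h}"
      using A \<sigma> by (intro card_mono) auto
    then have "h \<le> 2 * card ?G" using card by (intro card_thin_levels_ge[OF A]) linarith
    then have "\<rho> powr real (card ?G) \<le> \<rho> powr (real h / 2)"
      using \<rho> by (intro powr_mono') auto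
    then show ?thesis
      using crossing_prob_le[OF P srw \<sigma> A, of h "2 * m"] \<rho> by (simp add: powr_realpow \<rho>_def)
  qed
  have "prob {\<omega> \<in> space P. hits_within A {z. int h \<le> \<bar>snd z - i\<bar>} (X \<omega>)}
      \<le> prob ({\<omega> \<in> space P. hits_within A {z. int h \<le> 1 * (snd z - i)} (X \<omega>)} \<union>
              {\<omega> \<in> space P. hits_within A {z. int h \<le> -1 * (snd z - i)} (X \<omega>)})"
  proof (rule finite_measure_mono)
    show "{\<omega> \<in> space P. hits_within A {z. int h \<le> \<bar>snd z - i\<bar>} (X \<omega>)} \<subseteq>
      {\<omega> \<in> space P. hits_within A {z. int h \<le> 1 * (snd z - i)} (X \<omega>)} \<union>
      {\<omega> \<in> space P. hits_within A {z. int h \<le> -1 * (snd z - i)} (X \<omega>)}"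
      by (auto simp: hits_within_def abs_if split: if_splits)
  qed measurable
  also have "\<dots> \<le> prob {\<omega> \<in> space P. hits_within A {z. int h \<le> 1 * (snd z - i)} (X \<omega>)} +
              prob {\<omega> \<in> space P. hits_within A {z. int h \<le> -1 * (snd z - i)} (X \<omega>)}"
    by (rule measure_Un_le) auto
  also have "\<dots> \<le> 2 * \<rho> powr (real h / 2)"
    using one[of 1] one[of "-1"] by simp
  finally show ?thesis by (simp add: \<rho>_def)
qed

section \<open>Straying particles\<close>

lemma send_all_Nil [simp]: "send_all w [] = {}"
  by (simp add: send_all_def)

lemma send_all_snoc: "send_all w (ps @ [p]) = send (send_all w ps) (w (fst p) (snd p))"
  by (simp add: send_all_def case_prod_beta)

lemma send_extensive: "A \<subseteq> send A w"
  by (auto simp: send_def)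

lemma finite_send: "finite A \<Longrightarrow> finite (send A w)"
  by (simp add: send_def)

lemma finite_send_all [simp]: "finite (send_all w ps)"
  by (induction ps rule: rev_induct) (simp_all add: send_all_snoc finite_send)

text \<open>In the larger aggregate the walk goes on at least as long. If its exit site from
  \<open>A\<close> is not yet in \<open>B\<close>, then it is also the exit site from
  \<open>B\<close>.\<close>

lemma send_mono:
  assumes "A \<subseteq> B"
  shows "send A w \<subseteq> send B w"
proof (cases "\<exists>t. w t \<notin> A")
  case False
  then show ?thesis using assms send_extensive[of B w] by (auto simp: send_def)
next
  case True
  let ?t = "LEAST t. w t \<notin> A"
  have sA: "send A w = insert (w ?t) A" using True by (simp add: send_def)
  have "w ?t \<in> send B w"
  proof (cases "w ?t \<in> B")
    case True
    then show ?thesis using send_extensive by blast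
  next
    case False
    have "(LEAST t. w t \<notin> B) = ?t"
    proof (rule Least_equality)
      show "w ?t \<notin> B" by fact
      fix t assume "w t \<notin> B"
      then show "?t \<le> t" using assms by (intro Least_le) auto
    qed
    then show ?thesis using False by (auto simp: send_def)
  qed
  then show ?thesis unfolding sA using assms send_extensive[of B w] by blast
qed

text \<open>Iterates \<open>send_mono\<close>, starting from two nested aggregates. It gives growth
  in \<open>M\<close> even when the new particles are sent between the old ones.\<close>

lemma send_all_subseq:
  assumes "subseq ps qs"
  shows "send_all w ps \<subseteq> send_all w qs"
proof -
  let ?f = "\<lambda>A (i, j). send A (w i j)"
  have "foldl ?f A ps \<subseteq> foldl ?f B qs" if "A \<subseteq> B" for A B
    using assms that
  proof (induction arbitrary: A B)
    case (list_emb_Nil ys)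
    have "B \<subseteq> foldl ?f B ys"
    proof (induction ys rule: rev_induct)
      case (snoc p ys)
      then show ?case using send_extensive by (cases p) fastforce
    qed simp
    then show ?case using list_emb_Nil by auto
  next
    case (list_emb_Cons xs ys y)
    obtain i j where y: "y = (i, j)" by fastforce
    have "A \<subseteq> send B (w i j)" using list_emb_Cons.prems send_extensive by blast
    then show ?case using list_emb_Cons.IH by (simp add: y)
  next
    case (list_emb_Cons2 x y xs ys)
    obtain i j where "y = (i, j)" by fastforce
    then show ?case
      using list_emb_Cons2.IH[OF send_mono[OF list_emb_Cons2.prems]] list_emb_Cons2.hyps by simp
  qed
  then show ?thesis by (simp add: send_all_def)
qed

lemma send_all_cong:
  assumes "\<And>p. p \<in> set ps \<Longrightarrow> w (fst p) (snd p) = w' (fst p) (snd p)"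
  shows "send_all w ps = send_all w' ps"
  using assms by (induction ps rule: rev_induct) (simp_all add: send_all_snoc)

text \<open>The site where \<open>p\<close> settles counts as well: only the earlier ones have to lie in \<open>A\<close>.\<close>

definition strays :: "site set \<Rightarrow> nat \<Rightarrow> (int \<Rightarrow> nat \<Rightarrow> path) \<Rightarrow> int \<times> nat \<Rightarrow> bool" where
  "strays A h w p \<longleftrightarrow> hits_within A {z. int h \<le> \<bar>snd z - fst p\<bar>} (w (fst p) (snd p))"

lemma hits_within_mono: "hits_within A B w \<Longrightarrow> A \<subseteq> A' \<Longrightarrow> B \<subseteq> B' \<Longrightarrow> hits_within A' B' w"
  unfolding hits_within_def by blast

text \<open>Here \<open>f l\<close> is the settling site of the particle with index
  \<open>l\<close>, so sites can be counted by particles, and each comes with a walk through earlier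
  sites of the aggregate. Only an inclusion is stated, because a particle that never leaves the
  aggregate is assigned a site too.\<close>

lemma send_all_origin:
  "\<exists>f. send_all w ps \<subseteq> f ` {l. l < length ps \<and>
     hits_within (send_all w (take l ps)) {f l} (w (fst (ps ! l)) (snd (ps ! l)))}"
proof (induction ps rule: rev_induct)
  case (snoc p ps)
  then obtain f where f: "send_all w ps \<subseteq> f ` {l. l < length ps \<and>
      hits_within (send_all w (take l ps)) {f l} (w (fst (ps ! l)) (snd (ps ! l)))}"
    by blast
  let ?A = "send_all w ps" and ?u = "w (fst p) (snd p)" and ?ps = "ps @ [p]"
  let ?z = "?u (LEAST t. ?u t \<notin> ?A)"
  define g where "g = f(length ps := ?z)"
  let ?P = "\<lambda>l. hits_within (send_all w (take l ?ps)) {g l} (w (fst (?ps ! l)) (snd (?ps ! l)))"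
  have "y \<in> g ` {l. l < length ?ps \<and> ?P l}" if y: "y \<in> send_all w ?ps" for y
  proof -
    consider "y \<in> ?A" | "y = ?z"
      using y unfolding send_all_snoc send_def by (cases "\<exists>t. ?u t \<notin> ?A") auto
    then show ?thesis
    proof cases
      case 1
      then obtain l where l: "l < length ps"
        "hits_within (send_all w (take l ps)) {f l} (w (fst (ps ! l)) (snd (ps ! l)))" "y = f l"
        using f by blast
      have "g l = f l" "?ps ! l = ps ! l" "take l ?ps = take l ps"
        using l(1) by (simp_all add: g_def nth_append)
      then have "?P l" "y = g l" using l(2,3) by simp_all
      then show ?thesis using l(1) by (intro image_eqI[of _ _ l]) simp_all
    next
      case 2
      have "\<forall>s<(LEAST t. ?u t \<notin> ?A). ?u s \<in> ?A"
        using not_less_Least by blast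
      then have "hits_within ?A {?z} ?u" unfolding hits_within_def by blast
      then have "?P (length ps)" by (simp add: g_def)
      then show ?thesis using 2 by (intro image_eqI[of _ _ "length ps"]) (simp_all add: g_def)
    qed
  qed
  then show ?case by blast
qed simp

text \<open>A settling site farther away than \<open>h\<close> would itself witness straying. Hence
  every site of the aggregate is charged to a particle from a nearby level.\<close>

lemma send_all_subset_image:
  assumes "\<And>l. l < length ps \<Longrightarrow> \<not> strays (send_all w (take l ps)) (h (ps ! l)) w (ps ! l)"
  shows "\<exists>f. send_all w ps \<subseteq> f ` {l. l < length ps \<and> \<bar>snd (f l :: site) - fst (ps ! l)\<bar> < int (h (ps ! l))}"
proof -
  obtain f where f: "send_all w ps \<subseteq> f ` {l. l < length ps \<and>
      hits_within (send_all w (take l ps)) {f l} (w (fst (ps ! l)) (snd (ps ! l)))}" (is "_ \<subseteq> f ` ?I")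
    using send_all_origin[of w ps] by blast
  have "\<bar>snd (f l) - fst (ps ! l)\<bar> < int (h (ps ! l))" if "l \<in> ?I" for l
  proof (rule ccontr)
    assume "\<not> ?thesis"
    then have "{f l} \<subseteq> {z. int (h (ps ! l)) \<le> \<bar>snd z - fst (ps ! l)\<bar>}" by simp
    then have "strays (send_all w (take l ps)) (h (ps ! l)) w (ps ! l)"
      using that hits_within_mono unfolding strays_def by blast
    then show False using that assms by blast
  qed
  then have "?I \<subseteq> {l. l < length ps \<and> \<bar>snd (f l) - fst (ps ! l)\<bar> < int (h (ps ! l))}"
    by blast
  then show ?thesis using f by (meson image_mono order_trans)
qed

text \<open>
  The displacements allowed below grow with the distance to the level \<open>a\<close>, so that, as long as
  they are respected, the part of the aggregate relevant to a particle only comes from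
  levels at most three times farther from \<open>a\<close>.
\<close>

definition leash :: "int \<Rightarrow> int \<times> nat \<Rightarrow> nat" where
  "leash a p = (nat \<bar>fst p - a\<bar> + 1) div 2"

text \<open>\<open>leash\<close> is half the distance rounded up, so the integers below it are
  exactly those whose double is less than the distance.\<close>

lemma less_leashD: "x < int (leash a p) \<Longrightarrow> 2 * x < \<bar>fst p - a\<bar>"
  unfolding leash_def by (simp add: zdiv_int)

text \<open>Let D be the distance of \<open>ps ! l\<close> from \<open>a\<close>. A site in its
  strip is at distance less than 3 D / 2 from \<open>a\<close>; if it was filled from distance E, it
  is at distance more than E / 2, so E < 3 D. By density there are at most 3 C D such particles, and
  D is at most twice the leash.\<close>

lemma card_strip_le:
  assumes "distinct ps" "l < length ps"
    and short: "\<And>k. k < l \<Longrightarrow> \<not> strays (send_all w (take k ps)) (leash a (ps ! k)) w (ps ! k)"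
    and dens: "\<And>r. card {p \<in> set ps. \<bar>fst p - a\<bar> \<le> int r} \<le> C * r"
  shows "card {z \<in> send_all w (take l ps). \<bar>snd z - fst (ps ! l)\<bar> < int (leash a (ps ! l))}
     \<le> (6 * C) * leash a (ps ! l)"
proof -
  let ?p = "ps ! l"
  let ?D = "nat \<bar>fst ?p - a\<bar>"
  let ?N = "{p \<in> set ps. \<bar>fst p - a\<bar> \<le> int (3 * ?D)}"
  let ?I = "{k. k < l \<and> ps ! k \<in> ?N}"
  obtain f where f: "send_all w (take l ps)
      \<subseteq> f ` {k. k < l \<and> \<bar>snd (f k :: site) - fst (ps ! k)\<bar> < int (leash a (ps ! k))}"
  proof -
    have "\<exists>f. send_all w (take l ps) \<subseteq> f ` {k. k < length (take l ps) \<and>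
        \<bar>snd (f k :: site) - fst (take l ps ! k)\<bar> < int (leash a (take l ps ! k))}"
      using short assms(2) by (intro send_all_subset_image) (auto simp: min_def)
    then show ?thesis using that assms(2) by (auto simp: min_def cong: conj_cong)
  qed
  have "{z \<in> send_all w (take l ps). \<bar>snd z - fst ?p\<bar> < int (leash a ?p)} \<subseteq> f ` ?I"
  proof
    fix z assume "z \<in> {z \<in> send_all w (take l ps). \<bar>snd z - fst ?p\<bar> < int (leash a ?p)}"
    then obtain k where k: "k < l" "\<bar>snd z - fst (ps ! k)\<bar> < int (leash a (ps ! k))" "z = f k"
      "\<bar>snd z - fst ?p\<bar> < int (leash a ?p)"
      using f by auto
    have "\<bar>fst (ps ! k) - a\<bar> \<le> int (3 * ?D)"
      using less_leashD[OF k(2)] less_leashD[OF k(4)]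
      by (simp add: abs_if split: if_splits)
    then show "z \<in> f ` ?I" using k assms(2) by auto
  qed
  then have "card {z \<in> send_all w (take l ps). \<bar>snd z - fst ?p\<bar> < int (leash a ?p)} \<le> card (f ` ?I)"
    by (intro card_mono) auto
  also have "\<dots> \<le> card ?I" by (intro card_image_le) auto
  also have "\<dots> = card ((!) ps ` ?I)"
    using assms(1,2) by (intro card_image[symmetric] inj_onI) (auto simp: nth_eq_iff_index_eq)
  also have "\<dots> \<le> card ?N" by (intro card_mono) auto
  also have "\<dots> \<le> C * (3 * ?D)" by (rule dens)
  also have "\<dots> \<le> C * (3 * (2 * leash a ?p))"
    by (intro mult_left_mono) (auto simp: leash_def)
  finally show ?thesis by (simp add: ac_simps)
qed

text \<open>Reaching \<open>a\<close> takes a displacement by the full distance, while less than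
  half of it is allowed.\<close>

lemma misses_level_if_not_strays:
  assumes "\<And>l. l < length ps \<Longrightarrow> \<not> strays (send_all w (take l ps)) (leash a (ps ! l)) w (ps ! l)"
    and "\<And>p. p \<in> set ps \<Longrightarrow> fst p \<noteq> a"
  shows "misses_level (send_all w ps) a"
proof -
  obtain f where f: "send_all w ps
      \<subseteq> f ` {l. l < length ps \<and> \<bar>snd (f l :: site) - fst (ps ! l)\<bar> < int (leash a (ps ! l))}"
    using send_all_subset_image[of ps w "leash a"] assms(1) by blast
  have "snd z \<noteq> a" if z: "z \<in> send_all w ps" for z
  proof
    assume "snd z = a"
    then obtain l where "\<bar>a - fst (ps ! l)\<bar> < int (leash a (ps ! l))"
      using f z by auto
    from less_leashD[OF this] show False by (simp add: abs_if split: if_splits)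
  qed
  then show ?thesis by (force simp: misses_level_def)
qed

section \<open>Measurability of aggregates and the cost of straying\<close>

lemma countable_finite_sites: "countable {A :: site set. finite A}"
  by (rule countable_Collect_finite)

text \<open>The values are restricted to finite sets because these are countably many: composing
  with a random aggregate then only needs measurability for each fixed one.\<close>

lemma send_measurable:
  assumes "finite A"
  shows "send A \<in> path_space \<rightarrow>\<^sub>M count_space {A. finite A}"
proof -
  have [measurable]: "(\<lambda>w. LEAST t. w t \<notin> A) \<in> path_space \<rightarrow>\<^sub>M count_space UNIV"
    by measurable
  have m: "(\<lambda>w. w (LEAST t. w t \<notin> A)) \<in> path_space \<rightarrow>\<^sub>M count_space UNIV"
    by (rule measurable_compose_countable[OF path_component_measurable]) measurable
  have "(\<lambda>w. insert (w (LEAST t. w t \<notin> A)) A) \<in> path_space \<rightarrow>\<^sub>M count_space {A. finite A}"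
    using assms by (intro measurable_compose[OF m]) auto
  moreover have "(\<lambda>_. A) \<in> path_space \<rightarrow>\<^sub>M count_space {A. finite A}"
    using assms by simp
  moreover have "Measurable.pred path_space (\<lambda>w. \<exists>t. w t \<notin> A)" by measurable
  ultimately show ?thesis
    unfolding send_def[abs_def] by (intro measurable_If) (simp_all add: pred_def)
qed

lemma send_all_measurable:
  assumes "set ps \<subseteq> K"
  shows "(\<lambda>w. send_all (\<lambda>i j. w (i, j)) ps) \<in> PiM K (\<lambda>_. path_space) \<rightarrow>\<^sub>M count_space {A. finite A}"
  using assms
proof (induction ps rule: rev_induct)
  case Nil then show ?case by simp
next
  case (snoc p ps)
  have w: "(\<lambda>w. w p) \<in> PiM K (\<lambda>_. path_space) \<rightarrow>\<^sub>M path_space"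
    using snoc.prems by (intro measurable_component_singleton) auto
  have "(\<lambda>w. send (send_all (\<lambda>i j. w (i, j)) ps) (w p)) \<in> PiM K (\<lambda>_. path_space) \<rightarrow>\<^sub>M count_space {A. finite A}"
  proof (rule measurable_compose_countable'[where I = "{A :: site set. finite A}"
        and f = "\<lambda>A w. send A (w p)" and g = "\<lambda>w. send_all (\<lambda>i j. w (i, j)) ps"])
    show "(\<lambda>w. send A (w p)) \<in> PiM K (\<lambda>_. path_space) \<rightarrow>\<^sub>M count_space {A. finite A}"
      if "A \<in> {A. finite A}" for A
      using that by (intro measurable_compose[OF w send_measurable]) auto
    show "(\<lambda>w. send_all (\<lambda>i j. w (i, j)) ps) \<in> PiM K (\<lambda>_. path_space) \<rightarrow>\<^sub>M count_space {A. finite A}"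
      using snoc by auto
  qed (rule countable_finite_sites)
  then show ?case by (simp add: send_all_snoc)
qed

text \<open>Total probability over a countable partition, with \<open>c\<close> a common bound for
  the conditional probabilities of \<open>G v\<close> given \<open>F v\<close>; the product form
  also covers null events \<open>F v\<close>.\<close>

lemma (in prob_space) prob_mixture_le:
  assumes V: "countable V" and F: "\<And>v. v \<in> V \<Longrightarrow> F v \<in> events" and G: "\<And>v. v \<in> V \<Longrightarrow> G v \<in> events"
    and disj: "disjoint_family_on F V" and c: "0 \<le> c"
    and le: "\<And>v. v \<in> V \<Longrightarrow> prob (F v \<inter> G v) \<le> c * prob (F v)"
  shows "prob (\<Union>v\<in>V. F v \<inter> G v) \<le> c * prob (\<Union>v\<in>V. F v)"
proof -
  have "emeasure M (\<Union>v\<in>V. F v \<inter> G v) = (\<integral>\<^sup>+v. emeasure M (F v \<inter> G v) \<partial>count_space V)"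
    using V F G disj unfolding disjoint_family_on_def by (intro emeasure_UN_countable) (auto simp: disjoint_family_on_def, blast)
  also have "\<dots> \<le> (\<integral>\<^sup>+v. ennreal c * emeasure M (F v) \<partial>count_space V)"
    using le c by (intro nn_integral_mono)
      (auto simp: emeasure_eq_measure ennreal_mult[symmetric] intro!: ennreal_leI)
  also have "\<dots> = ennreal c * (\<integral>\<^sup>+v. emeasure M (F v) \<partial>count_space V)"
    by (rule nn_integral_cmult) simp
  also have "(\<integral>\<^sup>+v. emeasure M (F v) \<partial>count_space V) = emeasure M (\<Union>v\<in>V. F v)"
    using V F disj by (intro emeasure_UN_countable[symmetric]) auto
  finally show ?thesis
    using c by (simp add: emeasure_eq_measure ennreal_mult[symmetric])
qed

text \<open>As \<open>ps\<close> is distinct, the aggregate before the particle with index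
  \<open>l\<close> depends on the walks of other particles only. Splitting according to its value
  \<open>A\<close> makes it deterministic, as \<open>escape_prob_le\<close> requires; the density
  condition merely selects the admissible values.\<close>

lemma stray_prob_le:
  assumes P: "prob_space P" and S: "independent_walks P S"
    and ps: "distinct ps" "set ps \<subseteq> particles" "l < length ps" and m: "1 \<le> m"
  shows "{\<omega> \<in> space P. card {z \<in> send_all (\<lambda>i j. S i j \<omega>) (take l ps). \<bar>snd z - fst (ps ! l)\<bar> < int h} \<le> m * h
       \<and> strays (send_all (\<lambda>i j. S i j \<omega>) (take l ps)) h (\<lambda>i j. S i j \<omega>) (ps ! l)} \<in> sets P" (is "?E \<in> _")
    and "measure P {\<omega> \<in> space P. card {z \<in> send_all (\<lambda>i j. S i j \<omega>) (take l ps). \<bar>snd z - fst (ps ! l)\<bar> < int h} \<le> m * h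
       \<and> strays (send_all (\<lambda>i j. S i j \<omega>) (take l ps)) h (\<lambda>i j. S i j \<omega>) (ps ! l)}
      \<le> 2 * (1 - (1/4) ^ (2 * m)) powr (real h / 2)"
proof -
  interpret prob_space P by fact
  let ?p = "ps ! l" and ?ps = "take l ps"
  let ?X = "S (fst ?p) (snd ?p)"
  let ?agg = "\<lambda>\<omega>. send_all (\<lambda>i j. S i j \<omega>) ?ps"
  have p: "?p \<in> particles" using ps nth_mem by blast
  have srw: "simple_random_walk P (0, fst ?p) ?X"
    using S p by (auto simp: independent_walks_def case_prod_beta)
  have X: "?X \<in> P \<rightarrow>\<^sub>M path_space" using srw by (simp add: simple_random_walk_def)
  have ind: "indep_vars (\<lambda>_. path_space) (\<lambda>(i, j). S i j) particles"
    using S by (simp add: independent_walks_def)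
  have sub: "set ?ps \<subseteq> particles" "?p \<notin> set ?ps"
    using ps by (auto dest: in_set_takeD simp: in_set_conv_nth nth_eq_iff_index_eq)
  let ?R = "\<lambda>K \<omega>. restrict (\<lambda>p. (case p of (i, j) \<Rightarrow> S i j) \<omega>) K"
  have iv: "indep_var (PiM (set ?ps) (\<lambda>_. path_space)) (?R (set ?ps)) (PiM {?p} (\<lambda>_. path_space)) (?R {?p})"
    using sub p by (intro indep_var_restrict[OF ind]) auto
  have aggR: "?agg \<omega> = send_all (\<lambda>i j. ?R (set ?ps) \<omega> (i, j)) ?ps" for \<omega>
    by (rule send_all_cong) auto
  define F where "F A = {\<omega> \<in> space P. ?agg \<omega> = A}" for A
  define B where "B = {z :: site. int h \<le> \<bar>snd z - fst ?p\<bar>}"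
  define H where "H A = {\<omega> \<in> space P. hits_within A B (?X \<omega>)}" for A
  define V where "V = {A :: site set. finite A \<and> card {z \<in> A. \<bar>snd z - fst ?p\<bar> < int h} \<le> m * h}"
  have V: "countable V"
    by (rule countable_subset[OF _ countable_finite_sites]) (auto simp: V_def)
  have H: "H A \<in> events" for A
    unfolding H_def using measurable_compose[OF X pred_hits_within] by (simp add: pred_def)
  let ?FA = "\<lambda>A. {w \<in> space (PiM (set ?ps) (\<lambda>_. path_space)). send_all (\<lambda>i j. w (i, j)) ?ps = A}"
  let ?HA = "\<lambda>A. {w \<in> space (PiM {?p} (\<lambda>_. path_space)). hits_within A B (w ?p)}"
  have FA: "?FA A \<in> sets (PiM (set ?ps) (\<lambda>_. path_space))" if "finite A" for A
    using measurable_sets[OF send_all_measurable[OF order_refl, of ?ps], of "{A}"] that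
    by (auto simp: vimage_def Collect_conj_eq Int_commute)
  have HA: "?HA A \<in> sets (PiM {?p} (\<lambda>_. path_space))" for A
    using measurable_compose[OF measurable_component_singleton[of ?p "{?p}" "\<lambda>_. path_space"] pred_hits_within[of A B]]
    by (simp add: pred_def)
  have Rm: "?R (set ?ps) \<in> P \<rightarrow>\<^sub>M PiM (set ?ps) (\<lambda>_. path_space)" "?R {?p} \<in> P \<rightarrow>\<^sub>M PiM {?p} (\<lambda>_. path_space)"
    using indep_var_rv1[OF iv] indep_var_rv2[OF iv] by auto
  have Feq: "F A = ?R (set ?ps) -` ?FA A \<inter> space P" for A
    using measurable_space[OF Rm(1)] by (auto simp: F_def aggR)
  have Heq: "H A = ?R {?p} -` ?HA A \<inter> space P" for A
    using measurable_space[OF Rm(2)] by (auto simp: H_def case_prod_beta)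
  have F: "F A \<in> events" if "A \<in> V" for A
    unfolding Feq using that by (intro measurable_sets[OF Rm(1)] FA) (auto simp: V_def)
  have E: "?E = (\<Union>A\<in>V. F A \<inter> H A)"
    by (auto simp: F_def H_def V_def B_def strays_def)
  show "?E \<in> events"
    unfolding E using V F H by (intro sets.countable_UN') auto
  have c: "0 \<le> 2 * (1 - (1/4::real) ^ (2 * m)) powr (real h / 2)" by simp
  have "prob (F A \<inter> H A) \<le> 2 * (1 - (1/4) ^ (2 * m)) powr (real h / 2) * prob (F A)" if A: "A \<in> V" for A
  proof -
    have "F A \<inter> H A = (\<lambda>\<omega>. (?R (set ?ps) \<omega>, ?R {?p} \<omega>)) -` (?FA A \<times> ?HA A) \<inter> space P"
      unfolding Feq Heq by blast
    then have "prob (F A \<inter> H A) = prob (F A) * prob (H A)"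
      using A indep_varD[OF iv FA HA, of A] by (simp add: Feq Heq V_def)
    also have "\<dots> \<le> prob (F A) * (2 * (1 - (1/4) ^ (2 * m)) powr (real h / 2))"
      unfolding H_def B_def using A
      by (intro mult_left_mono escape_prob_le[OF P srw _ m]) (auto simp: V_def)
    finally show ?thesis by (simp add: ac_simps)
  qed
  then have "prob ?E \<le> 2 * (1 - (1/4) ^ (2 * m)) powr (real h / 2) * prob (\<Union>A\<in>V. F A)"
    unfolding E using V F H c by (intro prob_mixture_le) (auto simp: disjoint_family_on_def F_def)
  also have "\<dots> \<le> 2 * (1 - (1/4) ^ (2 * m)) powr (real h / 2) * 1"
    using c by (intro mult_left_mono) auto
  finally show "prob ?E \<le> 2 * (1 - (1/4) ^ (2 * m)) powr (real h / 2)" by simp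
qed

definition walk_events :: "'a measure \<Rightarrow> (int \<Rightarrow> nat \<Rightarrow> 'a \<Rightarrow> path) \<Rightarrow> 'a set set" where
  "walk_events P S =
     sets (vimage_algebra (space P) (\<lambda>\<omega>. \<lambda>(i, j)\<in>particles. S i j \<omega>) (PiM particles (\<lambda>_. path_space)))"

text \<open>For a fixed list the aggregate is a function of the walks alone. This is what allows
  conditioning on a random order that is independent of \<open>walk_events\<close>.\<close>

lemma visits_level_in_walk_events:
  assumes ps: "set ps \<subseteq> particles" and S: "independent_walks P S"
  shows "{\<omega> \<in> space P. \<not> misses_level (send_all (\<lambda>i j. S i j \<omega>) ps) a} \<in> walk_events P S"
    and "walk_events P S \<subseteq> sets P"
proof -
  let ?R = "\<lambda>\<omega>. \<lambda>(i, j)\<in>particles. S i j \<omega>"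
  let ?B = "(\<lambda>w. send_all (\<lambda>i j. w (i, j)) ps) -` {A. finite A \<and> \<not> misses_level A a}
      \<inter> space (PiM particles (\<lambda>_. path_space))"
  have R: "?R \<in> P \<rightarrow>\<^sub>M PiM particles (\<lambda>_. path_space)"
    using S by (intro measurable_restrict) (auto simp: independent_walks_def simple_random_walk_def)
  show "walk_events P S \<subseteq> sets P"
  proof
    fix W assume "W \<in> walk_events P S"
    moreover have "?R \<in> space P \<rightarrow> space (PiM particles (\<lambda>_. path_space))"
      using measurable_space[OF R] by blast
    ultimately obtain B where "B \<in> sets (PiM particles (\<lambda>_. path_space))" "W = ?R -` B \<inter> space P"
      unfolding walk_events_def by (subst (asm) sets_vimage_algebra2) auto
    then show "W \<in> sets P" using measurable_sets[OF R] by blast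
  qed
  have "?B \<in> sets (PiM particles (\<lambda>_. path_space))"
    by (rule measurable_sets[OF send_all_measurable[OF ps]]) auto
  then have "?R -` ?B \<inter> space P \<in> walk_events P S"
    unfolding walk_events_def by (rule in_vimage_algebra)
  also have "send_all (\<lambda>i j. ?R \<omega> (i, j)) ps = send_all (\<lambda>i j. S i j \<omega>) ps" for \<omega>
    using ps by (intro send_all_cong) auto
  then have "?R -` ?B \<inter> space P = {\<omega> \<in> space P. \<not> misses_level (send_all (\<lambda>i j. S i j \<omega>) ps) a}"
    using measurable_space[OF R] by auto
  finally show "{\<omega> \<in> space P. \<not> misses_level (send_all (\<lambda>i j. S i j \<omega>) ps) a} \<in> walk_events P S" .
qed

text \<open>Union bound over the index of the first particle that strays: all earlier ones respected
  their leash, so \<open>card_strip_le\<close> makes its surroundings thin and one of the events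
  \<open>E l\<close> below occurs. The exponent \<open>12 * C\<close> is the density
  \<open>6 * C\<close> found there, doubled in \<open>escape_prob_le\<close>; the quarter arises
  because half the leash is at least a quarter of the distance.\<close>

proposition visit_prob_le:
  assumes P: "prob_space P" and S: "independent_walks P S"
    and ps: "distinct ps" "set ps \<subseteq> particles" and C: "1 \<le> C"
    and dens: "\<And>r. card {p \<in> set ps. \<bar>fst p - a\<bar> \<le> int r} \<le> C * r"
  shows "measure P {\<omega> \<in> space P. \<not> misses_level (send_all (\<lambda>i j. S i j \<omega>) ps) a}
     \<le> (\<Sum>p\<in>set ps. 2 * (1 - (1/4) ^ (12 * C)) powr (real_of_int \<bar>fst p - a\<bar> / 4))"
proof -
  interpret prob_space P by fact
  define w where "w \<omega> = (\<lambda>i j. S i j \<omega>)" for \<omega>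
  define \<rho> :: real where "\<rho> = 1 - (1/4) ^ (12 * C)"
  have "(1/4::real) ^ (12 * C) \<le> 1" by (intro power_le_one) auto
  then have \<rho>: "0 \<le> \<rho>" "\<rho> \<le> 1" by (auto simp: \<rho>_def)
  let ?A = "\<lambda>l \<omega>. send_all (w \<omega>) (take l ps)"
  let ?h = "\<lambda>l. leash a (ps ! l)"
  define E where "E l = {\<omega> \<in> space P.
      card {z \<in> ?A l \<omega>. \<bar>snd z - fst (ps ! l)\<bar> < int (?h l)} \<le> (6 * C) * ?h l \<and>
      strays (?A l \<omega>) (?h l) (w \<omega>) (ps ! l)}" for l
  \<comment> \<open>The case \<open>r = 0\<close> of the density bound leaves no particle on level
    \<open>a\<close>.\<close>
  have ne: "fst p \<noteq> a" if "p \<in> set ps" for p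
  proof
    assume "fst p = a"
    then have "p \<in> {p \<in> set ps. \<bar>fst p - a\<bar> \<le> int 0}" using that by simp
    moreover have "{p \<in> set ps. \<bar>fst p - a\<bar> \<le> int 0} = {}"
      using dens[of 0] by (subst card_0_eq[symmetric]) simp_all
    ultimately show False by blast
  qed
  have sub: "{\<omega> \<in> space P. \<not> misses_level (send_all (w \<omega>) ps) a} \<subseteq> (\<Union>l\<in>{..<length ps}. E l)"
  proof
    fix \<omega> assume \<omega>: "\<omega> \<in> {\<omega> \<in> space P. \<not> misses_level (send_all (w \<omega>) ps) a}"
    let ?Q = "\<lambda>l. l < length ps \<and> strays (?A l \<omega>) (?h l) (w \<omega>) (ps ! l)"
    have "\<exists>l. ?Q l"
      using \<omega> misses_level_if_not_strays[of ps "w \<omega>" a] ne by blast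
    define l where "l = (LEAST l. ?Q l)"
    have l: "?Q l" unfolding l_def by (rule LeastI_ex) fact
    have "\<not> strays (?A k \<omega>) (?h k) (w \<omega>) (ps ! k)" if "k < l" for k
      using not_less_Least[of k ?Q] that l unfolding l_def[symmetric] by auto
    then have "card {z \<in> ?A l \<omega>. \<bar>snd z - fst (ps ! l)\<bar> < int (?h l)} \<le> (6 * C) * ?h l"
      using l by (intro card_strip_le[OF ps(1) _ _ dens]) auto
    then show "\<omega> \<in> (\<Union>l\<in>{..<length ps}. E l)" using l \<omega> by (auto simp: E_def)
  qed
  have E: "E l \<in> events" "prob (E l) \<le> 2 * \<rho> powr (real_of_int \<bar>fst (ps ! l) - a\<bar> / 4)" if "l < length ps" for l
  proof -
    show "E l \<in> events"
      unfolding E_def w_def by (rule stray_prob_le[OF P S ps that]) (use C in simp)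
    have "prob (E l) \<le> 2 * (1 - (1/4) ^ (2 * (6 * C))) powr (real (?h l) / 2)"
      unfolding E_def w_def by (rule stray_prob_le[OF P S ps that]) (use C in simp)
    also have "\<dots> = 2 * \<rho> powr (real (?h l) / 2)" by (simp add: \<rho>_def)
    also have "\<dots> \<le> 2 * \<rho> powr (real_of_int \<bar>fst (ps ! l) - a\<bar> / 4)"
    proof -
      have "nat \<bar>fst (ps ! l) - a\<bar> \<le> 2 * ?h l" by (simp add: leash_def)
      then have "\<bar>fst (ps ! l) - a\<bar> \<le> int (2 * ?h l)" by linarith
      then have "real_of_int \<bar>fst (ps ! l) - a\<bar> \<le> real_of_int (int (2 * ?h l))"
        by (simp only: of_int_le_iff)
      then show ?thesis using \<rho> by (intro mult_left_mono powr_mono') auto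
    qed
    finally show "prob (E l) \<le> 2 * \<rho> powr (real_of_int \<bar>fst (ps ! l) - a\<bar> / 4)" .
  qed
  have "prob {\<omega> \<in> space P. \<not> misses_level (send_all (w \<omega>) ps) a} \<le> prob (\<Union>l\<in>{..<length ps}. E l)"
    using E by (intro finite_measure_mono[OF sub]) auto
  also have "\<dots> \<le> (\<Sum>l<length ps. prob (E l))"
    using E by (intro finite_measure_subadditive_finite) auto
  also have "\<dots> \<le> (\<Sum>l<length ps. 2 * \<rho> powr (real_of_int \<bar>fst (ps ! l) - a\<bar> / 4))"
    using E by (intro sum_mono) auto
  also have "\<dots> = (\<Sum>p\<in>set ps. 2 * \<rho> powr (real_of_int \<bar>fst p - a\<bar> / 4))"
    using ps(1) by (simp add: sum_list_distinct_conv_sum_set[symmetric] sum_list_sum_nth atLeast0LessThan)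
  finally show ?thesis by (simp add: \<rho>_def w_def)
qed

section \<open>Vacant blocks of levels\<close>

lemma distr_poisson:
  assumes "prob_space P" "poisson_distributed P X r" "0 < r"
  shows "distr P (count_space UNIV) X = measure_pmf (poisson_pmf r)"
proof (rule measure_eqI_countable[where A = UNIV])
  interpret prob_space P by fact
  have X: "X \<in> P \<rightarrow>\<^sub>M count_space UNIV" using assms(2) by (simp add: poisson_distributed_def)
  fix k
  have "emeasure (distr P (count_space UNIV) X) {k} = emeasure P {\<omega> \<in> space P. X \<omega> = k}"
    using X by (subst emeasure_distr) (auto intro!: arg_cong[where f="emeasure P"])
  also have "\<dots> = ennreal (r ^ k / fact k * exp (- r))"
    using assms(2) by (simp add: emeasure_eq_measure poisson_distributed_def)
  also have "\<dots> = emeasure (measure_pmf (poisson_pmf r)) {k}"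
    using assms(3) by (simp add: emeasure_pmf_single)
  finally show "emeasure (distr P (count_space UNIV) X) {k} = emeasure (measure_pmf (poisson_pmf r)) {k}" .
qed auto

text \<open>The probability generating function. At \<open>x = 0\<close>, where
  \<open>0 ^ 0 = 1\<close>, the integrand is the indicator of no emission, so vacancy and
  exponential moments come from one formula.\<close>

lemma poisson_nn_integral_power:
  assumes "prob_space P" "poisson_distributed P X r" "0 < r" "0 \<le> x"
  shows "(\<integral>\<^sup>+\<omega>. ennreal (x ^ X \<omega>) \<partial>P) = ennreal (exp ((x - 1) * r))"
proof -
  have X: "X \<in> P \<rightarrow>\<^sub>M count_space UNIV" using assms(2) by (simp add: poisson_distributed_def)
  have "(\<integral>\<^sup>+\<omega>. ennreal (x ^ X \<omega>) \<partial>P) = (\<integral>\<^sup>+k. ennreal (x ^ k) \<partial>distr P (count_space UNIV) X)"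
    using X by (subst nn_integral_distr) auto
  also have "\<dots> = (\<Sum>k. ennreal (pmf (poisson_pmf r) k) * ennreal (x ^ k))"
    unfolding distr_poisson[OF assms(1-3)]
    by (simp add: nn_integral_measure_pmf nn_integral_count_space_nat)
  also have "\<dots> = (\<Sum>k. ennreal (exp (- r) * ((x * r) ^ k /\<^sub>R fact k)))"
    using assms by (simp add: ennreal_mult[symmetric] power_mult_distrib field_simps)
  also have "\<dots> = ennreal (\<Sum>k. exp (- r) * ((x * r) ^ k /\<^sub>R fact k))"
    using assms exp_converges[of "x * r"]
    by (intro suminf_ennreal2 summable_mult) (auto simp: sums_iff)
  also have "(\<Sum>k. exp (- r) * ((x * r) ^ k /\<^sub>R fact k)) = exp ((x - 1) * r)"
    using exp_converges[of "x * r"]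
    by (subst suminf_mult) (auto simp: sums_iff exp_add[symmetric] algebra_simps)
  finally show ?thesis .
qed

text \<open>Only the numbers of particles per level enter here, so both models fit: with the given
  counts, or with the numbers of clock points in \<open>{0..real n}\<close>.\<close>

locale poisson_sources = prob_space P for P :: "'a measure" +
  fixes N :: "int \<Rightarrow> 'a \<Rightarrow> nat" and n :: nat
  assumes n: "1 \<le> n"
    and N_poisson: "\<And>i. poisson_distributed P (N i) (real n)"
    and N_indep: "indep_vars (\<lambda>_. count_space UNIV) N UNIV"
begin

lemma N_measurable [measurable]: "N i \<in> P \<rightarrow>\<^sub>M count_space UNIV"
  using N_poisson by (simp add: poisson_distributed_def)

definition vacant :: "int \<Rightarrow> nat \<Rightarrow> 'a set" where
  "vacant a R = {\<omega> \<in> space P. \<forall>k\<in>{a - int R..a + int R}. N k \<omega> = 0}"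

text \<open>The case \<open>r = 0\<close> asks that level \<open>a\<close> itself emit nothing, in
  accordance with the bound \<open>C * r\<close> imposed on lists.\<close>

definition sparse :: "int \<Rightarrow> 'a set" where
  "sparse a = {\<omega> \<in> space P. \<forall>r::nat. (\<Sum>k\<in>{a - int r..a + int r}. N k \<omega>) \<le> 8 * n * r}"

lemma vacant_event [measurable]: "vacant a R \<in> events"
  unfolding vacant_def by measurable

lemma sparse_event [measurable]: "sparse a \<in> events"
  unfolding sparse_def by measurable

text \<open>
  Markov's inequality for \<open>2 ^ (\<Sum>k. N k)\<close> on the event that the block is vacant; the factor
  \<open>8\<close> is large enough for \<open>2 ^ (8 n r)\<close> to beat the exponential moment \<open>exp (2 n r)\<close>.
\<close>

lemma vacant_overcrowded_prob_le:
  assumes "R < r"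
  shows "prob (vacant a R \<inter> {\<omega> \<in> space P. 8 * n * r < (\<Sum>k\<in>{a - int r..a + int r}. N k \<omega>)})
     \<le> exp (- real n) ^ (2 * R + 1) * (1/2) ^ r"
proof -
  let ?I = "{a - int r..a + int r}" and ?B = "{a - int R..a + int R}"
  \<comment> \<open>With base 0 on the block, the power is the indicator that a level is silent;
    with base 2 outside, it is the weight for Markov's inequality. By independence the expectation
    of the product factorizes over the levels.\<close>
  define x :: "int \<Rightarrow> real" where "x k = (if k \<in> ?B then 0 else 2)" for k
  let ?Y = "\<lambda>\<omega>. \<Prod>k\<in>?I. ennreal (x k ^ N k \<omega>)"
  let ?E = "vacant a R \<inter> {\<omega> \<in> space P. 8 * n * r < (\<Sum>k\<in>?I. N k \<omega>)}"
  have pos: "0 < real n" using n by simp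
  have cardI: "card ?I = 2 * r + 1" and cardB: "card ?B = 2 * R + 1" by auto
  have B_sub: "?B \<subseteq> ?I" using assms by auto
  have "(\<integral>\<^sup>+\<omega>. ?Y \<omega> \<partial>P) = (\<Prod>k\<in>?I. \<integral>\<^sup>+\<omega>. ennreal (x k ^ N k \<omega>) \<partial>P)"
  proof (rule indep_vars_nn_integral)
    show "indep_vars (\<lambda>_. borel) (\<lambda>k \<omega>. ennreal (x k ^ N k \<omega>)) ?I"
      using indep_vars_compose2[OF indep_vars_subset[OF N_indep, of ?I], of "\<lambda>k m. ennreal (x k ^ m)" "\<lambda>_. borel"]
      by auto
  qed auto
  also have "\<dots> = (\<Prod>k\<in>?I. ennreal (exp ((x k - 1) * real n)))"
    by (intro prod.cong refl poisson_nn_integral_power[OF prob_space_axioms N_poisson pos]) (simp add: x_def)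
  also have "\<dots> = ennreal (\<Prod>k\<in>?I. exp ((x k - 1) * real n))"
    by (rule prod_ennreal) simp
  also have "(\<Prod>k\<in>?I. exp ((x k - 1) * real n)) = (\<Prod>k\<in>?B. exp (- real n)) * (\<Prod>k\<in>?I - ?B. exp (real n))"
  proof -
    have "(\<Prod>k\<in>?I. exp ((x k - 1) * real n))
        = (\<Prod>k\<in>?I - ?B. exp ((x k - 1) * real n)) * (\<Prod>k\<in>?B. exp ((x k - 1) * real n))"
      by (rule prod.subset_diff[OF B_sub]) simp
    also have "(\<Prod>k\<in>?I - ?B. exp ((x k - 1) * real n)) = (\<Prod>k\<in>?I - ?B. exp (real n))"
      by (rule prod.cong) (auto simp: x_def)
    also have "(\<Prod>k\<in>?B. exp ((x k - 1) * real n)) = (\<Prod>k\<in>?B. exp (- real n))"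
      by (rule prod.cong) (auto simp: x_def)
    finally show ?thesis by (simp only: mult.commute)
  qed
  also have "(\<Prod>k\<in>?B. exp (- real n)) = exp (- real n) ^ (2 * R + 1)"
    by (simp only: prod_constant cardB)
  \<comment> \<open>Outside the block there are \<open>2 * r - 2 * R\<close> levels, each with
    exponential moment \<open>exp (real n)\<close>.\<close>
  also have "(\<Prod>k\<in>?I - ?B. exp (real n)) \<le> exp (real n) ^ (2 * r)"
    using B_sub cardI cardB by (simp only: prod_constant card_Diff_subset finite_atLeastAtMost_int)
      (intro power_increasing, auto)
  finally have int: "(\<integral>\<^sup>+\<omega>. ?Y \<omega> \<partial>P) \<le> ennreal (exp (- real n) ^ (2 * R + 1) * exp (real n) ^ (2 * r))"
    by (simp add: ennreal_leI mult_left_mono)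
  have ind: "indicator ?E \<omega> \<le> ennreal ((1/2) ^ (8 * n * r)) * ?Y \<omega>" if "\<omega> \<in> space P" for \<omega>
  proof (cases "\<omega> \<in> ?E")
    case True
    have "?Y \<omega> = (\<Prod>k\<in>?I. ennreal (2 ^ N k \<omega>))"
    proof (intro prod.cong refl)
      fix k assume "k \<in> ?I"
      show "ennreal (x k ^ N k \<omega>) = ennreal (2 ^ N k \<omega>)"
      proof (cases "k \<in> ?B")
        case True
        then have "N k \<omega> = 0" using \<open>\<omega> \<in> ?E\<close> unfolding vacant_def by blast
        then show ?thesis by simp
      qed (auto simp: x_def)
    qed
    also have "\<dots> = ennreal (2 ^ (\<Sum>k\<in>?I. N k \<omega>))"
      by (simp add: prod_ennreal power_sum)
    also have "ennreal ((1/2) ^ (8 * n * r)) * \<dots> = ennreal ((1/2) ^ (8 * n * r) * 2 ^ (\<Sum>k\<in>?I. N k \<omega>))"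
      by (simp add: ennreal_mult)
    also have "1 \<le> \<dots>"
    proof -
      have "(1::real) = (1/2) ^ (8 * n * r) * 2 ^ (8 * n * r)" by (simp add: power_one_over)
      also have "\<dots> \<le> (1/2) ^ (8 * n * r) * 2 ^ (\<Sum>k\<in>?I. N k \<omega>)"
        using True by (intro mult_left_mono power_increasing) auto
      finally show ?thesis by (simp add: ennreal_leI flip: ennreal_1)
    qed
    finally show ?thesis using True by simp
  qed simp
  have Em: "?E \<in> events" by measurable
  have "ennreal (prob ?E) = (\<integral>\<^sup>+\<omega>. indicator ?E \<omega> \<partial>P)"
    using Em by (simp add: emeasure_eq_measure)
  also have "\<dots> \<le> (\<integral>\<^sup>+\<omega>. ennreal ((1/2) ^ (8 * n * r)) * ?Y \<omega> \<partial>P)"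
    by (intro nn_integral_mono ind)
  also have "\<dots> = ennreal ((1/2) ^ (8 * n * r)) * (\<integral>\<^sup>+\<omega>. ?Y \<omega> \<partial>P)"
    by (rule nn_integral_cmult) measurable
  also have "\<dots> \<le> ennreal ((1/2) ^ (8 * n * r)) * ennreal (exp (- real n) ^ (2 * R + 1) * exp (real n) ^ (2 * r))"
    by (intro mult_left_mono int) simp
  also have "\<dots> = ennreal ((1/2) ^ (8 * n * r) * (exp (- real n) ^ (2 * R + 1) * exp (real n) ^ (2 * r)))"
    by (rule ennreal_mult[symmetric]) auto
  finally have "prob ?E \<le> (1/2) ^ (8 * n * r) * (exp (- real n) ^ (2 * R + 1) * exp (real n) ^ (2 * r))"
    by (subst (asm) ennreal_le_iff) auto
  also have "\<dots> = exp (- real n) ^ (2 * R + 1) * ((1/2) ^ (8 * n * r) * exp (real n) ^ (2 * r))"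
    by (simp only: ac_simps)
  \<comment> \<open>Here 256 is \<open>2 ^ 8\<close>; as \<open>exp 1 * exp 1\<close> is at most 9,
    the base on the right is below 1/2.\<close>
  also have "(1/2) ^ (8 * n * r) * exp (real n) ^ (2 * r) = ((1/256) * (exp 1 * exp 1)) ^ (n * r)"
  proof -
    have "(1/2::real) ^ (8 * n * r) = (1/256) ^ (n * r)"
      unfolding mult.assoc power_mult[of _ 8] by (simp add: power_one_over)
    moreover have "exp (real n) ^ (2 * r) = (exp 1 * exp 1 :: real) ^ (n * r)"
    proof -
      have "exp (real n) ^ (2 * r) = exp (real (2 * r) * real n)"
        by (rule exp_of_nat_mult[symmetric])
      also have "real (2 * r) * real n = real (n * r) * (1 + 1)" by simp
      also have "exp \<dots> = (exp (1 + 1)) ^ (n * r)" by (rule exp_of_nat_mult)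
      finally show ?thesis by (simp only: exp_add)
    qed
    ultimately show ?thesis by (simp only: power_mult_distrib)
  qed
  also have "\<dots> \<le> (1/2) ^ (n * r)"
  proof (rule power_mono)
    have "exp 1 * exp 1 \<le> (3 * 3 :: real)"
      using exp_le by (intro mult_mono) auto
    then show "(1/256) * (exp 1 * exp 1) \<le> (1/2 :: real)" by simp
  qed simp
  also have "\<dots> \<le> (1/2) ^ r"
    using n by (intro power_decreasing) auto
  finally show ?thesis by (simp add: mult_left_mono)
qed

lemma vacant_prob: "prob (vacant a R) = exp (- real n) ^ (2 * R + 1)"
proof -
  let ?B = "{a - int R..a + int R}"
  have "vacant a R = (\<Inter>k\<in>?B. N k -` {0} \<inter> space P)"
    by (force simp: vacant_def)
  also have "prob \<dots> = (\<Prod>k\<in>?B. prob (N k -` {0} \<inter> space P))"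
    by (intro indep_varsD[OF N_indep]) auto
  also have "\<dots> = (\<Prod>k\<in>?B. exp (- real n))"
  proof (intro prod.cong refl)
    fix k
    have "N k -` {0} \<inter> space P = {\<omega> \<in> space P. N k \<omega> = 0}" by auto
    then show "prob (N k -` {0} \<inter> space P) = exp (- real n)"
      using N_poisson[of k] by (simp add: poisson_distributed_def)
  qed
  also have "\<dots> = exp (- real n) ^ card ?B" by (rule prod_constant)
  also have "card ?B = 2 * R + 1" by simp
  finally show ?thesis .
qed

text \<open>On a vacant block the ranges \<open>r \<le> R\<close> contain no particle, so
  overcrowding can only occur beyond \<open>R\<close>, where the geometric bounds add up to
  \<open>(1/2) ^ R\<close>. The factor \<open>prob (vacant a R)\<close> makes this an estimate
  conditional on a rare event.\<close>

lemma vacant_not_sparse_prob_le: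
  "prob (vacant a R - sparse a) \<le> prob (vacant a R) * (1/2) ^ R"
proof -
  let ?E = "\<lambda>r. vacant a R \<inter> {\<omega> \<in> space P. 8 * n * r < (\<Sum>k\<in>{a - int r..a + int r}. N k \<omega>)}"
  let ?p = "prob (vacant a R)"
  have sub: "vacant a R - sparse a \<subseteq> (\<Union>r. ?E (r + Suc R))"
  proof
    fix \<omega> assume \<omega>: "\<omega> \<in> vacant a R - sparse a"
    then obtain r where r: "8 * n * r < (\<Sum>k\<in>{a - int r..a + int r}. N k \<omega>)" "\<omega> \<in> space P"
      by (auto simp: sparse_def vacant_def not_le)
    have "R < r"
    proof (rule ccontr)
      assume "\<not> R < r"
      then have "(\<Sum>k\<in>{a - int r..a + int r}. N k \<omega>) = 0"
        using \<omega> by (intro sum.neutral) (auto simp: vacant_def)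
      then show False using r by simp
    qed
    then have "(r - Suc R) + Suc R = r" by simp
    then have "\<omega> \<in> ?E ((r - Suc R) + Suc R)" using \<omega> r by (simp only:) blast
    then show "\<omega> \<in> (\<Union>r. ?E (r + Suc R))" by (rule UN_I[OF UNIV_I])
  qed
  have le: "prob (?E (r + Suc R)) \<le> ?p * (1/2) ^ Suc R * (1/2) ^ r" for r
  proof -
    have "(1/2 :: real) ^ (r + Suc R) = (1/2) ^ Suc R * (1/2) ^ r"
      unfolding power_add by (rule mult.commute)
    then show ?thesis
      using vacant_overcrowded_prob_le[of R "r + Suc R" a] by (simp only: vacant_prob mult.assoc)
  qed
  have summ: "summable (\<lambda>r. ?p * (1/2) ^ Suc R * (1/2) ^ r)"
    by (intro summable_mult summable_geometric) simp
  have summ': "summable (\<lambda>r. prob (?E (r + Suc R)))"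
    by (rule summable_comparison_test'[OF summ, of 0]) (use le in auto)
  have "prob (vacant a R - sparse a) \<le> prob (\<Union>r. ?E (r + Suc R))"
    by (intro finite_measure_mono[OF sub]) measurable
  also have "\<dots> \<le> (\<Sum>r. prob (?E (r + Suc R)))"
    by (intro finite_measure_subadditive_countably summ') auto
  also have "\<dots> \<le> (\<Sum>r. ?p * (1/2) ^ Suc R * (1/2) ^ r)"
    by (intro suminf_le le summ summ')
  also have "\<dots> = ?p * (1/2) ^ Suc R * 2"
    by (subst suminf_mult) (auto simp: suminf_geometric summable_geometric)
  finally show ?thesis by simp
qed

text \<open>Centres more than \<open>2 * R\<close> apart have disjoint blocks, whose vacancies are
  independent.\<close>

lemma no_vacant_prob:
  fixes c :: "nat \<Rightarrow> int"
  assumes sep: "\<And>l m. l \<noteq> m \<Longrightarrow> int (2 * R) < \<bar>c l - c m\<bar>"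
  shows "prob {\<omega> \<in> space P. \<forall>l<q. \<omega> \<notin> vacant (c l) R} = (1 - prob (vacant 0 R)) ^ q"
proof (cases "q = 0")
  case True
  then show ?thesis by (simp add: prob_space)
next
  case False
  let ?K = "\<lambda>l. {c l - int R..c l + int R}"
  let ?M = "\<lambda>l. PiM (?K l) (\<lambda>_. count_space UNIV) :: (int \<Rightarrow> nat) measure"
  let ?X = "\<lambda>l \<omega>. restrict (\<lambda>i. N i \<omega>) (?K l)"
  have disj: "disjoint_family_on ?K {..<q}"
    unfolding disjoint_family_on_def
  proof (intro ballI impI)
    fix l m :: nat assume "l \<noteq> m"
    show "?K l \<inter> ?K m = {}"
    proof (rule equals0I)
      fix x assume "x \<in> ?K l \<inter> ?K m"
      then have "\<bar>c l - c m\<bar> \<le> int (2 * R)" by simp linarith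
      then show False using sep[OF \<open>l \<noteq> m\<close>] by simp
    qed
  qed
  have iv: "indep_vars ?M ?X {..<q}"
    by (rule indep_vars_restrict[OF N_indep _ disj]) simp
  \<comment> \<open>Non-vacancy as an event on the coordinates of a single block, to which
    independence of the restrictions applies.\<close>
  define Z where "Z l = space (?M l) - (\<Inter>k\<in>?K l. (\<lambda>f. f k) -` {0} \<inter> space (?M l))" for l
  have Z: "Z l \<in> sets (?M l)" for l
    unfolding Z_def
    by (intro sets.Diff sets.top sets.finite_INT measurable_sets[OF measurable_component_singleton]) auto
  have eq: "?X l -` Z l \<inter> space P = space P - vacant (c l) R" if "l < q" for l
  proof -
    have "?X l \<omega> \<in> space (?M l)" for \<omega> by (simp add: space_PiM)
    then have "?X l \<omega> \<in> Z l \<longleftrightarrow> \<not> (\<forall>k\<in>?K l. N k \<omega> = 0)" for \<omega>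
      unfolding Z_def by (simp only: Diff_iff INT_iff Int_iff vimage_eq singleton_iff) auto
    note Z_iff = this
    show ?thesis
    proof (rule set_eqI)
      fix \<omega>
      show "\<omega> \<in> ?X l -` Z l \<inter> space P \<longleftrightarrow> \<omega> \<in> space P - vacant (c l) R"
        unfolding vimage_eq Int_iff Diff_iff Z_iff vacant_def mem_Collect_eq by argo
    qed
  qed
  have "{\<omega> \<in> space P. \<forall>l<q. \<omega> \<notin> vacant (c l) R} = (\<Inter>l\<in>{..<q}. ?X l -` Z l \<inter> space P)"
    using False eq by auto
  also have "prob \<dots> = (\<Prod>l<q. prob (?X l -` Z l \<inter> space P))"
    using False Z by (intro indep_varsD[OF iv]) auto
  also have "\<dots> = (\<Prod>l<q. 1 - prob (vacant 0 R))"
    by (intro prod.cong refl) (simp add: eq prob_compl vacant_prob)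
  finally show ?thesis by simp
qed

end

section \<open>Missed levels\<close>

text \<open>The tail beyond \<open>R\<close> of the convergent series of terms 2 C r \<eta>^r, where
  \<eta> is the fourth root of \<open>1 - (1/4) ^ (12 * C)\<close>. The term of index r pays for the
  at most C r particles at distance r.\<close>

definition tail_weight :: "nat \<Rightarrow> nat \<Rightarrow> real" where
  "tail_weight C R =
     (\<Sum>r. 2 * real C * (real (r + Suc R) * ((1 - (1/4) ^ (12 * C)) powr (1/4)) ^ (r + Suc R)))"

lemma tail_base:
  assumes "1 \<le> C"
  shows "0 < (1 - (1/4) ^ (12 * C)) powr (1/4 :: real)" "(1 - (1/4) ^ (12 * C)) powr (1/4 :: real) < 1"
proof -
  have "(1/4::real) ^ (12 * C) \<le> (1/4) ^ 1" using assms by (intro power_decreasing) auto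
  then have *: "0 < 1 - (1/4::real) ^ (12 * C)" "1 - (1/4::real) ^ (12 * C) < 1" by auto
  then show "0 < (1 - (1/4) ^ (12 * C)) powr (1/4 :: real)" by simp
  show "(1 - (1/4) ^ (12 * C)) powr (1/4 :: real) < 1"
    using * powr_less_mono2[of "1/4" "1 - (1/4) ^ (12 * C)" 1] by simp
qed

lemma summable_tail:
  assumes "1 \<le> C"
  shows "summable (\<lambda>r. 2 * real C * (real r * ((1 - (1/4) ^ (12 * C)) powr (1/4)) ^ r))"
proof -
  let ?\<eta> = "(1 - (1/4) ^ (12 * C)) powr (1/4) :: real"
  have "norm ?\<eta> < 1" using tail_base[OF assms] by simp
  from geometric_deriv_sums[OF this]
  have "summable (\<lambda>r. real (Suc r) * ?\<eta> ^ r)" by (rule sums_summable)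
  then have "summable (\<lambda>r. ?\<eta> * (real (Suc r) * ?\<eta> ^ r))" by (rule summable_mult)
  then have "summable (\<lambda>r. real (Suc r) * ?\<eta> ^ Suc r)" by (simp add: ac_simps)
  then have "summable (\<lambda>r. real r * ?\<eta> ^ r)"
    by (subst (asm) summable_Suc_iff)
  then show ?thesis by (rule summable_mult)
qed

lemma tail_weight_tendsto_0:
  assumes "1 \<le> C"
  shows "tail_weight C \<longlonglongrightarrow> 0"
proof (rule LIMSEQ_I)
  fix e :: real assume "0 < e"
  from suminf_exist_split[OF this summable_tail[OF assms]] obtain R0 where
    R0: "\<And>R. R \<ge> R0 \<Longrightarrow> norm (\<Sum>r. 2 * real C * (real (r + R) * ((1 - (1/4) ^ (12 * C)) powr (1/4)) ^ (r + R))) < e"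
    by blast
  show "\<exists>R0. \<forall>R\<ge>R0. norm (tail_weight C R - 0) < e"
  proof (intro exI[of _ R0] allI impI)
    fix R assume "R0 \<le> R"
    then show "norm (tail_weight C R - 0) < e"
      using R0[of "Suc R"] unfolding tail_weight_def by simp
  qed
qed

lemma tail_weight_nonneg:
  assumes "1 \<le> C"
  shows "0 \<le> tail_weight C R"
  unfolding tail_weight_def
proof (rule suminf_nonneg)
  show "summable (\<lambda>r. 2 * real C * (real (r + Suc R) * ((1 - (1/4) ^ (12 * C)) powr (1/4)) ^ (r + Suc R)))"
    using summable_ignore_initial_segment[OF summable_tail[OF assms], of "Suc R"] .
qed (use tail_base[OF assms] in simp)

text \<open>Particles are grouped by their distance \<open>r\<close> from \<open>a\<close>. At most
  \<open>C * r\<close> have exactly this distance, as even those within it are no more, and each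
  contributes \<open>2 * \<eta> ^ r\<close>. Distances start at \<open>Suc R\<close>, so the groups
  are dominated by distinct terms of the tail.\<close>

lemma sum_le_tail_weight:
  fixes ps :: "(int \<times> nat) list"
  assumes C: "1 \<le> C" and far: "\<And>p. p \<in> set ps \<Longrightarrow> int R < \<bar>fst p - a\<bar>"
    and dens: "\<And>r. card {p \<in> set ps. \<bar>fst p - a\<bar> \<le> int r} \<le> C * r"
  shows "(\<Sum>p\<in>set ps. 2 * (1 - (1/4) ^ (12 * C)) powr (real_of_int \<bar>fst p - a\<bar> / 4)) \<le> tail_weight C R"
proof -
  define \<eta> :: real where "\<eta> = (1 - (1/4) ^ (12 * C)) powr (1/4)"
  have \<eta>: "0 < \<eta>" "\<eta> < 1" using tail_base[OF C] by (auto simp: \<eta>_def)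
  define f where "f r = 2 * real C * (real r * \<eta> ^ r)" for r
  have f0: "0 \<le> f r" for r using \<eta> by (simp add: f_def)
  define D where "D p = nat \<bar>fst p - a\<bar>" for p :: "int \<times> nat"
  have "(\<Sum>p\<in>set ps. 2 * (1 - (1/4) ^ (12 * C)) powr (real_of_int \<bar>fst p - a\<bar> / 4))
      = (\<Sum>p\<in>set ps. 2 * \<eta> ^ D p)"
  proof (intro sum.cong refl)
    fix p
    have "\<eta> ^ D p = \<eta> powr real (D p)" using \<eta> by (simp add: powr_realpow)
    also have "real (D p) = real_of_int \<bar>fst p - a\<bar>" by (simp add: D_def)
    finally show "2 * (1 - (1/4) ^ (12 * C)) powr (real_of_int \<bar>fst p - a\<bar> / 4) = 2 * \<eta> ^ D p"
      by (simp add: \<eta>_def powr_powr)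
  qed
  also have "\<dots> = (\<Sum>r\<in>D ` set ps. \<Sum>p\<in>{p \<in> set ps. D p = r}. 2 * \<eta> ^ D p)"
    by (rule sum.image_gen) simp
  also have "\<dots> \<le> (\<Sum>r\<in>D ` set ps. f r)"
  proof (rule sum_mono)
    fix r assume "r \<in> D ` set ps"
    have "card {p \<in> set ps. D p = r} \<le> card {p \<in> set ps. \<bar>fst p - a\<bar> \<le> int r}"
      by (intro card_mono) (auto simp: D_def)
    then have "real (card {p \<in> set ps. D p = r}) \<le> real (C * r)"
      using dens[of r] by (simp only: of_nat_le_iff)
    then have "real (card {p \<in> set ps. D p = r}) * (2 * \<eta> ^ r) \<le> real (C * r) * (2 * \<eta> ^ r)"
      using \<eta> by (intro mult_right_mono) auto
    then show "(\<Sum>p\<in>{p \<in> set ps. D p = r}. 2 * \<eta> ^ D p) \<le> f r"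
      by (simp add: f_def mult_ac)
  qed
  also have "\<dots> = (\<Sum>s\<in>(\<lambda>r. r - Suc R) ` (D ` set ps). f (s + Suc R))"
  proof -
    have ge: "Suc R \<le> r" if "r \<in> D ` set ps" for r using far that by (force simp: D_def)
    have "inj_on (\<lambda>r. r - Suc R) (D ` set ps)"
      using ge by (intro inj_onI) (metis le_add_diff_inverse2)
    then have "(\<Sum>s\<in>(\<lambda>r. r - Suc R) ` (D ` set ps). f (s + Suc R)) = (\<Sum>r\<in>D ` set ps. f (r - Suc R + Suc R))"
      by (simp add: sum.reindex)
    also have "\<dots> = (\<Sum>r\<in>D ` set ps. f r)"
      using ge by (intro sum.cong refl) (simp only: le_add_diff_inverse2)
    finally show ?thesis by simp
  qed
  also have "\<dots> \<le> (\<Sum>s. f (s + Suc R))"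
  proof (rule sum_le_suminf)
    show "summable (\<lambda>s. f (s + Suc R))"
      using summable_tail[OF C] by (subst summable_iff_shift) (simp add: f_def[abs_def] \<eta>_def)
  qed (use f0 in auto)
  finally show ?thesis by (simp add: tail_weight_def f_def \<eta>_def)
qed

text \<open>
  \<open>L M \<omega>\<close> lists the particles from the levels \<open>\<bar>i\<bar> \<le> M\<close> in the order in which they are sent;
  \<open>\<Omega>\<close> is an event of probability one on which all the almost sure properties hold.
\<close>

locale emission = poisson_sources +
  fixes S :: "int \<Rightarrow> nat \<Rightarrow> 'a \<Rightarrow> path" and L :: "nat \<Rightarrow> 'a \<Rightarrow> (int \<times> nat) list" and \<Omega> :: "'a set"
  assumes walks: "independent_walks P S"
    and full: "\<Omega> \<in> events" "prob \<Omega> = 1"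
    and order_event: "\<And>M ps. {\<omega> \<in> \<Omega>. L M \<omega> = ps} \<in> events"
    and order_indep: "\<And>M ps W. W \<in> walk_events P S \<Longrightarrow>
        prob ({\<omega> \<in> \<Omega>. L M \<omega> = ps} \<inter> W) = prob {\<omega> \<in> \<Omega>. L M \<omega> = ps} * prob W"
    and order_distinct: "\<And>M \<omega>. \<omega> \<in> \<Omega> \<Longrightarrow> distinct (L M \<omega>)"
    and order_set: "\<And>M \<omega>. \<omega> \<in> \<Omega> \<Longrightarrow> set (L M \<omega>) = {(i, j). \<bar>i\<bar> \<le> int M \<and> 1 \<le> j \<and> j \<le> N i \<omega>}"
    and order_subseq: "\<And>M \<omega>. \<omega> \<in> \<Omega> \<Longrightarrow> subseq (L M \<omega>) (L (Suc M) \<omega>)"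
    and walk_start: "\<And>i j \<omega>. \<omega> \<in> \<Omega> \<Longrightarrow> (i, j) \<in> particles \<Longrightarrow> S i j \<omega> 0 = (0, i)"
    and walk_step: "\<And>i j t \<omega>. \<omega> \<in> \<Omega> \<Longrightarrow> (i, j) \<in> particles \<Longrightarrow> S i j \<omega> (Suc t) - S i j \<omega> t \<in> steps"
begin

definition agg_upto :: "nat \<Rightarrow> 'a \<Rightarrow> site set" where
  "agg_upto M \<omega> = send_all (\<lambda>i j. S i j \<omega>) (L M \<omega>)"

definition agg :: "'a \<Rightarrow> site set" where
  "agg \<omega> = (\<Union>M. agg_upto M \<omega>)"

lemma full_subset: "\<Omega> \<subseteq> space P"
  using full sets.sets_into_space by blast

lemma agg_upto_mono: "\<omega> \<in> \<Omega> \<Longrightarrow> M \<le> M' \<Longrightarrow> agg_upto M \<omega> \<subseteq> agg_upto M' \<omega>"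
  by (rule lift_Suc_mono_le[of "\<lambda>M. agg_upto M \<omega>"])
    (simp_all add: agg_upto_def send_all_subseq order_subseq)

lemma order_particles: "\<omega> \<in> \<Omega> \<Longrightarrow> set (L M \<omega>) \<subseteq> particles"
  by (auto simp: order_set particles_def)

definition visited_upto :: "nat \<Rightarrow> int \<Rightarrow> 'a set" where
  "visited_upto M a = {\<omega> \<in> \<Omega>. \<not> misses_level (agg_upto M \<omega>) a}"

definition visited :: "int \<Rightarrow> 'a set" where
  "visited a = {\<omega> \<in> \<Omega>. \<not> misses_level (agg \<omega>) a}"

lemma visited_upto_restrict:
  "visited_upto M a \<inter> {\<omega> \<in> \<Omega>. L M \<omega> = ps}
     = {\<omega> \<in> \<Omega>. L M \<omega> = ps} \<inter> {\<omega> \<in> space P. \<not> misses_level (send_all (\<lambda>i j. S i j \<omega>) ps) a}"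
  using full_subset by (auto simp: visited_upto_def agg_upto_def)

lemma order_event_inter:
  assumes "W \<in> walk_events P S"
  shows "{\<omega> \<in> \<Omega>. L M \<omega> = ps} \<inter> W \<in> events"
  using assms order_event visits_level_in_walk_events(2)[of "[]", OF _ walks] by (intro sets.Int) auto

text \<open>Lists of particles are countably many, so one order at a time can be checked; a list not
  contained in \<open>particles\<close> never occurs.\<close>

lemma visited_upto_event [measurable]: "visited_upto M a \<in> events"
proof -
  have "visited_upto M a \<inter> {\<omega> \<in> \<Omega>. L M \<omega> = ps} \<in> events" for ps
  proof (cases "set ps \<subseteq> particles")
    case True
    then show ?thesis
      unfolding visited_upto_restrict by (intro order_event_inter visits_level_in_walk_events(1) walks)
  next
    case False
    then have "{\<omega> \<in> \<Omega>. L M \<omega> = ps} = {}" using order_particles by blast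
    then show ?thesis by (simp only: Int_empty_right sets.empty_sets)
  qed
  then have "(\<Union>ps. visited_upto M a \<inter> {\<omega> \<in> \<Omega>. L M \<omega> = ps}) \<in> events"
    by (intro sets.countable_UN') auto
  also have "(\<Union>ps. visited_upto M a \<inter> {\<omega> \<in> \<Omega>. L M \<omega> = ps}) = visited_upto M a"
    by (auto simp: visited_upto_def)
  finally show ?thesis .
qed

lemma visited_eq: "visited a = (\<Union>M. visited_upto M a)"
  by (auto simp: visited_def visited_upto_def misses_level_def agg_def)

lemma visited_upto_incseq: "incseq (\<lambda>M. visited_upto M a)"
  using agg_upto_mono by (fastforce simp: incseq_def visited_upto_def misses_level_def)

lemma visited_event [measurable]: "visited a \<in> events"
  unfolding visited_eq by (intro sets.countable_UN'') auto

text \<open>Splits according to the list that is sent. The lists compatible with vacancy and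
  sparsity form \<open>V\<close>; for each of them the order is independent of the walks, and
  \<open>visit_prob_le\<close> bounds the probability of a visit by the tail.\<close>

lemma visited_upto_prob_le:
  assumes M: "\<bar>a\<bar> + int R \<le> int M"
  shows "prob (vacant a R \<inter> sparse a \<inter> visited_upto M a) \<le> tail_weight (8 * n) R * prob (vacant a R)"
proof -
  let ?C = "8 * n"
  have C: "1 \<le> ?C" using n by simp
  define V where "V = {ps :: (int \<times> nat) list. distinct ps \<and> set ps \<subseteq> particles \<and>
      (\<forall>p\<in>set ps. int R < \<bar>fst p - a\<bar>) \<and> (\<forall>r. card {p \<in> set ps. \<bar>fst p - a\<bar> \<le> int r} \<le> ?C * r)}"
  let ?F = "\<lambda>ps. {\<omega> \<in> \<Omega>. L M \<omega> = ps}"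
  let ?G = "\<lambda>ps. {\<omega> \<in> space P. \<not> misses_level (send_all (\<lambda>i j. S i j \<omega>) ps) a}"
  have G: "?G ps \<in> walk_events P S" if "ps \<in> V" for ps
    using that by (intro visits_level_in_walk_events(1) walks) (auto simp: V_def)
  have Ge: "?G ps \<in> events" if "ps \<in> V" for ps
    using G[OF that] visits_level_in_walk_events(2)[of "[]", OF _ walks] by auto
  have nonneg: "0 \<le> tail_weight ?C R" by (rule tail_weight_nonneg[OF C])
  have "vacant a R \<inter> sparse a \<inter> visited_upto M a \<subseteq> (\<Union>ps\<in>V. ?F ps \<inter> ?G ps)"
  proof
    fix \<omega> assume \<omega>: "\<omega> \<in> vacant a R \<inter> sparse a \<inter> visited_upto M a"
    then have \<omega>': "\<omega> \<in> \<Omega>" "\<omega> \<in> space P" using full_subset by (auto simp: visited_upto_def)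
    have "card {p \<in> set (L M \<omega>). \<bar>fst p - a\<bar> \<le> int r} \<le> ?C * r" for r
    proof -
      have "{p \<in> set (L M \<omega>). \<bar>fst p - a\<bar> \<le> int r} \<subseteq> Sigma {a - int r..a + int r} (\<lambda>i. {1..N i \<omega>})"
        by (auto simp: order_set[OF \<omega>'(1)])
      then have "card {p \<in> set (L M \<omega>). \<bar>fst p - a\<bar> \<le> int r} \<le> card (Sigma {a - int r..a + int r} (\<lambda>i. {1..N i \<omega>}))"
        by (intro card_mono) auto
      also have "\<dots> = (\<Sum>i\<in>{a - int r..a + int r}. N i \<omega>)" by simp
      also have "\<dots> \<le> ?C * r" using \<omega> by (auto simp: sparse_def)
      finally show ?thesis .
    qed
    moreover have "int R < \<bar>fst p - a\<bar>" if "p \<in> set (L M \<omega>)" for p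
    proof (rule ccontr)
      assume "\<not> ?thesis"
      then have "fst p \<in> {a - int R..a + int R}" by auto
      then have "N (fst p) \<omega> = 0" using \<omega> by (auto simp: vacant_def)
      then show False using that by (auto simp: order_set[OF \<omega>'(1)])
    qed
    ultimately have "L M \<omega> \<in> V"
      using order_particles order_distinct \<omega>' by (auto simp: V_def)
    then show "\<omega> \<in> (\<Union>ps\<in>V. ?F ps \<inter> ?G ps)"
      using \<omega> \<omega>' by (auto simp: visited_upto_def agg_upto_def)
  qed
  then have "prob (vacant a R \<inter> sparse a \<inter> visited_upto M a) \<le> prob (\<Union>ps\<in>V. ?F ps \<inter> ?G ps)"
    using Ge order_event by (intro finite_measure_mono) (auto intro!: sets.countable_UN')
  also have "\<dots> \<le> tail_weight ?C R * prob (\<Union>ps\<in>V. ?F ps)"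
  proof (rule prob_mixture_le)
    show "prob (?F ps \<inter> ?G ps) \<le> tail_weight ?C R * prob (?F ps)" if "ps \<in> V" for ps
    proof -
      have "prob (?G ps) \<le> (\<Sum>p\<in>set ps. 2 * (1 - (1/4) ^ (12 * ?C)) powr (real_of_int \<bar>fst p - a\<bar> / 4))"
        using that by (intro visit_prob_le[OF prob_space_axioms walks _ _ C]) (auto simp: V_def)
      also have "\<dots> \<le> tail_weight ?C R"
        using that by (intro sum_le_tail_weight[OF C]) (auto simp: V_def)
      finally have "prob (?F ps) * prob (?G ps) \<le> prob (?F ps) * tail_weight ?C R"
        by (intro mult_left_mono) auto
      then show ?thesis using order_indep[OF G[OF that]] by (simp add: mult.commute)
    qed
  qed (use order_event Ge nonneg in \<open>auto simp: disjoint_family_on_def\<close>)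
  \<comment> \<open>A list in \<open>V\<close> has no particle from the block. Since
    \<open>M\<close> is so large that every particle of the block would be listed, the block is then
    vacant, which preserves the small factor.\<close>
  also have "\<dots> \<le> tail_weight ?C R * prob (vacant a R)"
  proof (intro mult_left_mono nonneg finite_measure_mono)
    show "(\<Union>ps\<in>V. ?F ps) \<subseteq> vacant a R"
    proof
      fix \<omega> assume "\<omega> \<in> (\<Union>ps\<in>V. ?F ps)"
      then have \<omega>: "\<omega> \<in> \<Omega>" "L M \<omega> \<in> V" by auto
      have "N k \<omega> = 0" if k: "k \<in> {a - int R..a + int R}" for k
      proof (rule ccontr)
        assume "N k \<omega> \<noteq> 0"
        then have "(k, 1) \<in> set (L M \<omega>)" using k M by (auto simp: order_set[OF \<omega>(1)])
        then have "int R < \<bar>k - a\<bar>" using \<omega>(2) by (auto simp: V_def)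
        then show False using k by auto
      qed
      then show "\<omega> \<in> vacant a R" using \<omega> full_subset by (auto simp: vacant_def)
    qed
  qed auto
  finally show ?thesis .
qed

text \<open>The bound for large finite \<open>M\<close> does not depend on \<open>M\<close> and
  passes to the increasing limit; the outcomes that are vacant but not sparse are added as a further
  error.\<close>

lemma vacant_visited_prob_le:
  "prob (vacant a R \<inter> visited a) \<le> prob (vacant a R) * (tail_weight (8 * n) R + (1/2) ^ R)"
proof -
  let ?G = "vacant a R \<inter> sparse a"
  have inc: "incseq (\<lambda>M. ?G \<inter> visited_upto M a)"
    using visited_upto_incseq[of a] unfolding incseq_def by blast
  have "(\<lambda>M. prob (?G \<inter> visited_upto M a)) \<longlonglongrightarrow> prob (\<Union>M. ?G \<inter> visited_upto M a)"
    by (rule finite_Lim_measure_incseq[OF _ inc]) auto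
  then have "prob (\<Union>M. ?G \<inter> visited_upto M a) \<le> tail_weight (8 * n) R * prob (vacant a R)"
  proof (rule LIMSEQ_le_const2)
    have "prob (?G \<inter> visited_upto M a) \<le> tail_weight (8 * n) R * prob (vacant a R)"
      if "nat (\<bar>a\<bar> + int R) \<le> M" for M
      using that by (intro visited_upto_prob_le) linarith
    then show "\<exists>M0. \<forall>M\<ge>M0. prob (?G \<inter> visited_upto M a) \<le> tail_weight (8 * n) R * prob (vacant a R)"
      by blast
  qed
  moreover have "(\<Union>M. ?G \<inter> visited_upto M a) = ?G \<inter> visited a"
    unfolding visited_eq by blast
  moreover have "prob (vacant a R \<inter> visited a) \<le> prob ((?G \<inter> visited a) \<union> (vacant a R - sparse a))"
    by (rule finite_measure_mono) (blast, measurable)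
  moreover have "\<dots> \<le> prob (?G \<inter> visited a) + prob (vacant a R - sparse a)"
    by (rule measure_Un_le) measurable
  moreover note vacant_not_sparse_prob_le[of a R]
  ultimately show ?thesis
    by (simp only: distrib_left mult.commute[of "tail_weight (8 * n) R"])
qed

text \<open>The sign \<open>s\<close> treats the levels from \<open>m\<close> upwards and those from
  \<open>- m\<close> downwards in one go.\<close>

lemma all_visited_event:
  "{\<omega> \<in> \<Omega>. \<forall>i. m \<le> s * i \<longrightarrow> \<omega> \<in> visited i} \<in> events"
proof -
  have "{\<omega> \<in> \<Omega>. \<forall>i. m \<le> s * i \<longrightarrow> \<omega> \<in> visited i}
      = \<Omega> \<inter> {\<omega> \<in> space P. \<forall>i. m \<le> s * i \<longrightarrow> \<omega> \<in> visited i}"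
    using full_subset by blast
  then show ?thesis using full by simp
qed

text \<open>
  With \<open>p\<close> the probability that a block of \<open>2 R + 1\<close> levels is vacant, about \<open>\<lambda> / p\<close> disjoint
  blocks contain a vacant one up to probability \<open>exp (- \<lambda>)\<close>, while the expected
  number of vacant blocks with a visited centre is small when \<open>R\<close> is large.
\<close>

lemma all_visited_prob:
  fixes s m :: int
  assumes s: "s = 1 \<or> s = -1"
  shows "prob {\<omega> \<in> \<Omega>. \<forall>i. m \<le> s * i \<longrightarrow> \<omega> \<in> visited i} = 0"
proof -
  let ?Z = "{\<omega> \<in> \<Omega>. \<forall>i. m \<le> s * i \<longrightarrow> \<omega> \<in> visited i}"
  have "prob ?Z \<le> \<epsilon>" if \<epsilon>: "0 < \<epsilon>" for \<epsilon>
  proof -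
    \<comment> \<open>Chosen so that \<open>exp (- \<mu>)\<close> is at most
      \<open>\<epsilon> / 2\<close>; the absolute value keeps \<open>\<mu>\<close> nonnegative when
      \<open>\<epsilon>\<close> is large.\<close>
    define \<mu> where "\<mu> = \<bar>ln (\<epsilon> / 2)\<bar>"
    have "exp (- \<mu>) \<le> exp (ln (\<epsilon> / 2))" by (simp add: \<mu>_def)
    then have \<mu>: "exp (- \<mu>) \<le> \<epsilon> / 2" "0 \<le> \<mu>" using \<epsilon> by (auto simp: \<mu>_def)
    have "(\<lambda>R. tail_weight (8 * n) R + (1/2) ^ R) \<longlonglongrightarrow> 0 + 0"
      using n by (intro tendsto_add tail_weight_tendsto_0 LIMSEQ_power_zero) auto
    moreover have "0 < \<epsilon> / 2 / (\<mu> + 1)" using \<epsilon> \<mu> by simp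
    ultimately have "\<forall>\<^sub>F R in sequentially. tail_weight (8 * n) R + (1/2) ^ R < \<epsilon> / 2 / (\<mu> + 1)"
      by (intro order_tendstoD(2)[of _ 0]) auto
    \<comment> \<open>\<open>R\<close> has to be fixed first, as \<open>p\<close> and
      \<open>q\<close> depend on it. The tolerance therefore only involves \<open>\<mu> + 1\<close>,
      which will bound the expected number of vacant blocks for every \<open>R\<close>.\<close>
    then obtain R where R: "tail_weight (8 * n) R + (1/2) ^ R < \<epsilon> / 2 / (\<mu> + 1)"
      using eventually_happens'[OF sequentially_bot] by blast
    define p where "p = prob (vacant 0 R)"
    have p_eq: "prob (vacant a R) = p" for a by (simp only: p_def vacant_prob)
    have p: "0 < p" "p \<le> 1" unfolding p_def by (simp add: vacant_prob, simp)
    \<comment> \<open>The least number of blocks for which the expected number of vacant ones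
      reaches \<open>\<mu>\<close>; as \<open>p \<le> 1\<close>, rounding up exceeds
      \<open>\<mu>\<close> by at most 1.\<close>
    define q where "q = nat \<lceil>\<mu> / p\<rceil>"
    have q: "\<mu> \<le> real q * p" "real q * p \<le> \<mu> + 1"
    proof -
      have q': "real q = of_int \<lceil>\<mu> / p\<rceil>" using \<mu> p by (simp add: q_def)
      have "\<mu> / p \<le> real q" unfolding q' by simp
      then show "\<mu> \<le> real q * p" using p by (simp add: field_simps)
      have "real q \<le> \<mu> / p + 1" unfolding q' by linarith
      then have "real q * p \<le> (\<mu> / p + 1) * p" using p by (intro mult_right_mono) auto
      also have "\<dots> = \<mu> + p" using p by (simp add: field_simps)
      finally show "real q * p \<le> \<mu> + 1" using p by simp
    qed
    \<comment> \<open>\<open>2 * R + 1\<close> is the least spacing with disjoint blocks, and all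
      centres lie on the half-line under consideration.\<close>
    define c where "c l = s * (m + int l * int (2 * R + 1))" for l :: nat
    have sep: "int (2 * R) < \<bar>c l - c l'\<bar>" if "l \<noteq> l'" for l l'
    proof -
      have c': "c l = s * m + s * (int l * int (2 * R + 1))" for l
        unfolding c_def by (rule distrib_left)
      have "c l - c l' = s * ((int l - int l') * int (2 * R + 1))"
        unfolding c' by (simp only: left_diff_distrib right_diff_distrib add_diff_cancel_left)
      then have "\<bar>c l - c l'\<bar> = \<bar>s\<bar> * (\<bar>int l - int l'\<bar> * \<bar>int (2 * R + 1)\<bar>)"
        by (simp only: abs_mult)
      also have "\<dots> = \<bar>int l - int l'\<bar> * int (2 * R + 1)"
        using s by (elim disjE) (simp_all only: abs_minus_cancel abs_one mult_1 abs_of_nat)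
      also have "\<dots> \<ge> 1 * int (2 * R + 1)" using that by (intro mult_right_mono) auto
      finally show ?thesis by simp
    qed
    let ?none = "{\<omega> \<in> space P. \<forall>l<q. \<omega> \<notin> vacant (c l) R}"
    let ?some = "\<Union>l\<in>{..<q}. vacant (c l) R \<inter> visited (c l)"
    have "?Z \<subseteq> ?none \<union> ?some"
    proof
      fix \<omega> assume \<omega>: "\<omega> \<in> ?Z"
      have "m \<le> s * c l" for l
      proof -
        have "s * c l = (s * s) * (m + int l * int (2 * R + 1))"
          unfolding c_def by (rule mult.assoc[symmetric])
        also have "s * s = 1" using s by auto
        finally show ?thesis by simp
      qed
      then have "\<omega> \<in> visited (c l)" for l using \<omega> by blast
      moreover have "\<omega> \<in> space P" using \<omega> full_subset by blast
      ultimately show "\<omega> \<in> ?none \<union> ?some" by blast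
    qed
    then have "prob ?Z \<le> prob (?none \<union> ?some)"
      by (rule finite_measure_mono) measurable
    also have "\<dots> \<le> prob ?none + prob ?some"
      by (rule measure_Un_le) measurable
    also have "\<dots> \<le> \<epsilon> / 2 + \<epsilon> / 2"
    proof (rule add_mono)
      have "prob ?none = (1 - p) ^ q"
        unfolding p_def by (rule no_vacant_prob) (rule sep)
      also have "\<dots> \<le> exp (- p) ^ q"
        using p exp_ge_add_one_self[of "- p"] by (intro power_mono) auto
      also have "\<dots> = exp (- (real q * p))"
        using exp_of_nat_mult[of q "- p"] by simp
      also have "\<dots> \<le> exp (- \<mu>)" using q by simp
      also have "\<dots> \<le> \<epsilon> / 2" by (rule \<mu>)
      finally show "prob ?none \<le> \<epsilon> / 2" .
      have "prob ?some \<le> (\<Sum>l<q. prob (vacant (c l) R \<inter> visited (c l)))"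
        by (rule finite_measure_subadditive_finite) auto
      also have "\<dots> \<le> (\<Sum>l<q. p * (tail_weight (8 * n) R + (1/2) ^ R))"
      proof (rule sum_mono)
        fix l
        show "prob (vacant (c l) R \<inter> visited (c l)) \<le> p * (tail_weight (8 * n) R + (1/2) ^ R)"
          using vacant_visited_prob_le[of "c l" R] unfolding p_eq .
      qed
      also have "\<dots> = (real q * p) * (tail_weight (8 * n) R + (1/2) ^ R)" by simp
      also have "\<dots> \<le> (real q * p) * (\<epsilon> / 2 / (\<mu> + 1))"
        using R p by (intro mult_left_mono) auto
      also have "\<dots> \<le> (\<mu> + 1) * (\<epsilon> / 2 / (\<mu> + 1))"
        using q \<epsilon> \<mu> by (intro mult_right_mono) auto
      also have "\<dots> = \<epsilon> / 2"
      proof -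
        have "\<mu> + 1 \<noteq> 0" using \<mu>(2) by linarith
        then show ?thesis by (metis times_divide_eq_right nonzero_mult_div_cancel_left)
      qed
      finally show "prob ?some \<le> \<epsilon> / 2" .
    qed
    finally show ?thesis by simp
  qed
  then have "prob ?Z \<le> 0" by (rule field_le_epsilon) simp
  then show ?thesis by (simp add: measure_le_0_iff)
qed

end

section \<open>Connected components\<close>

lemma misses_levelD: "misses_level A z \<Longrightarrow> v \<in> A \<Longrightarrow> snd v \<noteq> z"
  by (cases v) (auto simp: misses_level_def)

text \<open>Discrete intermediate value property: a step of length one changes the height by at most
  one and cannot jump over \<open>z\<close>.\<close>

lemma lattice_path_same_side:
  assumes "successively (\<lambda>u v. l1_dist u v = 1) p" "p \<noteq> []" "\<And>v. v \<in> set p \<Longrightarrow> snd v \<noteq> z"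
  shows "snd (hd p) < z \<longleftrightarrow> snd (last p) < z"
  using assms
proof (induction p rule: induct_list012)
  case (3 x y zs)
  have "l1_dist x y = 1" "snd x \<noteq> z" "snd y \<noteq> z" using "3.prems" by auto
  then have "snd x < z \<longleftrightarrow> snd y < z" by (simp add: l1_dist_def) linarith
  moreover have "snd y < z \<longleftrightarrow> snd (last (y # zs)) < z"
    using "3.IH"(2) "3.prems" by simp
  ultimately show ?case by simp
qed auto

lemma walk_same_side:
  fixes u :: path
  assumes "\<And>s. u (Suc s) - u s \<in> steps" "\<And>s. s \<le> t \<Longrightarrow> snd (u s) \<noteq> z"
  shows "snd (u 0) < z \<longleftrightarrow> snd (u t) < z"
  using assms(2)
proof (induction t)
  case (Suc t)
  have "\<bar>snd (u (Suc t)) - snd (u t)\<bar> \<le> 1"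
    using assms(1)[of t] by (auto simp: steps_def prod_eq_iff)
  then have "snd (u t) < z \<longleftrightarrow> snd (u (Suc t)) < z"
    using Suc.prems[of t] Suc.prems[of "Suc t"] by linarith
  then show ?case using Suc by simp
qed simp

lemma component_same_side:
  assumes "C \<in> lattice_components A" "x \<in> C" "y \<in> C" "misses_level A z"
  shows "snd x < z \<longleftrightarrow> snd y < z"
proof -
  have C: "C \<subseteq> A" "lattice_connected C" using assms(1) by (auto simp: lattice_components_def)
  then obtain p where p: "p \<noteq> []" "hd p = x" "last p = y" "set p \<subseteq> C"
    "successively (\<lambda>u v. l1_dist u v = 1) p"
    using assms(2,3) unfolding lattice_connected_def by blast
  have "snd v \<noteq> z" if "v \<in> set p" for v
    using that p(4) C(1) misses_levelD[OF assms(4)] by blast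
  then show ?thesis using lattice_path_same_side[OF p(5,1)] p by blast
qed

text \<open>The ends are determined by the nearest elements of \<open>Z\<close> on either side of
  \<open>y\<close>. The run of levels so found is maximal, which later makes the strips
  disjoint.\<close>

lemma gap_around:
  fixes Z :: "int set"
  assumes "y \<notin> Z" "\<exists>z\<in>Z. z < y" "\<exists>z\<in>Z. y < z"
  shows "\<exists>a b. a \<le> y \<and> y \<le> b \<and> a - 1 \<in> Z \<and> b + 1 \<in> Z \<and> {a..b} \<inter> Z = {}"
proof -
  obtain l u where l: "l \<in> Z" "l < y" and u: "u \<in> Z" "y < u" using assms by blast
  define lo where "lo = Max (Z \<inter> {l..y})"
  define hi where "hi = Min (Z \<inter> {y..u})"
  have lo: "lo \<in> Z \<inter> {l..y}" unfolding lo_def using l by (intro Max_in) auto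
  have hi: "hi \<in> Z \<inter> {y..u}" unfolding hi_def using u by (intro Min_in) auto
  have "lo < y" "y < hi" using lo hi assms(1) by (auto simp: order_le_less)
  moreover have "{lo + 1..hi - 1} \<inter> Z = {}"
  proof (rule equals0I)
    fix z assume z: "z \<in> {lo + 1..hi - 1} \<inter> Z"
    show False
    proof (cases "z \<le> y")
      case True
      then have "z \<le> lo" unfolding lo_def using z lo by (intro Max_ge) auto
      then show False using z by simp
    next
      case False
      then have "hi \<le> z" unfolding hi_def using z hi by (intro Min_le) auto
      then show False using z by simp
    qed
  qed
  ultimately show ?thesis using lo hi by (intro exI[of _ "lo + 1"] exI[of _ "hi - 1"]) auto
qed

text \<open>The strips are the maximal runs of levels that are not missed. If two of them share a
  level, the missed level just beyond an end of one cannot lie in the other, so their ends agree. A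
  component stays in one strip because its paths cannot jump over a missed level.\<close>

lemma components_between_missed_levels:
  assumes up: "\<And>m. \<exists>z\<ge>m. misses_level A z" and down: "\<And>m. \<exists>z\<le>m. misses_level A z"
    and fin: "\<And>a b. misses_level A (a - 1) \<Longrightarrow> misses_level A (b + 1) \<Longrightarrow> finite (A \<inter> UNIV \<times> {a..b})"
  shows "\<forall>C\<in>lattice_components A. finite C" and "components_in_disjoint_strips A"
proof -
  let ?Z = "{z. misses_level A z}"
  define \<S> where "\<S> = {UNIV \<times> {a..b} :: site set | a b.
    a \<le> b \<and> a - 1 \<in> ?Z \<and> b + 1 \<in> ?Z \<and> {a..b} \<inter> ?Z = {}}"
  have *: "\<exists>a b. a \<le> b \<and> a - 1 \<in> ?Z \<and> b + 1 \<in> ?Z \<and> {a..b} \<inter> ?Z = {} \<and> C \<subseteq> UNIV \<times> {a..b}"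
    if C: "C \<in> lattice_components A" for C
  proof -
    obtain x where x: "x \<in> C" "x \<in> A" using C by (auto simp: lattice_components_def)
    have "snd x \<notin> ?Z" using x by (cases x) (auto simp: misses_level_def)
    moreover have "\<exists>z\<in>?Z. z < snd x"
      using down[of "snd x - 1"] by force
    moreover have "\<exists>z\<in>?Z. snd x < z"
      using up[of "snd x + 1"] by force
    ultimately obtain a b where ab: "a \<le> snd x" "snd x \<le> b" "a - 1 \<in> ?Z" "b + 1 \<in> ?Z" "{a..b} \<inter> ?Z = {}"
      using gap_around[of "snd x" ?Z] by blast
    have "C \<subseteq> UNIV \<times> {a..b}"
    proof
      fix y assume y: "y \<in> C"
      then have "y \<in> A" using C by (auto simp: lattice_components_def)
      then have "snd y \<noteq> a - 1" using ab(3) by (cases y) (auto simp: misses_level_def)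
      moreover have "\<not> snd y < a - 1" "snd y < b + 1"
        using component_same_side[OF C x(1) y] ab by force+
      ultimately show "y \<in> UNIV \<times> {a..b}" by (cases y) auto
    qed
    then show ?thesis using ab by (intro exI[of _ a] exI[of _ b]) auto
  qed
  show "\<forall>C\<in>lattice_components A. finite C"
  proof
    fix C assume C: "C \<in> lattice_components A"
    from *[OF C] obtain a b where ab: "a - 1 \<in> ?Z" "b + 1 \<in> ?Z" "C \<subseteq> UNIV \<times> {a..b}" by blast
    have "C \<subseteq> A" using C by (simp add: lattice_components_def)
    then have "C \<subseteq> A \<inter> UNIV \<times> {a..b}" using ab by blast
    then show "finite C" using fin[of a b] ab finite_subset by blast
  qed
  show "components_in_disjoint_strips A"
    unfolding components_in_disjoint_strips_def
  proof (intro exI[of _ \<S>] conjI ballI)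
    show "\<S> \<subseteq> strips" by (auto simp: \<S>_def strips_def)
    show "disjoint \<S>"
    proof (rule disjointI)
      fix R R' assume R: "R \<in> \<S>" "R' \<in> \<S>" "R \<noteq> R'"
      then obtain a b a' b' where ab: "R = UNIV \<times> {a..b}" "R' = UNIV \<times> {a'..b'}"
        "a - 1 \<in> ?Z" "b + 1 \<in> ?Z" "{a..b} \<inter> ?Z = {}" "a' - 1 \<in> ?Z" "b' + 1 \<in> ?Z" "{a'..b'} \<inter> ?Z = {}"
        unfolding \<S>_def by blast
      show "R \<inter> R' = {}"
      proof (rule ccontr)
        assume "R \<inter> R' \<noteq> {}"
        then obtain y where y: "a \<le> y" "y \<le> b" "a' \<le> y" "y \<le> b'" using ab by auto
        have out: "z \<notin> {a..b}" "z \<notin> {a'..b'}" if "z \<in> ?Z" for z using ab that by blast+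
        have "a = a'" using out(2)[OF ab(3)] out(1)[OF ab(6)] y by auto
        moreover have "b = b'" using out(2)[OF ab(4)] out(1)[OF ab(7)] y by auto
        ultimately show False using R ab by simp
      qed
    qed
    fix C assume "C \<in> lattice_components A"
    from *[OF this] obtain a b where ab: "a \<le> b \<and> a - 1 \<in> ?Z \<and> b + 1 \<in> ?Z \<and> {a..b} \<inter> ?Z = {}"
      and C: "C \<subseteq> UNIV \<times> {a..b}" by blast
    then have "UNIV \<times> {a..b} \<in> \<S>" unfolding \<S>_def by blast
    then show "\<exists>R\<in>\<S>. C \<subseteq> R" using C by blast
  qed
qed

text \<open>Otherwise some \<open>Suc B\<close> points of the union would all lie in a single
  \<open>A M\<close>, by monotonicity.\<close>

lemma finite_UN_incseq_bounded:
  fixes A :: "nat \<Rightarrow> 'b set"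
  assumes inc: "\<And>M M'. M \<le> M' \<Longrightarrow> A M \<subseteq> A M'"
    and bound: "\<And>M. finite (A M)" "\<And>M. card (A M) \<le> B"
  shows "finite (\<Union>M. A M)"
proof (rule ccontr)
  assume "infinite (\<Union>M. A M)"
  then obtain F where F: "F \<subseteq> (\<Union>M. A M)" "finite F" "card F = Suc B"
    using infinite_arbitrarily_large by metis
  have "\<exists>M. F \<subseteq> A M" using F(2,1)
  proof (induction F rule: finite_induct)
    case (insert x F)
    then obtain M M' where "F \<subseteq> A M" "x \<in> A M'" by auto
    then have "insert x F \<subseteq> A (max M M')"
      using inc[of M "max M M'"] inc[of M' "max M M'"] by auto
    then show ?case by blast
  qed simp
  then obtain M where "F \<subseteq> A M" by blast
  then have "Suc B \<le> card (A M)" using bound F(3) card_mono by metis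
  then show False using bound(2)[of M] by simp
qed

context emission
begin

text \<open>The whole path of a particle up to its settling site lies in the final aggregate, so a
  particle that settles between the two missed levels also starts between them. The sites in the
  strip are thus at most as many as the particles emitted there, uniformly in
  \<open>M\<close>.\<close>

lemma finite_agg_between_missed_levels:
  assumes \<omega>: "\<omega> \<in> \<Omega>" and ab: "misses_level (agg \<omega>) (a - 1)" "misses_level (agg \<omega>) (b + 1)"
  shows "finite (agg \<omega> \<inter> UNIV \<times> {a..b})"
proof -
  let ?w = "\<lambda>i j. S i j \<omega>"
  have "agg \<omega> \<inter> UNIV \<times> {a..b} = (\<Union>M. agg_upto M \<omega> \<inter> UNIV \<times> {a..b})"
    by (auto simp: agg_def)
  also have "finite \<dots>"
  proof (rule finite_UN_incseq_bounded)
    show "agg_upto M \<omega> \<inter> UNIV \<times> {a..b} \<subseteq> agg_upto M' \<omega> \<inter> UNIV \<times> {a..b}" if "M \<le> M'" for M M'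
      using agg_upto_mono[OF \<omega> that] by blast
    fix M
    show "finite (agg_upto M \<omega> \<inter> UNIV \<times> {a..b})" by (simp add: agg_upto_def)
    let ?ps = "L M \<omega>"
    obtain f where f: "send_all ?w ?ps \<subseteq> f ` {l. l < length ?ps \<and>
        hits_within (send_all ?w (take l ?ps)) {f l} (?w (fst (?ps ! l)) (snd (?ps ! l)))}"
      using send_all_origin by blast
    let ?I = "{l. l < length ?ps \<and> fst (?ps ! l) \<in> {a..b}}"
    have "agg_upto M \<omega> \<inter> UNIV \<times> {a..b} \<subseteq> f ` ?I"
    proof
      fix z assume z: "z \<in> agg_upto M \<omega> \<inter> UNIV \<times> {a..b}"
      then obtain l where l: "l < length ?ps" "z = f l"
        "hits_within (send_all ?w (take l ?ps)) {f l} (?w (fst (?ps ! l)) (snd (?ps ! l)))"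
        using f by (auto simp: agg_upto_def)
      let ?p = "?ps ! l"
      let ?u = "?w (fst ?p) (snd ?p)"
      have p: "(fst ?p, snd ?p) \<in> particles" using l order_particles[OF \<omega>, of M] nth_mem by force
      obtain t where t: "?u t = z" "\<forall>s<t. ?u s \<in> send_all ?w (take l ?ps)"
        using l by (auto simp: hits_within_def)
      have "send_all ?w (take l ?ps) \<subseteq> agg_upto M \<omega>"
        unfolding agg_upto_def by (intro send_all_subseq prefix_imp_subseq take_is_prefix)
      note prefix = this
      have in_agg: "?u s \<in> agg \<omega>" if "s \<le> t" for s
      proof -
        have "?u s \<in> agg_upto M \<omega>"
        proof (cases "s = t")
          case True then show ?thesis using t(1) z by simp
        next
          case False then show ?thesis using t(2) prefix that by (meson le_neq_implies_less subsetD)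
        qed
        then show ?thesis unfolding agg_def by (rule UN_I[OF UNIV_I])
      qed
      have avoid: "snd (?u s) \<noteq> c" if "misses_level (agg \<omega>) c" "s \<le> t" for s c
        using misses_levelD[OF that(1) in_agg[OF that(2)]] .
      have side: "fst ?p < c \<longleftrightarrow> snd z < c" if "misses_level (agg \<omega>) c" for c
        using walk_same_side[of ?u t c] walk_step[OF \<omega> p] avoid[OF that] walk_start[OF \<omega> p] t by simp
      have "fst ?p \<noteq> a - 1" using avoid[OF ab(1), of 0] walk_start[OF \<omega> p] by simp
      moreover have "\<not> fst ?p < a - 1" "fst ?p < b + 1"
        using side[OF ab(1)] side[OF ab(2)] z by auto
      ultimately have "l \<in> ?I" using l(1) by auto
      then show "z \<in> f ` ?I" using l(2) by blast
    qed
    then have "card (agg_upto M \<omega> \<inter> UNIV \<times> {a..b}) \<le> card (f ` ?I)"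
      by (intro card_mono) auto
    also have "\<dots> \<le> card ?I" by (intro card_image_le) auto
    also have "\<dots> = card ((!) ?ps ` ?I)"
      using order_distinct[OF \<omega>, of M]
      by (intro card_image[symmetric] inj_onI) (auto simp: nth_eq_iff_index_eq)
    also have "\<dots> \<le> card (Sigma {a..b} (\<lambda>i. {1..N i \<omega>}))"
    proof (rule card_mono)
      show "(!) ?ps ` ?I \<subseteq> Sigma {a..b} (\<lambda>i. {1..N i \<omega>})"
      proof
        fix p assume "p \<in> (!) ?ps ` ?I"
        then have "p \<in> set ?ps" and p: "fst p \<in> {a..b}" by auto
        from this(1) have "p \<in> {(i, j). \<bar>i\<bar> \<le> int M \<and> 1 \<le> j \<and> j \<le> N i \<omega>}"
          unfolding order_set[OF \<omega>] .
        then show "p \<in> Sigma {a..b} (\<lambda>i. {1..N i \<omega>})" using p by (cases p) simp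
      qed
    qed auto
    finally show "card (agg_upto M \<omega> \<inter> UNIV \<times> {a..b}) \<le> card (Sigma {a..b} (\<lambda>i. {1..N i \<omega>}))" .
  qed
  finally show ?thesis .
qed

lemma AE_full: "AE \<omega> in P. \<omega> \<in> \<Omega>"
  using full prob_eq_1[of \<Omega>] by simp

lemma AE_missed_beyond:
  assumes s: "s = 1 \<or> s = (-1 :: int)"
  shows "AE \<omega> in P. \<forall>m. \<exists>i. m \<le> s * i \<and> misses_level (agg \<omega>) i"
proof -
  have "AE \<omega> in P. \<not> (\<omega> \<in> \<Omega> \<and> (\<forall>i. m \<le> s * i \<longrightarrow> \<omega> \<in> visited i))" for m
  proof -
    have "{\<omega> \<in> \<Omega>. \<forall>i. m \<le> s * i \<longrightarrow> \<omega> \<in> visited i} \<in> null_sets P"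
      using all_visited_prob[OF s, of m] all_visited_event[of m s]
      by (simp add: null_sets_def emeasure_eq_measure)
    from AE_not_in[OF this] show ?thesis by simp
  qed
  then have "AE \<omega> in P. \<forall>m. \<not> (\<omega> \<in> \<Omega> \<and> (\<forall>i. m \<le> s * i \<longrightarrow> \<omega> \<in> visited i))"
    unfolding AE_all_countable by blast
  then show ?thesis
    using AE_full by eventually_elim (auto simp: visited_def)
qed

theorem AE_infinitely_many_missed:
  "AE \<omega> in P. \<forall>M::int. infinite {i. i \<ge> M \<and> misses_level (agg \<omega>) i}
                    \<and> infinite {j. j \<le> - M \<and> misses_level (agg \<omega>) j}"
  using AE_missed_beyond[of 1, simplified] AE_missed_beyond[of "-1", simplified]
proof eventually_elim
  case (elim \<omega>)
  show ?case
  proof (intro allI conjI notI)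
    fix M :: int
    assume fin: "finite {i. i \<ge> M \<and> misses_level (agg \<omega>) i}"
    \<comment> \<open>A missed level beyond both \<open>M\<close> and the supposed maximum belongs
      to the set, against maximality.\<close>
    obtain i where i: "max M (Max {i. i \<ge> M \<and> misses_level (agg \<omega>) i} + 1) \<le> i" "misses_level (agg \<omega>) i"
      using elim(1)[rule_format, of "max M (Max {i. i \<ge> M \<and> misses_level (agg \<omega>) i} + 1)"] by blast
    then have "i \<le> Max {i. i \<ge> M \<and> misses_level (agg \<omega>) i}" using fin by (intro Max_ge) auto
    then show False using i by simp
  next
    fix M :: int
    assume fin: "finite {j. j \<le> - M \<and> misses_level (agg \<omega>) j}"
    obtain j where j: "max M (1 - Min {j. j \<le> - M \<and> misses_level (agg \<omega>) j}) \<le> - j" "misses_level (agg \<omega>) j"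
      using elim(2)[rule_format, of "max M (1 - Min {j. j \<le> - M \<and> misses_level (agg \<omega>) j})"] by blast
    then have "Min {j. j \<le> - M \<and> misses_level (agg \<omega>) j} \<le> j" using fin by (intro Min_le) auto
    then show False using j by simp
  qed
qed

theorem AE_components:
  "AE \<omega> in P. (\<forall>C \<in> lattice_components (agg \<omega>). finite C) \<and> components_in_disjoint_strips (agg \<omega>)"
  using AE_missed_beyond[of 1, simplified] AE_missed_beyond[of "-1", simplified] AE_full
proof eventually_elim
  case (elim \<omega>)
  have "\<exists>z\<le>m. misses_level (agg \<omega>) z" for m
    using elim(2)[rule_format, of "- m"] by auto
  then show ?case
    using components_between_missed_levels[of "agg \<omega>", OF elim(1)[rule_format] _ finite_agg_between_missed_levels[OF elim(3)]]
    by blast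
qed

end

section \<open>The usual order and the Poisson clocks\<close>

lemma (in prob_space) prob_Int_full:
  assumes "\<Omega> \<in> events" "prob \<Omega> = 1" "X \<in> events"
  shows "prob (\<Omega> \<inter> X) = prob X"
proof (rule finite_measure_eq_AE)
  have "AE \<omega> in M. \<omega> \<in> \<Omega>" using assms prob_eq_1[of \<Omega>] by simp
  then show "AE x in M. x \<in> \<Omega> \<inter> X \<longleftrightarrow> x \<in> X" by eventually_elim simp
qed (use assms in auto)

text \<open>The event that the order equals \<open>ps\<close> need not itself be generated by the
  sources, since the order may be arbitrary on a null set. It is replaced by a generated event
  \<open>E M ps\<close> that agrees with it almost surely, and all almost sure properties are
  collected in one event of probability one.\<close>

lemma emissionI:
  assumes src: "poisson_sources P N n" and walks: "independent_walks P S"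
    and indep: "prob_space.indep_set P (walk_events P S) \<V>"
    and E: "\<And>M ps. E M ps \<in> \<V>"
    and order: "AE \<omega> in P. \<forall>M. (\<forall>ps. \<omega> \<in> E M ps \<longleftrightarrow> L M \<omega> = ps) \<and> distinct (L M \<omega>) \<and>
        set (L M \<omega>) = {(i, j). \<bar>i\<bar> \<le> int M \<and> 1 \<le> j \<and> j \<le> N i \<omega>} \<and> subseq (L M \<omega>) (L (Suc M) \<omega>)"
  shows "\<exists>\<Omega>. emission P N n S L \<Omega>"
proof -
  interpret poisson_sources P N n by fact
  define W0 where "W0 \<omega> \<longleftrightarrow> (\<forall>p\<in>particles. S (fst p) (snd p) \<omega> 0 = (0, fst p) \<and>
     (\<forall>t. S (fst p) (snd p) \<omega> (Suc t) - S (fst p) (snd p) \<omega> t \<in> steps))" for \<omega>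
  define Q where "Q \<omega> \<longleftrightarrow> (\<forall>M. (\<forall>ps. \<omega> \<in> E M ps \<longleftrightarrow> L M \<omega> = ps) \<and> distinct (L M \<omega>) \<and>
        set (L M \<omega>) = {(i, j). \<bar>i\<bar> \<le> int M \<and> 1 \<le> j \<and> j \<le> N i \<omega>} \<and> subseq (L M \<omega>) (L (Suc M) \<omega>))" for \<omega>
  have "AE \<omega> in P. \<forall>p\<in>particles. S (fst p) (snd p) \<omega> 0 = (0, fst p) \<and>
     (\<forall>t. S (fst p) (snd p) \<omega> (Suc t) - S (fst p) (snd p) \<omega> t \<in> steps)"
  proof (rule AE_ball_countable')
    fix p assume "p \<in> particles"
    then have srw: "simple_random_walk P (0, fst p) (S (fst p) (snd p))"
      using walks by (auto simp: independent_walks_def case_prod_beta)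
    then have "AE \<omega> in P. S (fst p) (snd p) \<omega> 0 = (0, fst p)"
      by (simp add: simple_random_walk_def)
    then show "AE \<omega> in P. S (fst p) (snd p) \<omega> 0 = (0, fst p) \<and>
       (\<forall>t. S (fst p) (snd p) \<omega> (Suc t) - S (fst p) (snd p) \<omega> t \<in> steps)"
      using simple_random_walk_steps[OF prob_space_axioms srw] by eventually_elim blast
  qed simp
  then have "AE \<omega> in P. W0 \<omega> \<and> Q \<omega>"
    using order unfolding W0_def Q_def by eventually_elim (rule conjI)
  from AE_E_prob[OF this] obtain \<Omega> where \<Omega>: "\<Omega> \<in> events" "prob \<Omega> = 1"
    and sub: "\<Omega> \<subseteq> {\<omega> \<in> space P. W0 \<omega> \<and> Q \<omega>}"
    by metis
  have W0: "W0 \<omega>" and Q: "Q \<omega>" if "\<omega> \<in> \<Omega>" for \<omega> using that sub by auto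
  have good: "\<omega> \<in> E M ps \<longleftrightarrow> L M \<omega> = ps" "distinct (L M \<omega>)"
    "set (L M \<omega>) = {(i, j). \<bar>i\<bar> \<le> int M \<and> 1 \<le> j \<and> j \<le> N i \<omega>}" "subseq (L M \<omega>) (L (Suc M) \<omega>)"
    if "\<omega> \<in> \<Omega>" for \<omega> M ps
    using Q[OF that] unfolding Q_def by blast+
  have E_ev: "E M ps \<in> events" for M ps
    using E indep_setD_ev2[OF indep] by blast
  have eq: "{\<omega> \<in> \<Omega>. L M \<omega> = ps} = \<Omega> \<inter> E M ps" for M ps
    using good(1) by blast
  have "emission P N n S L \<Omega>"
  proof
    show "{\<omega> \<in> \<Omega>. L M \<omega> = ps} \<in> events" for M ps
      unfolding eq using \<Omega> E_ev by blast
    show "prob ({\<omega> \<in> \<Omega>. L M \<omega> = ps} \<inter> W) = prob {\<omega> \<in> \<Omega>. L M \<omega> = ps} * prob W"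
      if W: "W \<in> walk_events P S" for M ps W
    proof -
      have We: "W \<in> events" using W indep_setD_ev1[OF indep] by blast
      have "prob ((\<Omega> \<inter> E M ps) \<inter> W) = prob (\<Omega> \<inter> (W \<inter> E M ps))"
        by (simp only: Int_assoc Int_commute[of W])
      also have "\<dots> = prob W * prob (E M ps)"
        using prob_Int_full[OF \<Omega>, of "W \<inter> E M ps"] We E_ev indep_setD[OF indep W E] by simp
      also have "prob (E M ps) = prob (\<Omega> \<inter> E M ps)"
        using prob_Int_full[OF \<Omega> E_ev] by simp
      finally show ?thesis unfolding eq by (simp only: mult.commute)
    qed
    show "S i j \<omega> 0 = (0, i)" if "\<omega> \<in> \<Omega>" "(i, j) \<in> particles" for i j \<omega>
      using W0[OF that(1)] that(2) unfolding W0_def by force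
    show "S i j \<omega> (Suc t) - S i j \<omega> t \<in> steps" if "\<omega> \<in> \<Omega>" "(i, j) \<in> particles" for i j t \<omega>
      using W0[OF that(1)] that(2) unfolding W0_def by force
  qed (fact walks \<Omega> | erule good)+
  then show ?thesis by blast
qed

lemma indep_of_walks_events:
  assumes "indep_of_walks P S M X"
  shows "prob_space.indep_set P (walk_events P S)
           (sets (vimage_algebra (space P) (\<lambda>\<omega> i. X i \<omega>) (PiM UNIV (\<lambda>_. M))))"
  using assms by (simp add: indep_of_walks_def indep_rvs_def walk_events_def)

section \<open>The usual order\<close>

lemma usual_levels_Suc: "usual_levels (Suc M) = usual_levels M @ [int (Suc M), - int (Suc M)]"
  by (simp add: usual_levels_def)

lemma set_usual_levels: "set (usual_levels M) = {i. \<bar>i\<bar> \<le> int M}"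
proof (induction M)
  case 0 then show ?case by (simp add: usual_levels_def)
next
  case (Suc M)
  have "i \<in> set (usual_levels (Suc M)) \<longleftrightarrow> \<bar>i\<bar> \<le> int (Suc M)" for i
    unfolding usual_levels_Suc by (cases "0 \<le> i") (auto simp: Suc)
  then show ?case by blast
qed

lemma distinct_usual_levels: "distinct (usual_levels M)"
proof (induction M)
  case 0 then show ?case by (simp add: usual_levels_def)
next
  case (Suc M)
  then show ?case by (auto simp: usual_levels_Suc set_usual_levels)
qed

definition star_order :: "(int \<Rightarrow> nat) \<Rightarrow> int list \<Rightarrow> (int \<times> nat) list" where
  "star_order \<nu> ls = concat (map (\<lambda>i. map (\<lambda>j. (i, j)) [1..<Suc (\<nu> i)]) ls)"

lemma star_order_Cons:
  "star_order \<nu> (i # ls) = map (\<lambda>j. (i, j)) [1..<Suc (\<nu> i)] @ star_order \<nu> ls"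
  by (simp only: star_order_def list.map concat.simps)

lemma set_star_order: "set (star_order \<nu> ls) = {(i, j). i \<in> set ls \<and> 1 \<le> j \<and> j \<le> \<nu> i}"
  unfolding star_order_def by (auto simp del: upt_Suc)

lemma distinct_star_order: "distinct ls \<Longrightarrow> distinct (star_order \<nu> ls)"
proof (induction ls)
  case (Cons i ls)
  have "distinct (map (\<lambda>j. (i, j)) [1..<Suc (\<nu> i)])"
    unfolding distinct_map by (simp add: inj_on_def)
  moreover have "set (map (\<lambda>j. (i, j)) [1..<Suc (\<nu> i)]) \<inter> set (star_order \<nu> ls) = {}"
    using Cons.prems unfolding set_star_order by auto
  ultimately show ?case
    using Cons unfolding star_order_Cons distinct_append by simp
qed (simp add: star_order_def)

lemma star_order_measurable:
  "(\<lambda>\<nu>. star_order \<nu> ls) \<in> PiM UNIV (\<lambda>_. count_space UNIV) \<rightarrow>\<^sub>M count_space UNIV"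
proof (induction ls)
  case Nil then show ?case by (simp add: star_order_def)
next
  case (Cons i ls)
  have "(\<lambda>\<nu>. map (\<lambda>j. (i, j)) [1..<Suc (\<nu> i)] @ star_order \<nu> ls)
      \<in> PiM UNIV (\<lambda>_. count_space UNIV) \<rightarrow>\<^sub>M count_space UNIV"
  proof (rule measurable_compose_countable[where f = "\<lambda>k \<nu>. map (\<lambda>j. (i, j)) [1..<Suc k] @ star_order \<nu> ls"
        and g = "\<lambda>\<nu>. \<nu> i"])
    show "(\<lambda>\<nu>. map (\<lambda>j. (i, j)) [1..<Suc k] @ star_order \<nu> ls)
        \<in> PiM UNIV (\<lambda>_. count_space UNIV) \<rightarrow>\<^sub>M count_space UNIV" for k
      using measurable_compose[OF Cons, of "\<lambda>qs. map (\<lambda>j. (i, j)) [1..<Suc k] @ qs" "count_space UNIV"]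
      by (simp only: measurable_count_space)
    show "(\<lambda>\<nu>. \<nu> i) \<in> PiM UNIV (\<lambda>_. count_space UNIV) \<rightarrow>\<^sub>M count_space UNIV"
      by (rule measurable_component_singleton) simp
  qed
  then show ?case by (simp only: star_order_Cons)
qed

lemma star_emission:
  assumes P: "prob_space P" and S: "independent_walks P S" and n: "1 \<le> n"
    and N: "poisson_levels P S (real n) N"
  shows "\<exists>\<Omega>. emission P N n S (\<lambda>M \<omega>. star_order (\<lambda>i. N i \<omega>) (usual_levels M)) \<Omega>"
proof -
  interpret prob_space P by fact
  let ?\<V> = "sets (vimage_algebra (space P) (\<lambda>\<omega> i. N i \<omega>) (PiM UNIV (\<lambda>_. count_space UNIV)))"
  let ?E = "\<lambda>M ps. (\<lambda>\<omega> i. N i \<omega>) -` {\<nu> \<in> space (PiM UNIV (\<lambda>_. count_space UNIV)). star_order \<nu> (usual_levels M) = ps} \<inter> space P"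
  have src: "poisson_sources P N n"
    using N n by unfold_locales (auto simp: poisson_levels_def)
  have indep: "indep_set (walk_events P S) ?\<V>"
    using N by (intro indep_of_walks_events) (simp add: poisson_levels_def)
  show ?thesis
  proof (rule emissionI[OF src S indep, of ?E])
    fix M ps
    show "?E M ps \<in> ?\<V>"
    proof (rule in_vimage_algebra)
      have "(\<lambda>\<nu>. star_order \<nu> (usual_levels M)) -` {ps} \<inter> space (PiM UNIV (\<lambda>_. count_space UNIV))
          \<in> sets (PiM UNIV (\<lambda>_. count_space UNIV))"
        by (rule measurable_sets[OF star_order_measurable]) simp
      also have "(\<lambda>\<nu>. star_order \<nu> (usual_levels M)) -` {ps} \<inter> space (PiM UNIV (\<lambda>_. count_space UNIV))
          = {\<nu> \<in> space (PiM UNIV (\<lambda>_. count_space UNIV)). star_order \<nu> (usual_levels M) = ps}"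
        by blast
      finally show "{\<nu> \<in> space (PiM UNIV (\<lambda>_. count_space UNIV)). star_order \<nu> (usual_levels M) = ps}
          \<in> sets (PiM UNIV (\<lambda>_. count_space UNIV))" .
    qed
  next
    show "AE \<omega> in P. \<forall>M. (\<forall>ps. \<omega> \<in> ?E M ps \<longleftrightarrow> star_order (\<lambda>i. N i \<omega>) (usual_levels M) = ps) \<and>
        distinct (star_order (\<lambda>i. N i \<omega>) (usual_levels M)) \<and>
        set (star_order (\<lambda>i. N i \<omega>) (usual_levels M)) = {(i, j). \<bar>i\<bar> \<le> int M \<and> 1 \<le> j \<and> j \<le> N i \<omega>} \<and>
        subseq (star_order (\<lambda>i. N i \<omega>) (usual_levels M)) (star_order (\<lambda>i. N i \<omega>) (usual_levels (Suc M)))"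
    proof (rule AE_I2, intro allI conjI)
      fix \<omega> M
      assume \<omega>: "\<omega> \<in> space P"
      show "\<omega> \<in> ?E M ps \<longleftrightarrow> star_order (\<lambda>i. N i \<omega>) (usual_levels M) = ps" for ps
      proof -
        have "(\<lambda>i. N i \<omega>) \<in> space (PiM UNIV (\<lambda>_. count_space UNIV))" by (simp add: space_PiM)
        then show ?thesis using \<omega> by blast
      qed
      show "distinct (star_order (\<lambda>i. N i \<omega>) (usual_levels M))"
        by (intro distinct_star_order distinct_usual_levels)
      show "set (star_order (\<lambda>i. N i \<omega>) (usual_levels M)) = {(i, j). \<bar>i\<bar> \<le> int M \<and> 1 \<le> j \<and> j \<le> N i \<omega>}"
        unfolding set_star_order set_usual_levels mem_Collect_eq ..
      \<comment> \<open>In the usual order, raising \<open>M\<close> appends the two new levels at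
        the end, so the old list is even a prefix.\<close>
      have "star_order (\<lambda>i. N i \<omega>) (usual_levels (Suc M)) = star_order (\<lambda>i. N i \<omega>) (usual_levels M)
          @ star_order (\<lambda>i. N i \<omega>) [int (Suc M), - int (Suc M)]"
        unfolding star_order_def usual_levels_Suc map_append concat_append ..
      then show "subseq (star_order (\<lambda>i. N i \<omega>) (usual_levels M)) (star_order (\<lambda>i. N i \<omega>) (usual_levels (Suc M)))"
        by (simp only: prefix_imp_subseq prefix_def) blast
    qed
  qed
qed

section \<open>Points of a Poisson process\<close>

lemma space_configurations: "space configurations = {\<xi>. \<xi> \<subseteq> {0..} \<and> (\<forall>t. finite (\<xi> \<inter> {..t}))}"
  unfolding configurations_def by (rule space_measure_of) auto

lemma card_configuration_measurable:
  assumes "B \<in> bounded_borel"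
  shows "(\<lambda>\<xi>. card (\<xi> \<inter> B)) \<in> configurations \<rightarrow>\<^sub>M count_space UNIV"
proof -
  have "(\<lambda>\<xi>. card (\<xi> \<inter> B)) -` {k} \<inter> space configurations \<in> sets configurations" for k
  proof -
    have "(\<lambda>\<xi>. card (\<xi> \<inter> B)) -` {k} \<inter> space configurations
        = {\<xi>. \<xi> \<subseteq> {0..} \<and> (\<forall>t. finite (\<xi> \<inter> {..t})) \<and> card (\<xi> \<inter> B) = k}"
      unfolding space_configurations by blast
    also have "\<dots> \<in> sets configurations"
      unfolding configurations_def by (rule in_measure_of) (use assms in blast)+
    finally show ?thesis .
  qed
  then show ?thesis by (simp add: measurable_count_space_eq2_countable)
qed

lemma Icc_bounded_borel: "0 \<le> a \<Longrightarrow> {a..b} \<in> bounded_borel"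
  by (auto simp: bounded_borel_def)

text \<open>Such a set is an increasing sequence, so \<open>nth_point\<close> is meaningful for
  every \<open>j \<ge> 1\<close>.\<close>

locale infinite_configuration =
  fixes \<xi> :: "real set"
  assumes conf: "\<xi> \<in> space configurations" and infinite: "infinite \<xi>"
begin

lemma finite_below: "finite (\<xi> \<inter> {..t})"
  using conf by (simp add: space_configurations)

lemma Int_atMost: "\<xi> \<inter> {..t} = \<xi> \<inter> {0..t}"
  using conf by (auto simp: space_configurations)

lemma card_less: "x < y \<Longrightarrow> y \<in> \<xi> \<Longrightarrow> card (\<xi> \<inter> {..x}) < card (\<xi> \<inter> {..y})"
  by (rule psubset_card_mono[OF finite_below]) force

text \<open>The counting function increases by one at each point, so the first point at which it
  reaches \<open>j\<close> has count exactly \<open>j\<close>; local finiteness provides this first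
  point.\<close>

lemma nth_point_ex1:
  assumes "1 \<le> j"
  shows "\<exists>!x. x \<in> \<xi> \<and> card (\<xi> \<inter> {..x}) = j"
proof -
  obtain F where F: "F \<subseteq> \<xi>" "finite F" "card F = j"
    using infinite_arbitrarily_large[OF infinite] by blast
  define G where "G = {x \<in> \<xi> \<inter> {..Max F}. j \<le> card (\<xi> \<inter> {..x})}"
  have F_ne: "F \<noteq> {}" using F assms by auto
  have "F \<subseteq> \<xi> \<inter> {..Max F}" using F by auto
  then have "j \<le> card (\<xi> \<inter> {..Max F})" using F card_mono[OF finite_below] by metis
  then have "Max F \<in> G" using F F_ne Max_in[of F] unfolding G_def by blast
  moreover have fin: "finite G" unfolding G_def by (rule finite_subset[OF _ finite_below[of "Max F"]]) auto
  ultimately have x: "Min G \<in> G" by (intro Min_in) auto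
  let ?x = "Min G"
  have "card (\<xi> \<inter> {..?x}) = j"
  proof (rule ccontr)
    assume "card (\<xi> \<inter> {..?x}) \<noteq> j"
    then have gt: "j < card (\<xi> \<inter> {..?x})" using x by (auto simp: G_def)
    let ?H = "\<xi> \<inter> {..<?x}"
    have "\<xi> \<inter> {..?x} \<subseteq> insert ?x ?H" by auto
    moreover have finH: "finite ?H" by (rule finite_subset[OF _ finite_below[of ?x]]) auto
    ultimately have "card (\<xi> \<inter> {..?x}) \<le> card (insert ?x ?H)" by (intro card_mono) auto
    also have "\<dots> \<le> Suc (card ?H)" by (rule card_insert_le_m1) auto
    \<comment> \<open>If the count at the first such point exceeded \<open>j\<close>, at least
      \<open>j\<close> points would lie strictly below it, and the largest of these would already
      belong to \<open>G\<close>.\<close>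
    finally have H: "j \<le> card ?H" using gt by simp
    then have "?H \<noteq> {}" using assms by auto
    then have y: "Max ?H \<in> ?H" using finH by (intro Max_in)
    have "?H \<subseteq> \<xi> \<inter> {..Max ?H}" using finH by auto
    then have "card ?H \<le> card (\<xi> \<inter> {..Max ?H})" by (rule card_mono[OF finite_below])
    then have "Max ?H \<in> G" using y x H unfolding G_def by auto
    then have "?x \<le> Max ?H" using fin by (intro Min_le)
    then show False using y by auto
  qed
  moreover have "?x \<in> \<xi>" using x by (auto simp: G_def)
  moreover have "x = y" if "x \<in> \<xi> \<and> card (\<xi> \<inter> {..x}) = j" "y \<in> \<xi> \<and> card (\<xi> \<inter> {..y}) = j" for x y
    using that card_less[of x y] card_less[of y x] by (cases x y rule: linorder_cases) auto
  ultimately show ?thesis by blast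
qed

lemma nth_point_in: "1 \<le> j \<Longrightarrow> nth_point \<xi> j \<in> \<xi>"
  and card_nth_point: "1 \<le> j \<Longrightarrow> card (\<xi> \<inter> {..nth_point \<xi> j}) = j"
  using theI'[OF nth_point_ex1, of j] unfolding nth_point_def by auto

text \<open>Translates times into counts on bounded Borel sets, by which the sigma-algebra of
  \<open>configurations\<close> is generated.\<close>

lemma nth_point_le_iff:
  assumes j: "1 \<le> j"
  shows "nth_point \<xi> j \<le> t \<longleftrightarrow> j \<le> card (\<xi> \<inter> {0..t})"
proof
  assume "nth_point \<xi> j \<le> t"
  then have "card (\<xi> \<inter> {..nth_point \<xi> j}) \<le> card (\<xi> \<inter> {..t})"
    by (intro card_mono finite_below) auto
  then show "j \<le> card (\<xi> \<inter> {0..t})"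
    unfolding card_nth_point[OF j] by (simp only: Int_atMost)
next
  assume "j \<le> card (\<xi> \<inter> {0..t})"
  then show "nth_point \<xi> j \<le> t"
    using card_less[of t "nth_point \<xi> j"] nth_point_in[OF j] card_nth_point[OF j] Int_atMost[of t]
    by (cases "nth_point \<xi> j \<le> t") auto
qed

end

lemma poisson_process_card:
  assumes "poisson_process P \<Xi>" "0 \<le> a" "a \<le> b"
  shows "measure P {\<omega> \<in> space P. card (\<Xi> \<omega> \<inter> {a..b}) = k} = (b - a) ^ k / fact k * exp (- (b - a))"
    and "(\<lambda>\<omega>. card (\<Xi> \<omega> \<inter> {a..b})) \<in> P \<rightarrow>\<^sub>M count_space UNIV"
  using assms Icc_bounded_borel[of a b] by (auto simp: poisson_process_def poisson_distributed_def)

text \<open>If there are at most \<open>k\<close> points altogether, then there are at most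
  \<open>k\<close> up to each time \<open>m\<close>. This has probability at most a polynomial in
  \<open>m\<close> times \<open>exp (- real m)\<close>, which tends to 0.\<close>

lemma poisson_process_infinite:
  assumes P: "prob_space P" and \<Xi>: "poisson_process P \<Xi>"
  shows "AE \<omega> in P. infinite (\<Xi> \<omega>)"
proof -
  interpret prob_space P by fact
  note m[measurable] = poisson_process_card(2)[OF \<Xi>]
  let ?c = "\<lambda>m \<omega>. card (\<Xi> \<omega> \<inter> {0..real m})"
  have cm[measurable]: "?c m \<in> P \<rightarrow>\<^sub>M count_space UNIV" for m by (rule m) auto
  have "AE \<omega> in P. \<not> (\<forall>m. ?c m \<omega> \<le> k)" for k
  proof -
    let ?F = "{\<omega> \<in> space P. \<forall>m. ?c m \<omega> \<le> k}"
    have le: "prob ?F \<le> (\<Sum>l\<le>k. real m ^ l / exp (real m))" for m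
    proof -
      have "prob ?F \<le> prob (\<Union>l\<in>{..k}. {\<omega> \<in> space P. ?c m \<omega> = l})"
        by (rule finite_measure_mono) auto
      also have "\<dots> \<le> (\<Sum>l\<le>k. prob {\<omega> \<in> space P. ?c m \<omega> = l})"
        by (rule finite_measure_subadditive_finite) auto
      also have "\<dots> \<le> (\<Sum>l\<le>k. real m ^ l / exp (real m))"
      proof (rule sum_mono)
        fix l
        have "real m ^ l / fact l * exp (- real m) \<le> real m ^ l / 1 * exp (- real m)"
          by (intro mult_right_mono divide_left_mono) auto
        then show "prob {\<omega> \<in> space P. ?c m \<omega> = l} \<le> real m ^ l / exp (real m)"
          using poisson_process_card(1)[OF \<Xi>, of 0 "real m" l] by (simp add: exp_minus divide_inverse)
      qed
      finally show ?thesis .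
    qed
    have "(\<lambda>m. \<Sum>l\<le>k. real m ^ l / exp (real m)) \<longlonglongrightarrow> (\<Sum>l\<le>k. 0)"
      by (intro tendsto_sum filterlim_compose[OF tendsto_power_div_exp_0 filterlim_real_sequentially])
    then have "prob ?F \<le> (\<Sum>l\<le>k. 0)"
      by (rule LIMSEQ_le_const) (use le in blast)
    then have "?F \<in> null_sets P"
      by (auto simp: null_sets_def emeasure_eq_measure measure_le_0_iff)
    from AE_not_in[OF this] AE_space show ?thesis by eventually_elim auto
  qed
  then have "AE \<omega> in P. \<forall>k. \<not> (\<forall>m. ?c m \<omega> \<le> k)" unfolding AE_all_countable by blast
  then show ?thesis
  proof eventually_elim
    case (elim \<omega>)
    show ?case
    proof
      assume "finite (\<Xi> \<omega>)"
      then have "?c m \<omega> \<le> card (\<Xi> \<omega>)" for m by (intro card_mono) auto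
      then show False using elim by blast
    qed
  qed
qed

text \<open>Cut \<open>{0..real n}\<close> into \<open>Suc m\<close> intervals of equal length. A
  common point makes both processes charge the same interval, which by independence has probability
  at most \<open>real n * real n / real (Suc m)\<close> in total. The intervals are closed and share
  endpoints, which is harmless for an upper bound.\<close>

lemma AE_disjoint_poisson_processes:
  assumes P: "prob_space P" and \<Xi>: "\<And>i. poisson_process P (\<Xi> i)"
    and ind: "prob_space.indep_vars P (\<lambda>_. configurations) \<Xi> UNIV" and ik: "i \<noteq> k"
  shows "AE \<omega> in P. \<Xi> i \<omega> \<inter> \<Xi> k \<omega> \<inter> {0..real n} = {}"
proof -
  interpret prob_space P by fact
  define I where "I m l = {real n * real l / real (Suc m)..real n * real (Suc l) / real (Suc m)}" for m l
  have len: "0 \<le> real n * real l / real (Suc m)"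
    "real n * real l / real (Suc m) \<le> real n * real (Suc l) / real (Suc m)"
    "real n * real (Suc l) / real (Suc m) - real n * real l / real (Suc m) = real n / real (Suc m)" for m l
  proof -
    have "real n * real (Suc l) / real (Suc m) - real n * real l / real (Suc m)
        = real n * (real (Suc l) - real l) / real (Suc m)"
      by (simp only: diff_divide_distrib[symmetric] right_diff_distrib)
    then show "real n * real (Suc l) / real (Suc m) - real n * real l / real (Suc m) = real n / real (Suc m)"
      by simp
  qed (auto intro!: divide_right_mono mult_left_mono)
  have Ib: "I m l \<in> bounded_borel" for m l unfolding I_def by (rule Icc_bounded_borel) (rule len)
  have cm[measurable]: "(\<lambda>\<omega>. card (\<Xi> a \<omega> \<inter> I m l)) \<in> P \<rightarrow>\<^sub>M count_space UNIV" for a m l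
    unfolding I_def by (rule poisson_process_card(2)[OF \<Xi>]) (rule len)+
  define D where "D m = {\<omega> \<in> space P. \<exists>l\<le>m. card (\<Xi> i \<omega> \<inter> I m l) \<noteq> 0 \<and> card (\<Xi> k \<omega> \<inter> I m l) \<noteq> 0}" for m
  have D[measurable]: "D m \<in> events" for m unfolding D_def by measurable
  have pt: "prob {\<omega> \<in> space P. card (\<Xi> a \<omega> \<inter> I m l) \<noteq> 0} \<le> real n / real (Suc m)" for a m l
  proof -
    have "prob {\<omega> \<in> space P. card (\<Xi> a \<omega> \<inter> I m l) = 0} = exp (- (real n / real (Suc m)))"
      unfolding I_def using poisson_process_card(1)[OF \<Xi> len(1,2), of a l m 0] len(3)[of l m] by simp
    moreover have "prob {\<omega> \<in> space P. card (\<Xi> a \<omega> \<inter> I m l) \<noteq> 0}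
        = 1 - prob {\<omega> \<in> space P. card (\<Xi> a \<omega> \<inter> I m l) = 0}"
      by (rule prob_neg) measurable
    ultimately show ?thesis using exp_ge_add_one_self[of "- (real n / real (Suc m))"] by linarith
  qed
  have pair: "prob {\<omega> \<in> space P. card (\<Xi> i \<omega> \<inter> I m l) \<noteq> 0 \<and> card (\<Xi> k \<omega> \<inter> I m l) \<noteq> 0}
      \<le> (real n / real (Suc m)) * (real n / real (Suc m))" for m l
  proof -
    let ?X = "\<lambda>a \<omega>. card (\<Xi> a \<omega> \<inter> I m l)"
    have iv: "indep_vars (\<lambda>_. count_space UNIV) ?X UNIV"
      by (rule indep_vars_compose2[OF ind]) (rule card_configuration_measurable[OF Ib])
    have "prob (\<Inter>a\<in>{i, k}. ?X a -` {0<..} \<inter> space P) = (\<Prod>a\<in>{i, k}. prob (?X a -` {0<..} \<inter> space P))"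
      by (rule indep_varsD[OF iv]) auto
    also have "\<dots> = prob (?X i -` {0<..} \<inter> space P) * prob (?X k -` {0<..} \<inter> space P)"
      using ik by simp
    also have "\<dots> \<le> (real n / real (Suc m)) * (real n / real (Suc m))"
    proof -
      have "?X a -` {0<..} \<inter> space P = {\<omega> \<in> space P. ?X a \<omega> \<noteq> 0}" for a by auto
      then show ?thesis using pt[of i m l] pt[of k m l] by (simp only:) (intro mult_mono, auto)
    qed
    also have "(\<Inter>a\<in>{i, k}. ?X a -` {0<..} \<inter> space P) = {\<omega> \<in> space P. ?X i \<omega> \<noteq> 0 \<and> ?X k \<omega> \<noteq> 0}"
      by auto
    finally show ?thesis .
  qed
  have D_le: "prob (D m) \<le> real n * real n / real (Suc m)" for m
  proof -
    let ?e = "\<lambda>l. {\<omega> \<in> space P. card (\<Xi> i \<omega> \<inter> I m l) \<noteq> 0 \<and> card (\<Xi> k \<omega> \<inter> I m l) \<noteq> 0}"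
    have "D m = (\<Union>l\<in>{..m}. ?e l)" unfolding D_def by blast
    then have "prob (D m) \<le> (\<Sum>l\<le>m. prob (?e l))"
      by (simp only:) (rule finite_measure_subadditive_finite, auto)
    also have "\<dots> \<le> (\<Sum>l\<le>m. (real n / real (Suc m)) * (real n / real (Suc m)))"
      by (rule sum_mono) (rule pair)
    also have "\<dots> = real (Suc m) * ((real n / real (Suc m)) * (real n / real (Suc m)))"
      by simp
    also have "\<dots> = real n * real n / real (Suc m)" by (simp add: divide_simps del: of_nat_Suc)
    finally show ?thesis .
  qed
  have "(\<Inter>m. D m) \<in> null_sets P"
  proof -
    have "prob (\<Inter>m. D m) \<le> real n * real n / real (Suc m)" for m
    proof -
      have "prob (\<Inter>m. D m) \<le> prob (D m)" by (rule finite_measure_mono) auto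
      then show ?thesis using D_le[of m] by linarith
    qed
    moreover have "(\<lambda>m. real n * real n / real (Suc m)) \<longlonglongrightarrow> 0"
      by (rule LIMSEQ_Suc[OF lim_const_over_n])
    ultimately have "prob (\<Inter>m. D m) \<le> 0" by (intro LIMSEQ_le_const) auto
    then show ?thesis by (auto simp: null_sets_def emeasure_eq_measure measure_le_0_iff)
  qed
  from AE_not_in[OF this] AE_space show ?thesis
  proof eventually_elim
    case (elim \<omega>)
    show ?case
    proof (rule equals0I)
      fix x assume x: "x \<in> \<Xi> i \<omega> \<inter> \<Xi> k \<omega> \<inter> {0..real n}"
      have conf: "finite (\<Xi> a \<omega> \<inter> {..t})" for a t
      proof -
        have "\<Xi> a \<in> P \<rightarrow>\<^sub>M configurations" using \<Xi> by (simp add: poisson_process_def)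
        then have "\<Xi> a \<omega> \<in> space configurations" using elim(2) by (rule measurable_space)
        then show ?thesis by (simp add: space_configurations)
      qed
      have "\<omega> \<in> D m" for m
      proof -
        \<comment> \<open>The endpoint \<open>real n\<close> is assigned to the last interval by
          hand: for positive \<open>n\<close> the floor used for the other points would give the
          index \<open>Suc m\<close>.\<close>
        have "\<exists>l\<le>m. x \<in> I m l"
        proof (cases "x = real n")
          case True
          then show ?thesis
            by (intro exI[of _ m]) (auto simp: I_def field_simps mult_left_mono)
        next
          case False
          then have x': "0 \<le> x" "x < real n" using x by auto
          then have n: "0 < real n" by linarith
          define l where "l = nat \<lfloor>x * real (Suc m) / real n\<rfloor>"
          have q: "0 \<le> x * real (Suc m) / real n" using x' by simp
          have l: "real l \<le> x * real (Suc m) / real n" "x * real (Suc m) / real n < real l + 1"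
            using q unfolding l_def by linarith+
          have "x * real (Suc m) / real n < real (Suc m)"
            using x' n by (simp add: field_simps del: of_nat_Suc)
          then have "real l < real (Suc m)" using l by linarith
          then have "l \<le> m" by simp
          moreover have "x \<in> I m l"
            using l n unfolding I_def by (auto simp: field_simps)
          ultimately show ?thesis by blast
        qed
        then obtain l where l: "l \<le> m" "x \<in> I m l" by blast
        have "card (\<Xi> a \<omega> \<inter> I m l) \<noteq> 0" if "x \<in> \<Xi> a \<omega>" for a
        proof -
          have "finite (\<Xi> a \<omega> \<inter> I m l)"
            by (rule finite_subset[OF _ conf[of a "real n * real (Suc l) / real (Suc m)"]]) (auto simp: I_def)
          then show ?thesis using that l by (auto simp: card_eq_0_iff)
        qed
        then show ?thesis using x l elim(2) unfolding D_def by blast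
      qed
      then show False using elim(1) by blast
    qed
  qed
qed

section \<open>The order given by the clocks\<close>

lemma (in linorder) distinct_if_sorted_wrt_less:
  assumes "sorted_wrt (\<lambda>x y. f x < f y) xs"
  shows "distinct xs"
  using assms by (induction xs) auto

text \<open>Injectivity makes the sorted keys strictly increasing, and such a list is distinct and
  determined by its set. An equality of lists thus becomes a condition on pairs of entries and on
  the set of entries.\<close>

lemma (in linorder) sorted_key_list_of_set_eq_iff:
  assumes "inj_on f A" "finite A"
  shows "sorted_key_list_of_set f A = xs \<longleftrightarrow> sorted_wrt (\<lambda>x y. f x < f y) xs \<and> set xs = A"
proof -
  interpret folding_insort_key "(\<le>)" "(<)" A f
    by unfold_locales (rule assms(1))
  show ?thesis
    using sorted_key_list_of_set_unique[OF subset_refl assms(2), of xs]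
      distinct_card[OF distinct_if_sorted_wrt_less[of f xs]]
    unfolding sorted_wrt_map by metis
qed

definition dagger_order :: "(int \<Rightarrow> real set) \<Rightarrow> nat \<Rightarrow> nat \<Rightarrow> (int \<times> nat) list" where
  "dagger_order \<xi> n M = sorted_key_list_of_set (\<lambda>(i, j). nth_point (\<xi> i) j)
     {(i, j) \<in> particles. \<bar>i\<bar> \<le> int M \<and> nth_point (\<xi> i) j \<le> real n}"

text \<open>
  Stated with counts up to rational times, so as to be measurable with respect to \<open>configurations\<close>
  without a study of \<open>nth_point\<close>, which is junk on finite configurations.
\<close>

definition sent_before :: "(int \<Rightarrow> real set) \<Rightarrow> int \<times> nat \<Rightarrow> int \<times> nat \<Rightarrow> bool" where
  "sent_before \<xi> p p' \<longleftrightarrow> (\<exists>q::rat. snd p \<le> card (\<xi> (fst p) \<inter> {0..real_of_rat q}) \<and>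
     card (\<xi> (fst p') \<inter> {0..real_of_rat q}) < snd p')"

text \<open>Common points are excluded up to time \<open>n\<close>, which covers all the particles
  that are sent.\<close>

locale point_configurations =
  fixes \<xi> :: "int \<Rightarrow> real set" and n :: nat
  assumes configurations: "\<And>i. infinite_configuration (\<xi> i)"
    and disj: "\<And>i k. i \<noteq> k \<Longrightarrow> \<xi> i \<inter> \<xi> k \<inter> {0..real n} = {}"
begin

abbreviation time :: "int \<times> nat \<Rightarrow> real" where
  "time \<equiv> \<lambda>(i, j). nth_point (\<xi> i) j"

definition sent_upto :: "nat \<Rightarrow> (int \<times> nat) set" where
  "sent_upto M = {(i, j) \<in> particles. \<bar>i\<bar> \<le> int M \<and> nth_point (\<xi> i) j \<le> real n}"

lemma sent_upto_eq: "sent_upto M = {(i, j). \<bar>i\<bar> \<le> int M \<and> 1 \<le> j \<and> j \<le> card (\<xi> i \<inter> {0..real n})}"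
proof -
  have "nth_point (\<xi> i) j \<le> real n \<longleftrightarrow> j \<le> card (\<xi> i \<inter> {0..real n})" if "1 \<le> j" for i j
    by (rule infinite_configuration.nth_point_le_iff[OF configurations that])
  then have "(i, j) \<in> sent_upto M \<longleftrightarrow> \<bar>i\<bar> \<le> int M \<and> 1 \<le> j \<and> j \<le> card (\<xi> i \<inter> {0..real n})" for i j
    unfolding sent_upto_def particles_def by (cases "1 \<le> j") simp_all
  then show ?thesis by (simp add: set_eq_iff)
qed

lemma finite_sent_upto: "finite (sent_upto M)"
proof (rule finite_subset)
  show "sent_upto M \<subseteq> Sigma {- int M..int M} (\<lambda>i. {1..card (\<xi> i \<inter> {0..real n})})"
  proof
    fix p assume "p \<in> sent_upto M"
    then have "\<bar>fst p\<bar> \<le> int M \<and> 1 \<le> snd p \<and> snd p \<le> card (\<xi> (fst p) \<inter> {0..real n})"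
      unfolding sent_upto_eq by (simp add: case_prod_beta)
    then show "p \<in> Sigma {- int M..int M} (\<lambda>i. {1..card (\<xi> i \<inter> {0..real n})})"
      by (cases p) (simp add: abs_le_iff)
  qed
qed simp

text \<open>Different levels have no common time by \<open>disj\<close>; within one level a time
  determines the rank \<open>j\<close> as the number of points up to it.\<close>

lemma inj_on_time: "inj_on time (sent_upto M)"
proof (rule inj_onI)
  fix p p' assume p: "p \<in> sent_upto M" "p' \<in> sent_upto M" and eq: "time p = time p'"
  obtain i j where "p = (i, j)" by (cases p)
  moreover obtain i' j' where "p' = (i', j')" by (cases p')
  ultimately have ij: "p = (i, j)" "p' = (i', j')" by simp_all
  have j: "1 \<le> j" "1 \<le> j'" "nth_point (\<xi> i) j \<le> real n"
    using p unfolding ij sent_upto_def particles_def by simp_all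
  note nth_in = infinite_configuration.nth_point_in[OF configurations]
    and card_nth = infinite_configuration.card_nth_point[OF configurations]
  have "nth_point (\<xi> i) j \<in> {0..real n}"
  proof -
    have "\<xi> i \<subseteq> {0..}"
      using infinite_configuration.conf[OF configurations, of i] by (simp add: space_configurations)
    then have "0 \<le> nth_point (\<xi> i) j" using nth_in[OF j(1), of i] by blast
    then show ?thesis using j(3) by simp
  qed
  moreover have "nth_point (\<xi> i) j \<in> \<xi> i" by (rule nth_in[OF j(1)])
  moreover have same: "nth_point (\<xi> i) j = nth_point (\<xi> i') j'" using eq unfolding ij by simp
  moreover have "nth_point (\<xi> i') j' \<in> \<xi> i'" by (rule nth_in[OF j(2)])
  ultimately have mem: "nth_point (\<xi> i) j \<in> \<xi> i \<inter> \<xi> i' \<inter> {0..real n}" by (simp only: Int_iff)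
  have "i = i'"
  proof (rule ccontr)
    assume "i \<noteq> i'"
    from disj[OF this] mem show False by (simp only: empty_iff)
  qed
  moreover have "j = j'"
  proof -
    have "j = card (\<xi> i \<inter> {..nth_point (\<xi> i) j})" by (rule card_nth[OF j(1), symmetric])
    also have "\<dots> = card (\<xi> i' \<inter> {..nth_point (\<xi> i') j'})"
      unfolding same unfolding \<open>i = i'\<close> ..
    also have "\<dots> = j'" by (rule card_nth[OF j(2)])
    finally show ?thesis .
  qed
  ultimately show "p = p'" unfolding ij by (simp only:)
qed

lemma dagger_order_iff:
  "dagger_order \<xi> n M = ps \<longleftrightarrow> sorted_wrt (\<lambda>p p'. time p < time p') ps \<and> set ps = sent_upto M"
proof -
  have "dagger_order \<xi> n M = sorted_key_list_of_set time (sent_upto M)"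
    by (simp only: dagger_order_def sent_upto_def)
  then show ?thesis
    using sorted_key_list_of_set_eq_iff[OF inj_on_time finite_sent_upto, of M ps] by (simp only:)
qed

text \<open>Some rational time \<open>q\<close> separates two distinct times: by then
  \<open>p\<close> has been sent and \<open>p'\<close> has not, both of which are visible in the
  counts.\<close>

lemma sent_before_iff:
  assumes "p \<in> particles" "p' \<in> particles"
  shows "sent_before \<xi> p p' \<longleftrightarrow> time p < time p'"
proof -
  have j: "1 \<le> snd p" "1 \<le> snd p'" using assms by (auto simp: particles_def)
  have t: "time p = nth_point (\<xi> (fst p)) (snd p)" "time p' = nth_point (\<xi> (fst p')) (snd p')"
    by (simp_all add: case_prod_beta)
  have "sent_before \<xi> p p' \<longleftrightarrow> (\<exists>q::rat. time p \<le> real_of_rat q \<and> real_of_rat q < time p')"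
    unfolding sent_before_def t
    using infinite_configuration.nth_point_le_iff[OF configurations j(1)]
      infinite_configuration.nth_point_le_iff[OF configurations j(2)]
    by (simp add: not_le[symmetric])
  also have "\<dots> \<longleftrightarrow> time p < time p'"
    using of_rat_dense[of "time p" "time p'"] by (meson less_imp_le order.strict_trans1)
  finally show ?thesis .
qed

text \<open>Countably many conditions on counts, hence a measurable description of the event that
  the order is \<open>ps\<close>.\<close>

lemma dagger_order_iff_counts:
  "dagger_order \<xi> n M = ps \<longleftrightarrow>
     (\<forall>i j. (i, j) \<in> set ps \<longleftrightarrow> \<bar>i\<bar> \<le> int M \<and> 1 \<le> j \<and> j \<le> card (\<xi> i \<inter> {0..real n})) \<and>
     (\<forall>k l. k < l \<longrightarrow> l < length ps \<longrightarrow> sent_before \<xi> (ps ! k) (ps ! l))"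
proof -
  have "set ps = sent_upto M \<longleftrightarrow>
      (\<forall>i j. (i, j) \<in> set ps \<longleftrightarrow> \<bar>i\<bar> \<le> int M \<and> 1 \<le> j \<and> j \<le> card (\<xi> i \<inter> {0..real n}))"
    unfolding sent_upto_eq by (simp add: set_eq_iff)
  moreover have "sorted_wrt (\<lambda>p p'. time p < time p') ps \<longleftrightarrow>
      (\<forall>k l. k < l \<longrightarrow> l < length ps \<longrightarrow> sent_before \<xi> (ps ! k) (ps ! l))" if "set ps = sent_upto M"
  proof -
    have "ps ! k \<in> particles" if "k < length ps" for k
      using nth_mem[OF that] \<open>set ps = sent_upto M\<close> by (auto simp: sent_upto_def)
    then have "sent_before \<xi> (ps ! k) (ps ! l) \<longleftrightarrow> time (ps ! k) < time (ps ! l)"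
      if "k < l" "l < length ps" for k l
      using sent_before_iff that by (meson order.strict_trans)
    then show ?thesis unfolding sorted_wrt_iff_nth_less by blast
  qed
  ultimately show ?thesis unfolding dagger_order_iff by blast
qed

lemma distinct_dagger_order: "distinct (dagger_order \<xi> n M)"
  using dagger_order_iff[of M "dagger_order \<xi> n M"] by (blast intro: distinct_if_sorted_wrt_less)

lemma set_dagger_order:
  "set (dagger_order \<xi> n M) = {(i, j). \<bar>i\<bar> \<le> int M \<and> 1 \<le> j \<and> j \<le> card (\<xi> i \<inter> {0..real n})}"
  using dagger_order_iff[of M "dagger_order \<xi> n M"] unfolding sent_upto_eq by blast

text \<open>New particles may be sent between old ones, so the old list need not be a prefix.
  Deleting the two outermost levels from the longer list leaves a sorted list with the right
  entries, which by uniqueness is the shorter one.\<close>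

lemma subseq_dagger_order: "subseq (dagger_order \<xi> n M) (dagger_order \<xi> n (Suc M))"
proof -
  let ?ps = "dagger_order \<xi> n (Suc M)"
  have "sorted_wrt (\<lambda>p p'. time p < time p') ?ps \<and> set ?ps = sent_upto (Suc M)"
    using dagger_order_iff by blast
  then have "dagger_order \<xi> n M = filter (\<lambda>p. \<bar>fst p\<bar> \<le> int M) ?ps"
    unfolding dagger_order_iff by (auto intro: sorted_wrt_filter simp: sent_upto_eq)
  then show ?thesis by simp
qed

end

lemma level_count_measurable:
  assumes "B \<in> bounded_borel"
  shows "(\<lambda>\<xi>. card (\<xi> i \<inter> B)) \<in> PiM UNIV (\<lambda>_. configurations) \<rightarrow>\<^sub>M count_space UNIV"
proof -
  have "(\<lambda>\<xi>. \<xi> i) \<in> PiM UNIV (\<lambda>_. configurations) \<rightarrow>\<^sub>M configurations"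
    by (rule measurable_component_singleton) simp
  from measurable_compose[OF this card_configuration_measurable[OF assms]] show ?thesis .
qed

lemma sent_before_measurable:
  "Measurable.pred (PiM UNIV (\<lambda>_. configurations)) (\<lambda>\<xi>. sent_before \<xi> p p')"
proof -
  have [measurable]: "(\<lambda>\<xi>. card (\<xi> i \<inter> {0..t})) \<in> PiM UNIV (\<lambda>_. configurations) \<rightarrow>\<^sub>M count_space UNIV"
    for i :: int and t :: real
    by (rule level_count_measurable) (simp add: Icc_bounded_borel)
  show ?thesis unfolding sent_before_def by measurable
qed

lemma dagger_emission:
  assumes P: "prob_space P" and S: "independent_walks P S" and n: "1 \<le> n"
    and \<Xi>: "poisson_clocks P S \<Xi>"
  shows "\<exists>\<Omega>. emission P (\<lambda>i \<omega>. card (\<Xi> i \<omega> \<inter> {0..real n})) n S (\<lambda>M \<omega>. dagger_order (\<lambda>i. \<Xi> i \<omega>) n M) \<Omega>"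
proof -
  interpret prob_space P by fact
  let ?N = "\<lambda>i \<omega>. card (\<Xi> i \<omega> \<inter> {0..real n})"
  have proc: "poisson_process P (\<Xi> i)" and ind: "indep_vars (\<lambda>_. configurations) \<Xi> UNIV"
    and iw: "indep_of_walks P S configurations \<Xi>" for i
    using \<Xi> by (auto simp: poisson_clocks_def)
  have B: "{0..real n} \<in> bounded_borel" by (rule Icc_bounded_borel) simp
  have src: "poisson_sources P ?N n"
  proof
    show "poisson_distributed P (?N i) (real n)" for i
      using proc[of i] B by (fastforce simp: poisson_process_def)
    show "indep_vars (\<lambda>_. count_space UNIV) ?N UNIV"
      by (rule indep_vars_compose2[OF ind]) (rule card_configuration_measurable[OF B])
  qed (rule n)
  let ?\<V> = "sets (vimage_algebra (space P) (\<lambda>\<omega> i. \<Xi> i \<omega>) (PiM UNIV (\<lambda>_. configurations)))"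
  \<comment> \<open>A measurable condition on arbitrary configurations; it is only claimed to
    describe \<open>dagger_order\<close> on the almost sure event that the clocks are infinite and
    have no common point up to time \<open>n\<close>.\<close>
  define cond where "cond M ps \<xi> \<longleftrightarrow>
     (\<forall>i j. (i, j) \<in> set ps \<longleftrightarrow> \<bar>i\<bar> \<le> int M \<and> 1 \<le> j \<and> j \<le> card (\<xi> i \<inter> {0..real n})) \<and>
     (\<forall>k l. k < l \<longrightarrow> l < length ps \<longrightarrow> sent_before \<xi> (ps ! k) (ps ! l))"
    for M :: nat and ps :: "(int \<times> nat) list" and \<xi>
  let ?E = "\<lambda>M ps. (\<lambda>\<omega> i. \<Xi> i \<omega>) -` {\<xi> \<in> space (PiM UNIV (\<lambda>_. configurations)). cond M ps \<xi>} \<inter> space P"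
  show ?thesis
  proof (rule emissionI[OF src S indep_of_walks_events[OF iw], of ?E])
    fix M ps
    have [measurable]: "(\<lambda>\<xi>. card (\<xi> i \<inter> {0..real n})) \<in> PiM UNIV (\<lambda>_. configurations) \<rightarrow>\<^sub>M count_space UNIV"
      for i :: int
      by (rule level_count_measurable[OF B])
    note sent_before_measurable[measurable]
    have "{\<xi> \<in> space (PiM UNIV (\<lambda>_. configurations)). cond M ps \<xi>} \<in> sets (PiM UNIV (\<lambda>_. configurations))"
      unfolding cond_def by measurable
    then show "?E M ps \<in> ?\<V>" by (rule in_vimage_algebra)
  next
    have "AE \<omega> in P. \<forall>i. infinite (\<Xi> i \<omega>)"
      unfolding AE_all_countable using poisson_process_infinite[OF P proc] by blast
    moreover have "AE \<omega> in P. \<forall>i k. i \<noteq> k \<longrightarrow> \<Xi> i \<omega> \<inter> \<Xi> k \<omega> \<inter> {0..real n} = {}"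
    proof -
      have "AE \<omega> in P. i \<noteq> k \<longrightarrow> \<Xi> i \<omega> \<inter> \<Xi> k \<omega> \<inter> {0..real n} = {}" for i k
        using AE_disjoint_poisson_processes[OF P proc ind, of i k n] by (cases "i = k") auto
      then show ?thesis unfolding AE_all_countable by blast
    qed
    ultimately show "AE \<omega> in P. \<forall>M. (\<forall>ps. \<omega> \<in> ?E M ps \<longleftrightarrow> dagger_order (\<lambda>i. \<Xi> i \<omega>) n M = ps) \<and>
        distinct (dagger_order (\<lambda>i. \<Xi> i \<omega>) n M) \<and>
        set (dagger_order (\<lambda>i. \<Xi> i \<omega>) n M) = {(i, j). \<bar>i\<bar> \<le> int M \<and> 1 \<le> j \<and> j \<le> ?N i \<omega>} \<and>
        subseq (dagger_order (\<lambda>i. \<Xi> i \<omega>) n M) (dagger_order (\<lambda>i. \<Xi> i \<omega>) n (Suc M))"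
      using AE_space
    proof eventually_elim
      case (elim \<omega>)
      have conf: "\<Xi> i \<omega> \<in> space configurations" for i
      proof -
        have "\<Xi> i \<in> P \<rightarrow>\<^sub>M configurations" using proc[of i] by (simp add: poisson_process_def)
        from measurable_space[OF this elim(3)] show ?thesis .
      qed
      interpret point_configurations "\<lambda>i. \<Xi> i \<omega>" n
        by unfold_locales (use elim conf in auto)
      have "(\<lambda>i. \<Xi> i \<omega>) \<in> space (PiM UNIV (\<lambda>_. configurations))"
        by (simp add: space_PiM PiE_iff conf)
      then have "\<omega> \<in> ?E M ps \<longleftrightarrow> cond M ps (\<lambda>i. \<Xi> i \<omega>)" for M ps
        using elim(3) by blast
      moreover have "cond M ps (\<lambda>i. \<Xi> i \<omega>) \<longleftrightarrow> dagger_order (\<lambda>i. \<Xi> i \<omega>) n M = ps" for M ps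
        unfolding cond_def dagger_order_iff_counts ..
      ultimately show ?case
        using distinct_dagger_order set_dagger_order subseq_dagger_order by blast
    qed
  qed
qed

theorem corollary5p2:
  fixes P :: "'a measure"
    and S :: "int \<Rightarrow> nat \<Rightarrow> 'a \<Rightarrow> path"
    and n :: nat
  assumes "prob_space P"
    and "independent_walks P S"
    and "n \<ge> 1"
  shows "(\<forall>N. poisson_levels P S (real n) N \<longrightarrow>
            (AE \<omega> in P. \<forall>M::int.
               infinite {i. i \<ge> M \<and> misses_level (star_aggregate (\<lambda>i j. S i j \<omega>) (\<lambda>i. N i \<omega>)) i} \<and>
               infinite {j. j \<le> - M \<and> misses_level (star_aggregate (\<lambda>i j. S i j \<omega>) (\<lambda>i. N i \<omega>)) j}) \<and>
            (AE \<omega> in P.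
               (\<forall>C \<in> lattice_components (star_aggregate (\<lambda>i j. S i j \<omega>) (\<lambda>i. N i \<omega>)). finite C) \<and>
               components_in_disjoint_strips (star_aggregate (\<lambda>i j. S i j \<omega>) (\<lambda>i. N i \<omega>))))
       \<and> (\<forall>\<Xi>. poisson_clocks P S \<Xi> \<longrightarrow>
            (AE \<omega> in P. \<forall>M::int.
               infinite {i. i \<ge> M \<and> misses_level
                 (dagger_aggregate (\<lambda>i j. S i j \<omega>) (\<lambda>i j. nth_point (\<Xi> i \<omega>) j) (real n)) i} \<and>
               infinite {j. j \<le> - M \<and> misses_level
                 (dagger_aggregate (\<lambda>i j. S i j \<omega>) (\<lambda>i j. nth_point (\<Xi> i \<omega>) j) (real n)) j}) \<and>
            (AE \<omega> in P.
               (\<forall>C \<in> lattice_components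
                  (dagger_aggregate (\<lambda>i j. S i j \<omega>) (\<lambda>i j. nth_point (\<Xi> i \<omega>) j) (real n)). finite C) \<and>
               components_in_disjoint_strips
                  (dagger_aggregate (\<lambda>i j. S i j \<omega>) (\<lambda>i j. nth_point (\<Xi> i \<omega>) j) (real n))))"
proof (intro conjI[where P = "\<forall>N. _ N"] allI impI)
  fix N
  assume "poisson_levels P S (real n) N"
  from star_emission[OF assms this] obtain \<Omega> where
    "emission P N n S (\<lambda>M \<omega>. star_order (\<lambda>i. N i \<omega>) (usual_levels M)) \<Omega>" by blast
  then interpret emission P N n S "\<lambda>M \<omega>. star_order (\<lambda>i. N i \<omega>) (usual_levels M)" \<Omega> .
  have "agg \<omega> = star_aggregate (\<lambda>i j. S i j \<omega>) (\<lambda>i. N i \<omega>)" for \<omega>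
    unfolding agg_def agg_upto_def
    unfolding star_aggregate_def star_aggregate_upto_def star_order_def ..
  then show "(AE \<omega> in P. \<forall>M::int.
               infinite {i. i \<ge> M \<and> misses_level (star_aggregate (\<lambda>i j. S i j \<omega>) (\<lambda>i. N i \<omega>)) i} \<and>
               infinite {j. j \<le> - M \<and> misses_level (star_aggregate (\<lambda>i j. S i j \<omega>) (\<lambda>i. N i \<omega>)) j}) \<and>
            (AE \<omega> in P.
               (\<forall>C \<in> lattice_components (star_aggregate (\<lambda>i j. S i j \<omega>) (\<lambda>i. N i \<omega>)). finite C) \<and>
               components_in_disjoint_strips (star_aggregate (\<lambda>i j. S i j \<omega>) (\<lambda>i. N i \<omega>)))"
    using AE_infinitely_many_missed AE_components by (simp only: simp_thms)
next
  fix \<Xi>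
  assume "poisson_clocks P S \<Xi>"
  from dagger_emission[OF assms this] obtain \<Omega> where
    "emission P (\<lambda>i \<omega>. card (\<Xi> i \<omega> \<inter> {0..real n})) n S (\<lambda>M \<omega>. dagger_order (\<lambda>i. \<Xi> i \<omega>) n M) \<Omega>" by blast
  then interpret emission P "\<lambda>i \<omega>. card (\<Xi> i \<omega> \<inter> {0..real n})" n S
    "\<lambda>M \<omega>. dagger_order (\<lambda>i. \<Xi> i \<omega>) n M" \<Omega> .
  have "agg \<omega> = dagger_aggregate (\<lambda>i j. S i j \<omega>) (\<lambda>i j. nth_point (\<Xi> i \<omega>) j) (real n)" for \<omega>
    unfolding agg_def agg_upto_def
    unfolding dagger_aggregate_def dagger_aggregate_upto_def dagger_order_def ..
  then show "(AE \<omega> in P. \<forall>M::int.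
               infinite {i. i \<ge> M \<and> misses_level
                 (dagger_aggregate (\<lambda>i j. S i j \<omega>) (\<lambda>i j. nth_point (\<Xi> i \<omega>) j) (real n)) i} \<and>
               infinite {j. j \<le> - M \<and> misses_level
                 (dagger_aggregate (\<lambda>i j. S i j \<omega>) (\<lambda>i j. nth_point (\<Xi> i \<omega>) j) (real n)) j}) \<and>
            (AE \<omega> in P.
               (\<forall>C \<in> lattice_components
                  (dagger_aggregate (\<lambda>i j. S i j \<omega>) (\<lambda>i j. nth_point (\<Xi> i \<omega>) j) (real n)). finite C) \<and>
               components_in_disjoint_strips
                  (dagger_aggregate (\<lambda>i j. S i j \<omega>) (\<lambda>i j. nth_point (\<Xi> i \<omega>) j) (real n)))"
    using AE_infinitely_many_missed AE_components by (simp only: simp_thms)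
qed

end
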